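(* Let $(M^n,g)$ be a Riemannian manifold of dimension $n\geq 4$, let $\phi:M\to\mathbb{R}$ be smooth, $\psi=e^\phi$ and $\overline{g}=\psi^{-2}g$. Let $C_{\mathbb{T}}$ be the $(0,3)$ tensor associated with $g$ and $\overline{C}_{\overline{\mathbb{T}}}$ the corresponding $(0,3)$ tensor associated with $\overline{g}$. Then $\overline{C}_{\overline{\mathbb{T}}}=C_{\mathbb{T}}$ holds on $M_{\mathcal{E}}$.
   Context: Let $(M^n,g)$ be a smooth Riemannian manifold, $n\ge 4$, with Levi-Civita connection $\nabla$. Curvature conventions: $R(X,Y,Z,T)=g(\nabla_X\nabla_YZ-\nabla_Y\nabla_XZ-\nabla_{[X,Y]}Z,T)$, $\mathrm{Ric}(X,Y)=\mathrm{trace}\{V\mapsto R_{V,X}Y\}$, $S=\mathrm{trace}(\mathrm{Ric})$. The Kulkarni--Nomizu product is $(g\odot h)(X,Y,Z,T)=g(X,T)h(Y,Z)+g(Y,Z)h(X,T)-g(X,Z)h(Y,T)-g(Y,T)h(X,Z)$, the Schouten tensor is $\mathfrak{k}=\frac{1}{n-2}\left(\mathrm{Ric}-\frac{1}{2(n-1)}Sg\right)$ and the Weyl tensor is the $(0,4)$ tensor $W=R-g\odot\mathfrak{k}$. For a vector field or vector $Y$, $Y^*=g(Y,\cdot)$. The Weyl tensor acts on $(0,2)$ tensors by $\mathcal{W}(X^*\otimes Y^* )(Z,T)=W(Y,Z,T,X)$; in particular $\mathcal{W}$ restricts to an endomorphism of $\Lambda^2(T^*M)$ with $\mathcal{W}(X^*\wedge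 Y^* )(Z,T)=W(X,Y,Z,T)$, where $X^*\wedge Y^*=X^*\otimes Y^*-Y^*\otimes X^*$. $X\llcorner\eta=\eta(X,\cdot)$ denotes contraction in the first slot. $\mathcal{E}_p=\{v\in T_pM : W(v,\cdot,\cdot,\cdot)=0\}$, and $M_{\mathcal{E}}$ is the set of all $p\in M$ at which $q\mapsto\dim\mathcal{E}_q$ is locally constant; it is open and dense in $M$. Both $\mathcal{E}$ and $M_{\mathcal{E}}$ are the same for $g$ and $\overline g$. $\mathfrak{w}:T^*M\to T^*M$ is the $g$-symmetric endomorphism $\mathfrak{w}(\theta)=\sum_{i=1}^n e_i\llcorner\mathcal{W}^2(e_i^*\wedge\theta)$, where $\mathcal{W}^2=\mathcal{W}\circ\mathcal{W}$ on $\Lambda^2(T^*M)$ and $e_1,\dots,e_n$ is a $g$-orthonormal basis of $T_pM$. $\mathfrak{w}^{\#}$ is its pointwise Moore--Penrose inverse (inverse of $\mathfrak{w}$ on $\mathrm{Im}(\mathfrak{w})$, zero on $\mathrm{Ker}(\mathfrak{w})$), which is smooth on $M_{\mathcal{E}}$. $\delta W(X,Y,Z)=\sum_j(\nabla_{e_j}W)(X,Y,Z,e_j)$, and $\delta W_Z$ is the two-form $\delta W_Z(X,Y)=\delta W(X,Y,Z)$. The smooth vector field $\mathbb{T}$ on $M_{\mathcal{E}}$ is defined by $$g(\mathbb{T},\cdot)=\frac{1}{n-3}\,\mathfrak{w}^{\#}\Bigl(\sum_{i=1}^n e_i\llcorner\mathcal{W}(\delta W_{e_i})\Bigr).$$ For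 a symmetric $(0,2)$ tensor $b$, $\mathrm{d}^{\nabla}b(X,Y,Z)=(\nabla_Xb)(Y,Z)-(\nabla_Yb)(X,Z)$. On $M_{\mathcal{E}}$ one sets $$C_{\mathbb{T}}=\mathrm{d}^{\nabla}\mathfrak{k}-W(\cdot,\cdot,\cdot,\mathbb{T}).$$ Overlined symbols ($\overline{\mathbb{T}}$, $\overline{C}_{\overline{\mathbb{T}}}$, ...) denote the objects defined in the same way from the metric $\overline g$. *)

theory Defs
  imports "HOL-Analysis.Analysis"
begin

section \<open>Smooth maps between Euclidean spaces\<close>

primrec Ck_on :: "nat \<Rightarrow> 'a::euclidean_space set \<Rightarrow> ('a \<Rightarrow> 'b::real_normed_vector) \<Rightarrow> bool" where
  "Ck_on 0 S f \<longleftrightarrow> continuous_on S f"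
| "Ck_on (Suc k) S f \<longleftrightarrow> (\<forall>x\<in>S. f differentiable (at x)) \<and>
     (\<forall>v. Ck_on k S (\<lambda>x. frechet_derivative f (at x) v))"

text \<open>Used only for open \<open>S\<close>.\<close>

definition smooth_on :: "'a::euclidean_space set \<Rightarrow> ('a \<Rightarrow> 'b::real_normed_vector) \<Rightarrow> bool" where
  "smooth_on S f \<longleftrightarrow> (\<forall>k. Ck_on k S f)"


section \<open>Smooth manifolds and their tangent spaces\<close>

text \<open>The manifold is the whole type \<open>'m\<close>; its dimension is \<open>CARD('n)\<close>. A chart is a pair
  \<open>(U, f)\<close> of an open domain and a coordinate map (whose values outside \<open>U\<close> are irrelevant).\<close>

type_synonym ('m, 'n) chart = "'m set \<times> ('m \<Rightarrow> real ^ 'n)"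

definition chart_inv :: "('m, 'n) chart \<Rightarrow> real ^ 'n \<Rightarrow> 'm" where
  "chart_inv c = inv_into (fst c) (snd c)"

definition smooth_atlas ::
  "('m::{t2_space, second_countable_topology}, 'n::finite) chart set \<Rightarrow> bool" where
  "smooth_atlas A \<longleftrightarrow>
     (\<Union>c\<in>A. fst c) = UNIV \<and>
     (\<forall>c\<in>A. open (fst c) \<and> open (snd c ` fst c) \<and>
        homeomorphism (fst c) (snd c ` fst c) (snd c) (chart_inv c)) \<and>
     (\<forall>c\<in>A. \<forall>d\<in>A. smooth_on (snd c ` (fst c \<inter> fst d)) (snd d \<circ> chart_inv c))"

text \<open>Every point has a preferred chart around it, and \<open>T\<^sub>pM\<close> is identified with \<open>real ^ 'n\<close> by means
  of it: \<open>v :: real ^ 'n\<close>, regarded as an element of \<open>T\<^sub>pM\<close>, is the tangent vector whose components in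
  the preferred chart at \<open>p\<close> are those of \<open>v\<close>. Vector and tensor fields are functions of \<open>p\<close> with
  values in (multilinear forms on) \<open>real ^ 'n\<close>. They are never compared at different points
  directly: comparison and differentiation always go through components in one single chart.\<close>

definition chart_at :: "('m, 'n) chart set \<Rightarrow> 'm \<Rightarrow> ('m, 'n) chart" where
  "chart_at A p = (SOME c. c \<in> A \<and> p \<in> fst c)"

definition chart_components ::
  "('m, 'n::finite) chart set \<Rightarrow> ('m, 'n) chart \<Rightarrow> 'm \<Rightarrow> real ^ 'n \<Rightarrow> real ^ 'n" where
  \<comment> \<open>components in the chart \<open>c\<close> of \<open>v \<in> T\<^sub>pM\<close>\<close>
  "chart_components A c p v =
     frechet_derivative (snd c \<circ> chart_inv (chart_at A p)) (at (snd (chart_at A p) p)) v"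

definition chart_vector ::
  "('m, 'n::finite) chart set \<Rightarrow> ('m, 'n) chart \<Rightarrow> 'm \<Rightarrow> real ^ 'n \<Rightarrow> real ^ 'n" where
  \<comment> \<open>the element of \<open>T\<^sub>pM\<close> whose components in the chart \<open>c\<close> are \<open>\<xi>\<close>\<close>
  "chart_vector A c p \<xi> = frechet_derivative (snd (chart_at A p) \<circ> chart_inv c) (at (snd c p)) \<xi>"

definition smooth_fun_on :: "('m, 'n::finite) chart set \<Rightarrow> 'm set \<Rightarrow> ('m \<Rightarrow> real) \<Rightarrow> bool" where
  "smooth_fun_on A U f \<longleftrightarrow> (\<forall>c\<in>A. smooth_on (snd c ` (U \<inter> fst c)) (f \<circ> chart_inv c))"

definition field_components ::
  "('m, 'n::finite) chart set \<Rightarrow> ('m, 'n) chart \<Rightarrow> ('m \<Rightarrow> real ^ 'n) \<Rightarrow> real ^ 'n \<Rightarrow> real ^ 'n" where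
  "field_components A c X y = chart_components A c (chart_inv c y) (X (chart_inv c y))"

definition smooth_field_on :: "('m, 'n::finite) chart set \<Rightarrow> 'm set \<Rightarrow> ('m \<Rightarrow> real ^ 'n) \<Rightarrow> bool" where
  "smooth_field_on A U X \<longleftrightarrow> (\<forall>c\<in>A. smooth_on (snd c ` (U \<inter> fst c)) (field_components A c X))"

definition smooth_fun_near ::
  "('m::topological_space, 'n::finite) chart set \<Rightarrow> 'm \<Rightarrow> ('m \<Rightarrow> real) \<Rightarrow> bool" where
  "smooth_fun_near A p f \<longleftrightarrow> (\<exists>U. open U \<and> p \<in> U \<and> smooth_fun_on A U f)"

definition smooth_field_near ::
  "('m::topological_space, 'n::finite) chart set \<Rightarrow> 'm \<Rightarrow> ('m \<Rightarrow> real ^ 'n) \<Rightarrow> bool" where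
  "smooth_field_near A p X \<longleftrightarrow> (\<exists>U. open U \<and> p \<in> U \<and> smooth_field_on A U X)"

definition dir_deriv :: "('m, 'n::finite) chart set \<Rightarrow> 'm \<Rightarrow> real ^ 'n \<Rightarrow> ('m \<Rightarrow> real) \<Rightarrow> real" where
  "dir_deriv A p v f =
     frechet_derivative (f \<circ> chart_inv (chart_at A p)) (at (snd (chart_at A p) p)) v"

definition lie_bracket ::
  "('m, 'n::finite) chart set \<Rightarrow> ('m \<Rightarrow> real ^ 'n) \<Rightarrow> ('m \<Rightarrow> real ^ 'n) \<Rightarrow> 'm \<Rightarrow> real ^ 'n" where
  "lie_bracket A X Y p = (let c = chart_at A p in
     frechet_derivative (field_components A c Y) (at (snd c p)) (X p) -
     frechet_derivative (field_components A c X) (at (snd c p)) (Y p))"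

definition extend :: "('m, 'n::finite) chart set \<Rightarrow> 'm \<Rightarrow> real ^ 'n \<Rightarrow> 'm \<Rightarrow> real ^ 'n" where
  \<comment> \<open>a vector field, smooth near \<open>p\<close>, with value \<open>v\<close> at \<open>p\<close>: the one with constant components in
    the preferred chart at \<open>p\<close>. It is only used in expressions that are tensorial, i.e. that
    depend on the values of the fields at \<open>p\<close> alone.\<close>
  "extend A p v = (\<lambda>q. chart_vector A (chart_at A p) q v)"


section \<open>Riemannian metrics and the Levi-Civita connection\<close>

type_synonym ('m, 'n) metric = "'m \<Rightarrow> real ^ 'n \<Rightarrow> real ^ 'n \<Rightarrow> real"

definition riemannian_metric ::
  "('m::topological_space, 'n::finite) chart set \<Rightarrow> ('m, 'n) metric \<Rightarrow> bool" where
  "riemannian_metric A g \<longleftrightarrow>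
     (\<forall>p. bilinear (g p)) \<and>
     (\<forall>p v w. g p v w = g p w v) \<and>
     (\<forall>p v. v \<noteq> 0 \<longrightarrow> g p v v > 0) \<and>
     (\<forall>U X Y. open U \<longrightarrow> smooth_field_on A U X \<longrightarrow> smooth_field_on A U Y \<longrightarrow>
        smooth_fun_on A U (\<lambda>q. g q (X q) (Y q)))"

text \<open>A connection takes a point \<open>p\<close>, a vector \<open>v \<in> T\<^sub>pM\<close> and a vector field \<open>Y\<close> defined and smooth near
  \<open>p\<close>, and returns \<open>\<nabla>\<^sub>v Y \<in> T\<^sub>pM\<close>; for vector fields, \<open>(\<nabla>\<^sub>X Y)\<^sub>p = D p (X p) Y\<close>. Nothing is required
  for \<open>Y\<close> that are not smooth near \<open>p\<close>. That \<open>D p v Y\<close> depends only on the germ of \<open>Y\<close> at \<open>p\<close> follows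
  from the product rule, applied to functions \<open>f\<close> that are locally constant near \<open>p\<close>.\<close>

type_synonym ('m, 'n) connection = "'m \<Rightarrow> real ^ 'n \<Rightarrow> ('m \<Rightarrow> real ^ 'n) \<Rightarrow> real ^ 'n"

definition affine_connection ::
  "('m::topological_space, 'n::finite) chart set \<Rightarrow> ('m, 'n) connection \<Rightarrow> bool" where
  "affine_connection A D \<longleftrightarrow>
     (\<forall>p Y. smooth_field_near A p Y \<longrightarrow> linear (\<lambda>v. D p v Y)) \<and>
     (\<forall>p v Y Z. smooth_field_near A p Y \<longrightarrow> smooth_field_near A p Z \<longrightarrow>
        D p v (\<lambda>q. Y q + Z q) = D p v Y + D p v Z) \<and>
     (\<forall>p v f Y. smooth_fun_near A p f \<longrightarrow> smooth_field_near A p Y \<longrightarrow>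
        D p v (\<lambda>q. f q *\<^sub>R Y q) = dir_deriv A p v f *\<^sub>R Y p + f p *\<^sub>R D p v Y) \<and>
     (\<forall>U X Y. open U \<longrightarrow> smooth_field_on A U X \<longrightarrow> smooth_field_on A U Y \<longrightarrow>
        smooth_field_on A U (\<lambda>q. D q (X q) Y))"

definition levi_civita ::
  "('m::topological_space, 'n::finite) chart set \<Rightarrow> ('m, 'n) metric \<Rightarrow> ('m, 'n) connection \<Rightarrow> bool" where
  "levi_civita A g D \<longleftrightarrow>
     affine_connection A D \<and>
     (\<forall>p X Y. smooth_field_near A p X \<longrightarrow> smooth_field_near A p Y \<longrightarrow>
        D p (X p) Y - D p (Y p) X = lie_bracket A X Y p) \<and>
     (\<forall>p v Y Z. smooth_field_near A p Y \<longrightarrow> smooth_field_near A p Z \<longrightarrow>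
        dir_deriv A p v (\<lambda>q. g q (Y q) (Z q)) = g p (D p v Y) (Z p) + g p (Y p) (D p v Z))"

definition orthonormal_frame :: "('m, 'n::finite) metric \<Rightarrow> 'm \<Rightarrow> 'n \<Rightarrow> real ^ 'n" where
  \<comment> \<open>some \<open>g\<close>-orthonormal basis of \<open>T\<^sub>pM\<close>; there is no continuity in \<open>p\<close>\<close>
  "orthonormal_frame g p = (SOME e. \<forall>i j. g p (e i) (e j) = (if i = j then 1 else 0))"


section \<open>Covariant tensors and curvature\<close>

type_synonym ('m, 'n) tensor2 = "'m \<Rightarrow> real ^ 'n \<Rightarrow> real ^ 'n \<Rightarrow> real"
type_synonym ('m, 'n) tensor3 = "'m \<Rightarrow> real ^ 'n \<Rightarrow> real ^ 'n \<Rightarrow> real ^ 'n \<Rightarrow> real"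
type_synonym ('m, 'n) tensor4 = "'m \<Rightarrow> real ^ 'n \<Rightarrow> real ^ 'n \<Rightarrow> real ^ 'n \<Rightarrow> real ^ 'n \<Rightarrow> real"

definition cov_deriv2 ::
  "('m, 'n::finite) chart set \<Rightarrow> ('m, 'n) connection \<Rightarrow> ('m, 'n) tensor2 \<Rightarrow> ('m, 'n) tensor3" where
  "cov_deriv2 A D b p v y z = (let Y = extend A p y; Z = extend A p z in
     dir_deriv A p v (\<lambda>q. b q (Y q) (Z q)) - b p (D p v Y) z - b p y (D p v Z))"

definition cov_deriv4 ::
  "('m, 'n::finite) chart set \<Rightarrow> ('m, 'n) connection \<Rightarrow> ('m, 'n) tensor4 \<Rightarrow>
    'm \<Rightarrow> real ^ 'n \<Rightarrow> real ^ 'n \<Rightarrow> real ^ 'n \<Rightarrow> real ^ 'n \<Rightarrow> real ^ 'n \<Rightarrow> real" where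
  "cov_deriv4 A D B p v x y z t =
     (let X = extend A p x; Y = extend A p y; Z = extend A p z; T = extend A p t in
      dir_deriv A p v (\<lambda>q. B q (X q) (Y q) (Z q) (T q))
      - B p (D p v X) y z t - B p x (D p v Y) z t - B p x y (D p v Z) t - B p x y z (D p v T))"

definition d_nabla ::
  "('m, 'n::finite) chart set \<Rightarrow> ('m, 'n) connection \<Rightarrow> ('m, 'n) tensor2 \<Rightarrow> ('m, 'n) tensor3" where
  "d_nabla A D b p x y z = cov_deriv2 A D b p x y z - cov_deriv2 A D b p y x z"

definition curvature_op ::
  "('m, 'n::finite) chart set \<Rightarrow> ('m, 'n) connection \<Rightarrow>
    'm \<Rightarrow> real ^ 'n \<Rightarrow> real ^ 'n \<Rightarrow> real ^ 'n \<Rightarrow> real ^ 'n" where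
  "curvature_op A D p x y z = (let X = extend A p x; Y = extend A p y; Z = extend A p z in
     D p (X p) (\<lambda>q. D q (Y q) Z) - D p (Y p) (\<lambda>q. D q (X q) Z) - D p (lie_bracket A X Y p) Z)"

definition riemann ::
  "('m, 'n::finite) chart set \<Rightarrow> ('m, 'n) metric \<Rightarrow> ('m, 'n) connection \<Rightarrow> ('m, 'n) tensor4" where
  "riemann A g D p x y z t = g p (curvature_op A D p x y z) t"

definition ricci :: "('m, 'n::finite) chart set \<Rightarrow> ('m, 'n) connection \<Rightarrow> ('m, 'n) tensor2" where
  "ricci A D p x y = trace (matrix (\<lambda>v. curvature_op A D p v x y))"

definition scalar_curvature ::
  "('m, 'n::finite) chart set \<Rightarrow> ('m, 'n) metric \<Rightarrow> ('m, 'n) connection \<Rightarrow> 'm \<Rightarrow> real" where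
  "scalar_curvature A g D p =
     (\<Sum>i\<in>UNIV. ricci A D p (orthonormal_frame g p i) (orthonormal_frame g p i))"

definition kulkarni_nomizu ::
  "('m, 'n::finite) tensor2 \<Rightarrow> ('m, 'n) tensor2 \<Rightarrow> ('m, 'n) tensor4" where
  "kulkarni_nomizu g h p x y z t =
     g p x t * h p y z + g p y z * h p x t - g p x z * h p y t - g p y t * h p x z"

definition schouten ::
  "('m, 'n::finite) chart set \<Rightarrow> ('m, 'n) metric \<Rightarrow> ('m, 'n) connection \<Rightarrow> ('m, 'n) tensor2" where
  "schouten A g D p x y = (let n = real CARD('n) in
     1 / (n - 2) * (ricci A D p x y - 1 / (2 * (n - 1)) * scalar_curvature A g D p * g p x y))"

definition weyl ::
  "('m, 'n::finite) chart set \<Rightarrow> ('m, 'n) metric \<Rightarrow> ('m, 'n) connection \<Rightarrow> ('m, 'n) tensor4" where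
  "weyl A g D p x y z t =
     riemann A g D p x y z t - kulkarni_nomizu g (schouten A g D) p x y z t"

definition weyl_nullity ::
  "('m, 'n::finite) chart set \<Rightarrow> ('m, 'n) metric \<Rightarrow> ('m, 'n) connection \<Rightarrow> 'm \<Rightarrow> (real ^ 'n) set" where
  "weyl_nullity A g D p = {v. \<forall>x y z. weyl A g D p v x y z = 0}"

definition M_E ::
  "('m::topological_space, 'n::finite) chart set \<Rightarrow> ('m, 'n) metric \<Rightarrow> ('m, 'n) connection \<Rightarrow> 'm set" where
  "M_E A g D =
     {p. \<exists>U. open U \<and> p \<in> U \<and> (\<forall>q\<in>U. dim (weyl_nullity A g D q) = dim (weyl_nullity A g D p))}"


section \<open>The field \<open>\<T>\<close> and the tensor \<open>C\<^sub>T\<close>\<close>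

text \<open>The linear extension of \<open>X\<^sup>* \<otimes> Y\<^sup>* \<mapsto> W(Y,\<cdot>,\<cdot>,X)\<close> to all \<open>(0,2)\<close> tensors
  \<open>b = (\<Sum>i j. b(e\<^sub>i, e\<^sub>j) e\<^sub>i\<^sup>* \<otimes> e\<^sub>j\<^sup>*)\<close> on \<open>T\<^sub>pM\<close>.\<close>

definition weyl_action ::
  "('m, 'n::finite) chart set \<Rightarrow> ('m, 'n) metric \<Rightarrow> ('m, 'n) connection \<Rightarrow> 'm \<Rightarrow>
    (real ^ 'n \<Rightarrow> real ^ 'n \<Rightarrow> real) \<Rightarrow> real ^ 'n \<Rightarrow> real ^ 'n \<Rightarrow> real" where
  "weyl_action A g D p b z t = (let e = orthonormal_frame g p in
     \<Sum>i\<in>UNIV. \<Sum>j\<in>UNIV. b (e i) (e j) * weyl A g D p (e j) z t (e i))"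

text \<open>\<open>T\<^sub>p\<^sup>*M\<close> is the dual space \<open>(real ^ 'n) \<Rightarrow>\<^sub>L real\<close>.\<close>

definition flat :: "('m, 'n::finite) metric \<Rightarrow> 'm \<Rightarrow> real ^ 'n \<Rightarrow> (real ^ 'n) \<Rightarrow>\<^sub>L real" where
  "flat g p v = Blinfun (g p v)"

definition sharp :: "('m, 'n::finite) metric \<Rightarrow> 'm \<Rightarrow> (real ^ 'n) \<Rightarrow>\<^sub>L real \<Rightarrow> real ^ 'n" where
  "sharp g p \<theta> = (THE v. flat g p v = \<theta>)"

definition wedge ::
  "(real ^ 'n::finite) \<Rightarrow>\<^sub>L real \<Rightarrow> (real ^ 'n) \<Rightarrow>\<^sub>L real \<Rightarrow> real ^ 'n \<Rightarrow> real ^ 'n \<Rightarrow> real" where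
  "wedge \<alpha> \<beta> x y =
     blinfun_apply \<alpha> x * blinfun_apply \<beta> y - blinfun_apply \<beta> x * blinfun_apply \<alpha> y"

definition w_endo ::
  "('m, 'n::finite) chart set \<Rightarrow> ('m, 'n) metric \<Rightarrow> ('m, 'n) connection \<Rightarrow> 'm \<Rightarrow>
    (real ^ 'n) \<Rightarrow>\<^sub>L real \<Rightarrow> (real ^ 'n) \<Rightarrow>\<^sub>L real" where
  "w_endo A g D p \<theta> = (let e = orthonormal_frame g p; \<W> = weyl_action A g D p in
     Blinfun (\<lambda>x. \<Sum>i\<in>UNIV. \<W> (\<W> (wedge (flat g p (e i)) \<theta>)) (e i) x))"

definition pseudo_inverse :: "('v::real_vector \<Rightarrow> 'v) \<Rightarrow> 'v \<Rightarrow> 'v" where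
  \<comment> \<open>for an endomorphism that is symmetric with respect to some inner product, so that the space is
    the direct sum of its image and kernel\<close>
  "pseudo_inverse w = (THE s. linear s \<and> (\<forall>\<eta>\<in>range w. s (w \<eta>) = \<eta>) \<and> (\<forall>\<kappa>. w \<kappa> = 0 \<longrightarrow> s \<kappa> = 0))"

definition div_weyl ::
  "('m, 'n::finite) chart set \<Rightarrow> ('m, 'n) metric \<Rightarrow> ('m, 'n) connection \<Rightarrow> ('m, 'n) tensor3" where
  "div_weyl A g D p x y z = (let e = orthonormal_frame g p in
     \<Sum>j\<in>UNIV. cov_deriv4 A D (weyl A g D) p (e j) x y z (e j))"

definition T_field ::
  "('m, 'n::finite) chart set \<Rightarrow> ('m, 'n) metric \<Rightarrow> ('m, 'n) connection \<Rightarrow> 'm \<Rightarrow> real ^ 'n" where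
  "T_field A g D p = (let n = real CARD('n); e = orthonormal_frame g p in
     sharp g p ((1 / (n - 3)) *\<^sub>R pseudo_inverse (w_endo A g D p)
       (Blinfun (\<lambda>v. \<Sum>i\<in>UNIV.
          weyl_action A g D p (\<lambda>x y. div_weyl A g D p x y (e i)) (e i) v))))"

definition C_T ::
  "('m, 'n::finite) chart set \<Rightarrow> ('m, 'n) metric \<Rightarrow> ('m, 'n) connection \<Rightarrow> ('m, 'n) tensor3" where
  "C_T A g D p x y z =
     d_nabla A D (schouten A g D) p x y z - weyl A g D p x y z (T_field A g D p)"

end

theory Submission
  imports Defs
begin

text \<open>Write \<open>f = \<phi>\<close>, \<open>G = grad f\<close> and \<open>\<psi> = e\<^sup>f\<close>. The Koszul uniqueness argument gives
  \<open>Dbar\<^sub>v Y = D\<^sub>v Y - df(v) Y - df(Y) v + g(v, Y) G\<close>, whence the Schouten tensor changes by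
  \<open>Hess f + df \<otimes> df - |df|\<^sup>2 g / 2\<close> and the Weyl tensor is multiplied by \<open>\<psi>\<close> to the power \<open>-2\<close>.
  The exterior derivative of the Schouten tensor then changes by \<open>- W(\<cdot>,\<cdot>,\<cdot>,G)\<close> and the divergence of \<open>W\<close> by
  \<open>- (n-3) W(\<cdot>,\<cdot>,\<cdot>,G)\<close>; neither needs the second Bianchi identity. As
  contracting \<open>\<W>(W(\<cdot>,\<cdot>,e\<^sub>i,G))\<close> with \<open>e\<^sub>i\<close> and summing over \<open>i\<close> gives \<open>\<ww>(G\<^sup>*)\<close>,
  the field \<open>\<T>\<close> becomes \<open>\<psi>\<^sup>2 (\<T> - P G)\<close> with \<open>P\<close> the
  projection onto the image of \<open>\<ww>\<close>. Since \<open>2 g(\<ww>(X\<^sup>*), X\<^sup>*)\<close> is the sum of the squares of the components of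
  \<open>W(\<cdot>,X,\<cdot>,\<cdot>)\<close>, the kernel of \<open>\<ww>\<close> is the nullity of \<open>W\<close>, so \<open>P G\<close> may be replaced by \<open>G\<close> inside \<open>W\<close>
  and the two changes cancel.\<close>

section \<open>Calculus of smooth maps\<close>

text \<open>Two obstacles shape the computation. Tangent vectors at different points are written in
  different, unrelated preferred charts, so derivatives near \<open>p\<close> are transferred to the
  one chart preferred at \<open>p\<close>; its coordinate fields \<open>extend A p v\<close>
  commute, which removes all bracket terms. And traces use an orthonormal frame picked separately at
  each point, so differentiability of the scalar curvature and smoothness of \<open>grad\<close>
  cannot be read off their definitions; both are recovered from formulas free of that choice. The
  second Bianchi identity does not enter because third derivatives of f occur only antisymmetrised,
  as curvature acting on G: its Kulkarni-Nomizu part cancels the terms algebraic in the Schouten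
  tensor, and W is left. The divergence of W differentiates only the conformal factor and the
  connection. The exponents come from counting: a contraction gains \<psi> to the power 2 and a Weyl
  tensor loses it. On tangent vectors \<ww> scales by the power 4 and the source of \<T> by the
  power 6, whence the power 2 for \<T>.\<close>

lemma has_derivative_cong_open:
  assumes "open S" "x \<in> S" "\<And>y. y \<in> S \<Longrightarrow> f y = g y"
  shows "(f has_derivative f') (at x) \<longleftrightarrow> (g has_derivative f') (at x)"
proof -
  have "(g has_derivative f') (at x)" if "(f has_derivative f') (at x)" and "\<And>y. y \<in> S \<Longrightarrow> f y = g y"
    for f g :: "'a \<Rightarrow> 'b"
    using has_derivative_transform_within_open[OF that(1) assms(1,2)] that(2) by blast
  then show ?thesis using assms(3) by (metis (full_types))
qed

lemma frechet_derivative_cong_open: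
  assumes "open S" "x \<in> S" "\<And>y. y \<in> S \<Longrightarrow> f y = g y"
  shows "frechet_derivative f (at x) = frechet_derivative g (at x)"
  unfolding frechet_derivative_def using has_derivative_cong_open[OF assms] by simp

lemma differentiable_cong_open:
  assumes "open S" "x \<in> S" "\<And>y. y \<in> S \<Longrightarrow> f y = g y"
  shows "f differentiable (at x) \<longleftrightarrow> g differentiable (at x)"
  unfolding differentiable_def using has_derivative_cong_open[OF assms] by simp

text \<open>The derivatives in \<open>Ck_on\<close> are taken in the whole space, so values on
  \<open>S\<close> determine them only because \<open>S\<close> is open. Every later formula for the
  derivative of a sum, product or composite enters \<open>Ck_on\<close> through this
  rewriting.\<close>

lemma Ck_on_cong:
  assumes "open S" "\<And>y. y \<in> S \<Longrightarrow> f y = g y"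
  shows "Ck_on k S f \<longleftrightarrow> Ck_on k S g"
  using assms(2)
proof (induction k arbitrary: f g)
  case 0
  then show ?case by (simp cong: continuous_on_cong)
next
  case (Suc k)
  have "Ck_on k S (\<lambda>x. frechet_derivative f (at x) v) \<longleftrightarrow>
        Ck_on k S (\<lambda>x. frechet_derivative g (at x) v)" for v
    by (rule Suc.IH) (simp only: frechet_derivative_cong_open[OF assms(1) _ Suc.prems])
  then show ?case
    using differentiable_cong_open[OF assms(1) _ Suc.prems] by auto
qed

lemma Ck_on_Suc_imp: "Ck_on (Suc k) S f \<Longrightarrow> Ck_on k S f"
proof (induction k arbitrary: f)
  case 0
  then show ?case
    by (auto intro!: continuous_at_imp_continuous_on differentiable_imp_continuous_within)
next
  case (Suc k)
  then show ?case by (metis Ck_on.simps(2))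
qed

lemma Ck_on_subset: "Ck_on k S f \<Longrightarrow> T \<subseteq> S \<Longrightarrow> Ck_on k T f"
proof (induction k arbitrary: f)
  case 0
  then show ?case by (auto intro: continuous_on_subset)
next
  case (Suc k)
  then show ?case by auto
qed

lemma Ck_on_const: "Ck_on k S (\<lambda>_. c)"
proof (induction k arbitrary: c)
  case (Suc k)
  then show ?case by simp
qed simp

lemma Ck_on_add:
  assumes "open S" "Ck_on k S f" "Ck_on k S g"
  shows "Ck_on k S (\<lambda>x. f x + g x)"
  using assms(2,3)
proof (induction k arbitrary: f g)
  case 0
  then show ?case by (auto intro: continuous_intros)
next
  case (Suc k)
  have d: "((\<lambda>x. f x + g x) has_derivative
      (\<lambda>v. frechet_derivative f (at x) v + frechet_derivative g (at x) v)) (at x)" if "x \<in> S" for x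
    using Suc.prems that by (auto intro!: derivative_intros simp: frechet_derivative_works[symmetric])
  have "Ck_on k S (\<lambda>x. frechet_derivative (\<lambda>x. f x + g x) (at x) v)" for v
  proof (subst Ck_on_cong[OF assms(1)])
    show "frechet_derivative (\<lambda>x. f x + g x) (at x) v
       = frechet_derivative f (at x) v + frechet_derivative g (at x) v" if "x \<in> S" for x
      by (simp only: frechet_derivative_at[OF d[OF that], symmetric])
    show "Ck_on k S (\<lambda>x. frechet_derivative f (at x) v + frechet_derivative g (at x) v)"
      using Suc by auto
  qed
  then show ?case using d by (auto simp: differentiable_def)
qed

lemma Ck_on_linear:
  assumes "open S" "bounded_linear L" "Ck_on k S f"
  shows "Ck_on k S (\<lambda>x. L (f x))"
  using assms(3)
proof (induction k arbitrary: f)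
  case 0
  then show ?case using assms(2) by (auto intro: bounded_linear.continuous_on)
next
  case (Suc k)
  have d: "((\<lambda>x. L (f x)) has_derivative (\<lambda>v. L (frechet_derivative f (at x) v))) (at x)" if "x \<in> S" for x
    using Suc.prems that
    by (auto intro!: bounded_linear.has_derivative[OF assms(2)] simp: frechet_derivative_works[symmetric])
  have "Ck_on k S (\<lambda>x. frechet_derivative (\<lambda>x. L (f x)) (at x) v)" for v
  proof (subst Ck_on_cong[OF assms(1)])
    show "frechet_derivative (\<lambda>x. L (f x)) (at x) v = L (frechet_derivative f (at x) v)" if "x \<in> S" for x
      by (simp only: frechet_derivative_at[OF d[OF that], symmetric])
    show "Ck_on k S (\<lambda>x. L (frechet_derivative f (at x) v))"
      using Suc by auto
  qed
  then show ?case using d by (auto simp: differentiable_def)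
qed

text \<open>One rule covers scalar multiples and products of real functions. The Leibniz formula
  pairs a derivative with an undifferentiated factor, which is why the latter is lowered by
  \<open>Ck_on_Suc_imp\<close>.\<close>

lemma Ck_on_bilinear:
  assumes "open S" "bounded_bilinear B" "Ck_on k S f" "Ck_on k S g"
  shows "Ck_on k S (\<lambda>x. B (f x) (g x))"
  using assms(3,4)
proof (induction k arbitrary: f g)
  case 0
  then show ?case using assms(2) by (auto intro: bounded_bilinear.continuous_on)
next
  case (Suc k)
  have d: "((\<lambda>x. B (f x) (g x)) has_derivative
      (\<lambda>v. B (f x) (frechet_derivative g (at x) v) + B (frechet_derivative f (at x) v) (g x))) (at x)"
    if "x \<in> S" for x
    using Suc.prems that
    by (auto intro!: bounded_bilinear.FDERIV[OF assms(2)] simp: frechet_derivative_works[symmetric])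
  have "Ck_on k S (\<lambda>x. frechet_derivative (\<lambda>x. B (f x) (g x)) (at x) v)" for v
  proof (subst Ck_on_cong[OF assms(1)])
    show "frechet_derivative (\<lambda>x. B (f x) (g x)) (at x) v =
       B (f x) (frechet_derivative g (at x) v) + B (frechet_derivative f (at x) v) (g x)" if "x \<in> S" for x
      by (simp only: frechet_derivative_at[OF d[OF that], symmetric])
    show "Ck_on k S (\<lambda>x. B (f x) (frechet_derivative g (at x) v) + B (frechet_derivative f (at x) v) (g x))"
      using Suc.prems by (intro Ck_on_add[OF assms(1)] Suc.IH) (auto intro: Ck_on_Suc_imp)
  qed
  then show ?case using d by (auto simp: differentiable_def)
qed

lemma Ck_on_sum:
  assumes "open S" "\<And>i. i \<in> I \<Longrightarrow> Ck_on k S (f i)"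
  shows "Ck_on k S (\<lambda>x. \<Sum>i\<in>I. f i x)"
  using assms(2)
proof (induction I rule: infinite_finite_induct)
  case (insert i I)
  then show ?case by (auto intro!: Ck_on_add[OF assms(1)])
qed (auto simp: Ck_on_const)

lemma linear_euclidean_expand:
  fixes v :: "'a::euclidean_space"
  assumes "linear L"
  shows "L v = (\<Sum>b\<in>Basis. (v \<bullet> b) *\<^sub>R L b)"
proof -
  have "L v = L (\<Sum>b\<in>Basis. (v \<bullet> b) *\<^sub>R b)" by (simp add: euclidean_representation)
  also have "\<dots> = (\<Sum>b\<in>Basis. (v \<bullet> b) *\<^sub>R L b)"
    using assms by (simp add: linear_sum linear_scale)
  finally show ?thesis .
qed

text \<open>The chain rule puts the moving vector \<open>?g x v\<close> into the derivative of
  \<open>f\<close>, a form the induction does not handle. Expanding that vector in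
  \<open>Basis\<close> leaves products of scalar functions with composites of a directional
  derivative of \<open>f\<close>, to which the hypothesis for arbitrary \<open>f\<close>
  applies.\<close>

lemma Ck_on_compose:
  fixes f :: "'b::euclidean_space \<Rightarrow> 'c::real_normed_vector" and g :: "'a::euclidean_space \<Rightarrow> 'b"
  assumes "open S" "open T" "Ck_on k T f" "Ck_on k S g" "g ` S \<subseteq> T"
  shows "Ck_on k S (f \<circ> g)"
  using assms(3,4)
proof (induction k arbitrary: f)
  case 0
  then show ?case using assms(5) by (metis Ck_on.simps(1) continuous_on_compose continuous_on_subset)
next
  case (Suc k)
  let ?f = "\<lambda>y. frechet_derivative f (at y)" and ?g = "\<lambda>x. frechet_derivative g (at x)"
  have d: "((f \<circ> g) has_derivative (?f (g x) \<circ> ?g x)) (at x)" if "x \<in> S" for x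
    using Suc.prems that assms(5)
    by (intro diff_chain_at) (auto simp: frechet_derivative_works[symmetric])
  have "Ck_on k S (\<lambda>x. frechet_derivative (f \<circ> g) (at x) v)" for v
  proof (subst Ck_on_cong[OF assms(1)])
    show "frechet_derivative (f \<circ> g) (at x) v = (\<Sum>b\<in>Basis. (?g x v \<bullet> b) *\<^sub>R (((\<lambda>y. ?f y b) \<circ> g) x))"
      if "x \<in> S" for x
    proof -
      have "linear (?f (g x))"
        using Suc.prems that assms(5) by (auto intro!: linear_frechet_derivative)
      then show ?thesis
        by (simp only: frechet_derivative_at[OF d[OF that], symmetric] comp_apply
            linear_euclidean_expand[of "?f (g x)" "?g x v", symmetric])
    qed
    show "Ck_on k S (\<lambda>x. \<Sum>b\<in>Basis. (?g x v \<bullet> b) *\<^sub>R (((\<lambda>y. ?f y b) \<circ> g) x))"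
    proof (intro Ck_on_sum[OF assms(1)] Ck_on_bilinear[OF assms(1) bounded_bilinear_scaleR])
      show "Ck_on k S (\<lambda>x. ?g x v \<bullet> b)" for b
        using Suc.prems by (intro Ck_on_linear[OF assms(1) bounded_linear_inner_left]) auto
      show "Ck_on k S (\<lambda>x. ((\<lambda>y. ?f y b) \<circ> g) x)" for b
        using Suc.IH[of "\<lambda>y. ?f y b"] Suc.prems Ck_on_Suc_imp[of k S g] by (simp add: o_def)
    qed
  qed
  then show ?case unfolding Ck_on.simps differentiable_def using d by blast
qed

text \<open>The derivative of 1/f is again built from 1/f and the derivative of f, so the induction
  hypothesis is used for the same \<open>f\<close> and the bilinear rule does the rest.\<close>

lemma Ck_on_inverse:
  fixes f :: "'a::euclidean_space \<Rightarrow> real"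
  assumes "open S" "\<And>x. x \<in> S \<Longrightarrow> f x \<noteq> 0" "Ck_on k S f"
  shows "Ck_on k S (\<lambda>x. inverse (f x))"
  using assms(3)
proof (induction k)
  case 0
  then show ?case using assms(2) by (auto intro: continuous_intros)
next
  case (Suc k)
  have d: "((\<lambda>x. inverse (f x)) has_derivative
      (\<lambda>v. - (inverse (f x) * frechet_derivative f (at x) v * inverse (f x)))) (at x)" if "x \<in> S" for x
    using Suc.prems that assms(2)
    by (auto intro!: derivative_intros simp: frechet_derivative_works[symmetric])
  have "Ck_on k S (\<lambda>x. frechet_derivative (\<lambda>x. inverse (f x)) (at x) v)" for v
  proof (subst Ck_on_cong[OF assms(1)])
    show "frechet_derivative (\<lambda>x. inverse (f x)) (at x) v =
       - (inverse (f x) * frechet_derivative f (at x) v * inverse (f x))" if "x \<in> S" for x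
      by (simp only: frechet_derivative_at[OF d[OF that], symmetric])
    have i: "Ck_on k S (\<lambda>x. inverse (f x))" using Suc Ck_on_Suc_imp by blast
    show "Ck_on k S (\<lambda>x. - (inverse (f x) * frechet_derivative f (at x) v * inverse (f x)))"
      using Suc.prems i
      by (intro Ck_on_linear[OF assms(1) bounded_linear_minus[OF bounded_linear_ident]]
          Ck_on_bilinear[OF assms(1) bounded_bilinear_mult]) auto
  qed
  then show ?case using d by (auto simp: differentiable_def)
qed

lemma smooth_on_cong:
  "open S \<Longrightarrow> (\<And>y. y \<in> S \<Longrightarrow> f y = g y) \<Longrightarrow> smooth_on S f \<longleftrightarrow> smooth_on S g"
  unfolding smooth_on_def using Ck_on_cong[of S f g] by blast

lemma smooth_on_subset: "smooth_on S f \<Longrightarrow> T \<subseteq> S \<Longrightarrow> smooth_on T f"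
  unfolding smooth_on_def using Ck_on_subset by blast

lemma smooth_on_const: "smooth_on S (\<lambda>_. c)"
  unfolding smooth_on_def by (simp add: Ck_on_const)

lemma smooth_on_add:
  "open S \<Longrightarrow> smooth_on S f \<Longrightarrow> smooth_on S g \<Longrightarrow> smooth_on S (\<lambda>x. f x + g x)"
  unfolding smooth_on_def by (simp add: Ck_on_add)

lemma smooth_on_linear:
  "open S \<Longrightarrow> bounded_linear L \<Longrightarrow> smooth_on S f \<Longrightarrow> smooth_on S (\<lambda>x. L (f x))"
  unfolding smooth_on_def by (rule allI, rule Ck_on_linear; assumption?; erule spec)

lemma smooth_on_scaleR:
  "open S \<Longrightarrow> smooth_on S f \<Longrightarrow> smooth_on S g \<Longrightarrow> smooth_on S (\<lambda>x. f x *\<^sub>R g x)"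
  unfolding smooth_on_def by (rule allI, rule Ck_on_bilinear[OF _ bounded_bilinear_scaleR]; assumption?; erule spec)

lemma smooth_on_mult:
  fixes f g :: "'a::euclidean_space \<Rightarrow> real"
  shows "open S \<Longrightarrow> smooth_on S f \<Longrightarrow> smooth_on S g \<Longrightarrow> smooth_on S (\<lambda>x. f x * g x)"
  unfolding smooth_on_def by (rule allI, rule Ck_on_bilinear[OF _ bounded_bilinear_mult]; assumption?; erule spec)

lemma smooth_on_sum:
  "open S \<Longrightarrow> (\<And>i. i \<in> I \<Longrightarrow> smooth_on S (f i)) \<Longrightarrow> smooth_on S (\<lambda>x. \<Sum>i\<in>I. f i x)"
  unfolding smooth_on_def by (rule allI, rule Ck_on_sum; blast)

lemma smooth_on_compose:
  fixes f :: "'b::euclidean_space \<Rightarrow> 'c::real_normed_vector" and g :: "'a::euclidean_space \<Rightarrow> 'b"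
  shows "open S \<Longrightarrow> open T \<Longrightarrow> smooth_on T f \<Longrightarrow> smooth_on S g \<Longrightarrow> g ` S \<subseteq> T \<Longrightarrow> smooth_on S (f \<circ> g)"
  unfolding smooth_on_def by (rule allI, rule Ck_on_compose; blast)

lemma smooth_on_inverse:
  fixes f :: "'a::euclidean_space \<Rightarrow> real"
  shows "open S \<Longrightarrow> (\<And>x. x \<in> S \<Longrightarrow> f x \<noteq> 0) \<Longrightarrow> smooth_on S f \<Longrightarrow> smooth_on S (\<lambda>x. inverse (f x))"
  unfolding smooth_on_def by (rule allI, rule Ck_on_inverse; blast)

lemma smooth_on_differentiable: "smooth_on S f \<Longrightarrow> x \<in> S \<Longrightarrow> f differentiable (at x)"
  unfolding smooth_on_def using Ck_on.simps(2) by blast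

lemma smooth_on_frechet: "smooth_on S f \<Longrightarrow> smooth_on S (\<lambda>x. frechet_derivative f (at x) v)"
  unfolding smooth_on_def using Ck_on.simps(2) by blast

text \<open>\<open>smooth_on_frechet\<close> treats a fixed direction; a moving one is resolved into
  its coordinates. Components of a field after a change of chart have exactly this form.\<close>

lemma smooth_on_frechet_field:
  fixes f :: "'a::euclidean_space \<Rightarrow> 'b::real_normed_vector"
  assumes "open S" "smooth_on S f" "smooth_on S u"
  shows "smooth_on S (\<lambda>x. frechet_derivative f (at x) (u x))"
proof (subst smooth_on_cong[OF assms(1)])
  show "frechet_derivative f (at x) (u x) =
      (\<Sum>b\<in>Basis. (u x \<bullet> b) *\<^sub>R frechet_derivative f (at x) b)" if "x \<in> S" for x
    by (rule linear_euclidean_expand[OF linear_frechet_derivative[OF smooth_on_differentiable[OF assms(2) that]]])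
  show "smooth_on S (\<lambda>x. \<Sum>b\<in>Basis. (u x \<bullet> b) *\<^sub>R frechet_derivative f (at x) b)"
    by (intro smooth_on_sum[OF assms(1)] smooth_on_scaleR[OF assms(1)] smooth_on_frechet[OF assms(2)]
        smooth_on_linear[OF assms(1) bounded_linear_inner_left assms(3)])
qed

text \<open>Two applications of the mean value theorem to
  \<open>f (x + h v + h w) - f (x + h v) - f (x + h w) + f x\<close>.\<close>

lemma second_difference_mean_value:
  fixes f :: "'a::euclidean_space \<Rightarrow> real"
  assumes "convex S" "open S" "smooth_on S f"
    and h: "0 < h"
    and mem: "\<And>s t. 0 \<le> s \<Longrightarrow> s \<le> h \<Longrightarrow> 0 \<le> t \<Longrightarrow> t \<le> h \<Longrightarrow> x + s *\<^sub>R v + t *\<^sub>R w \<in> S"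
  obtains s t where "0 < s" "s < h" "0 < t" "t < h"
    "f (x + h *\<^sub>R v + h *\<^sub>R w) - f (x + h *\<^sub>R v) - f (x + h *\<^sub>R w) + f x =
     h * h * frechet_derivative (\<lambda>y. frechet_derivative f (at y) v) (at (x + s *\<^sub>R v + t *\<^sub>R w)) w"
proof -
  have lin: "frechet_derivative k (at y) (c *\<^sub>R u) = c * frechet_derivative k (at y) u"
    if "smooth_on S k" "y \<in> S" for k :: "'a \<Rightarrow> real" and y c u
    using linear_scale[OF linear_frechet_derivative[OF smooth_on_differentiable[OF that]]] by simp
  have der: "(k has_derivative frechet_derivative k (at y)) (at y)"
    if "smooth_on S k" "y \<in> S" for k :: "'a \<Rightarrow> real" and y
    using smooth_on_differentiable[OF that] by (simp add: frechet_derivative_works)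
  let ?d = "\<lambda>y. frechet_derivative f (at y) v"
  have sd: "smooth_on S ?d" using assms(3) smooth_on_frechet by blast
  define u where "u s = f (x + s *\<^sub>R v + h *\<^sub>R w) - f (x + s *\<^sub>R v + 0 *\<^sub>R w)" for s
  have a: "((\<lambda>s. f (x + s *\<^sub>R v + t *\<^sub>R w)) has_real_derivative ?d (x + s *\<^sub>R v + t *\<^sub>R w)) (at s)"
    if "0 \<le> s" "s \<le> h" "0 \<le> t" "t \<le> h" for s t
  proof -
    have "((\<lambda>s. x + s *\<^sub>R v + t *\<^sub>R w) has_derivative (\<lambda>r. r *\<^sub>R v)) (at s)"
      by (auto intro!: derivative_eq_intros)
    from has_derivative_compose[OF this der[OF assms(3) mem[OF that]]]
    show ?thesis
      unfolding has_field_derivative_def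
      using lin[OF assms(3) mem[OF that]] by (simp add: mult_commute_abs)
  qed
  have du: "(u has_real_derivative (?d (x + s *\<^sub>R v + h *\<^sub>R w) - ?d (x + s *\<^sub>R v + 0 *\<^sub>R w))) (at s)"
    if "0 \<le> s" "s \<le> h" for s
    unfolding u_def using h that by (intro DERIV_diff a) auto
  obtain s where s: "0 < s" "s < h" "u h - u 0 = (h - 0) * (?d (x + s *\<^sub>R v + h *\<^sub>R w) - ?d (x + s *\<^sub>R v + 0 *\<^sub>R w))"
    using MVT2[OF h du] by blast
  have b: "((\<lambda>t. ?d (x + s *\<^sub>R v + t *\<^sub>R w)) has_real_derivative
      frechet_derivative ?d (at (x + s *\<^sub>R v + t *\<^sub>R w)) w) (at t)"
    if "0 \<le> t" "t \<le> h" for t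
  proof -
    have m: "x + s *\<^sub>R v + t *\<^sub>R w \<in> S" using mem s that by auto
    have "((\<lambda>t. x + s *\<^sub>R v + t *\<^sub>R w) has_derivative (\<lambda>r. r *\<^sub>R w)) (at t)"
      by (auto intro!: derivative_eq_intros)
    from has_derivative_compose[OF this der[OF sd m]]
    show ?thesis
      unfolding has_field_derivative_def
      using lin[OF sd m] by (simp add: mult_commute_abs)
  qed
  obtain t where t: "0 < t" "t < h" "?d (x + s *\<^sub>R v + h *\<^sub>R w) - ?d (x + s *\<^sub>R v + 0 *\<^sub>R w) =
     (h - 0) * frechet_derivative ?d (at (x + s *\<^sub>R v + t *\<^sub>R w)) w"
    using MVT2[OF h b] by blast
  show ?thesis
    by (rule that[OF s(1,2) t(1,2)]) (use s(3) t(3) in \<open>simp add: u_def\<close>)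
qed

text \<open>The second difference over a small parallelogram does not see the order of
  \<open>v\<close> and \<open>w\<close>. Evaluating it in both orders gives, at every scale, two
  nearby points at which the two mixed derivatives agree; continuity at \<open>x\<close> merges
  them.\<close>

lemma second_derivative_symmetric_real:
  fixes f :: "'a::euclidean_space \<Rightarrow> real"
  assumes "open S" "smooth_on S f" "x \<in> S"
  shows "frechet_derivative (\<lambda>y. frechet_derivative f (at y) v) (at x) w =
         frechet_derivative (\<lambda>y. frechet_derivative f (at y) w) (at x) v"
proof -
  obtain e where e: "e > 0" "ball x e \<subseteq> S" using assms openE by blast
  have sm: "smooth_on (ball x e) f" using smooth_on_subset assms e by blast
  let ?F = "\<lambda>v w y. frechet_derivative (\<lambda>y. frechet_derivative f (at y) v) (at y) w"
  \<comment> \<open>The summand 1 keeps \<open>K\<close> positive for v = w = 0 and makes the bound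
    \<open>near\<close> strict; \<open>h n\<close> then keeps the whole parallelogram within e/(n+1)
    of \<open>x\<close>.\<close>
  define K where "K = norm v + norm w + 1"
  have K: "K > 0" unfolding K_def by (meson add_nonneg_pos add_nonneg_nonneg norm_ge_zero zero_less_one)
  define h where "h n = e / (K * real (Suc n))" for n
  have hpos: "h n > 0" for n unfolding h_def using e K by simp
  have hK: "h n * K \<le> e / real (Suc n)" for n
    unfolding h_def using K by simp
  have near: "norm (s *\<^sub>R v + t *\<^sub>R w) < h n * K" if "0 \<le> s" "s \<le> h n" "0 \<le> t" "t \<le> h n" for s t n
  proof -
    have "norm (s *\<^sub>R v + t *\<^sub>R w) \<le> s * norm v + t * norm w"
      using norm_triangle_ineq[of "s *\<^sub>R v" "t *\<^sub>R w"] that by simp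
    also have "\<dots> \<le> h n * norm v + h n * norm w"
      using that by (intro add_mono mult_right_mono) auto
    also have "\<dots> < h n * K" unfolding K_def using hpos[of n] by (simp add: algebra_simps)
    finally show ?thesis .
  qed
  have hKe: "h n * K \<le> e" for n
  proof -
    have "e / real (Suc n) \<le> e" using e by (simp add: field_simps)
    then show ?thesis using hK[of n] by linarith
  qed
  have mem: "x + s *\<^sub>R v + t *\<^sub>R w \<in> ball x e" "x + t *\<^sub>R w + s *\<^sub>R v \<in> ball x e"
    if "0 \<le> s" "s \<le> h n" "0 \<le> t" "t \<le> h n" for s t n
    using near[OF that] hKe[of n] norm_minus_cancel[of "s *\<^sub>R v + t *\<^sub>R w"]
    by (auto simp: dist_norm algebra_simps)
  have "\<exists>y z. norm (y - x) \<le> e / real (Suc n) \<and> norm (z - x) \<le> e / real (Suc n) \<and> ?F v w y = ?F w v z" for n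
  proof -
    obtain s t where 1: "0 < s" "s < h n" "0 < t" "t < h n"
      "f (x + h n *\<^sub>R v + h n *\<^sub>R w) - f (x + h n *\<^sub>R v) - f (x + h n *\<^sub>R w) + f x =
       h n * h n * ?F v w (x + s *\<^sub>R v + t *\<^sub>R w)"
      using second_difference_mean_value[OF convex_ball open_ball sm hpos[of n], of x v w] mem(1)[of _ n] by blast
    obtain s' t' where 2: "0 < s'" "s' < h n" "0 < t'" "t' < h n"
      "f (x + h n *\<^sub>R w + h n *\<^sub>R v) - f (x + h n *\<^sub>R w) - f (x + h n *\<^sub>R v) + f x =
       h n * h n * ?F w v (x + s' *\<^sub>R w + t' *\<^sub>R v)"
      using second_difference_mean_value[OF convex_ball open_ball sm hpos[of n], of x w v] mem(2)[of _ n] by blast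
    have "h n * h n * ?F v w (x + s *\<^sub>R v + t *\<^sub>R w) = h n * h n * ?F w v (x + s' *\<^sub>R w + t' *\<^sub>R v)"
      using 1(5) 2(5) by (simp add: algebra_simps)
    then have "?F v w (x + s *\<^sub>R v + t *\<^sub>R w) = ?F w v (x + s' *\<^sub>R w + t' *\<^sub>R v)"
      using hpos[of n] by simp
    moreover have "norm (x + s *\<^sub>R v + t *\<^sub>R w - x) \<le> e / real (Suc n)"
      using near[of s n t] 1 hK[of n] by (simp add: algebra_simps)
    moreover have "norm (x + s' *\<^sub>R w + t' *\<^sub>R v - x) \<le> e / real (Suc n)"
      using near[of t' n s'] 2 hK[of n] by (simp add: algebra_simps)
    ultimately show ?thesis by blast
  qed
  then obtain y z where yz: "\<And>n. norm (y n - x) \<le> e / real (Suc n)"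
     "\<And>n. norm (z n - x) \<le> e / real (Suc n)" "\<And>n. ?F v w (y n) = ?F w v (z n)"
    by metis
  have l0: "(\<lambda>n. e / real (Suc n)) \<longlonglongrightarrow> 0"
    using tendsto_mult_right_zero[OF LIMSEQ_inverse_real_of_nat, of e] by (simp add: divide_inverse)
  have ly: "y \<longlonglongrightarrow> x" and lz: "z \<longlonglongrightarrow> x"
    using yz(1,2) by (auto intro!: LIM_zero_cancel[of y] LIM_zero_cancel[of z] Lim_null_comparison[OF _ l0])
  have cont: "isCont (?F v w) x" for v w
    using smooth_on_differentiable[OF smooth_on_frechet[OF smooth_on_frechet[OF assms(2)]] assms(3)]
    by (rule differentiable_imp_continuous_within)
  have "(\<lambda>n. ?F v w (y n)) \<longlonglongrightarrow> ?F v w x" by (rule isCont_tendsto_compose[OF cont ly])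
  moreover have "(\<lambda>n. ?F w v (z n)) \<longlonglongrightarrow> ?F w v x" by (rule isCont_tendsto_compose[OF cont lz])
  ultimately show ?thesis using yz(3) LIMSEQ_unique by auto
qed

lemma second_derivative_symmetric:
  fixes f :: "'a::euclidean_space \<Rightarrow> 'b::euclidean_space"
  assumes "open S" "smooth_on S f" "x \<in> S"
  shows "frechet_derivative (\<lambda>y. frechet_derivative f (at y) v) (at x) w =
         frechet_derivative (\<lambda>y. frechet_derivative f (at y) w) (at x) v"
proof (rule euclidean_eqI)
  fix b :: 'b assume "b \<in> Basis"
  have comp: "frechet_derivative (\<lambda>y. k y \<bullet> b) (at y) u = frechet_derivative k (at y) u \<bullet> b"
    if "smooth_on S k" "y \<in> S" for k :: "'a \<Rightarrow> 'b" and y u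
    by (simp only: frechet_derivative_at[OF bounded_linear.has_derivative[OF bounded_linear_inner_left[of b]
          smooth_on_differentiable[OF that, unfolded frechet_derivative_works]], symmetric])
  have two: "frechet_derivative (\<lambda>y. frechet_derivative f (at y) v) (at x) w \<bullet> b =
      frechet_derivative (\<lambda>y. frechet_derivative (\<lambda>y. f y \<bullet> b) (at y) v) (at x) w" for v w
  proof -
    have "frechet_derivative (\<lambda>y. frechet_derivative (\<lambda>y. f y \<bullet> b) (at y) v) (at x) w =
        frechet_derivative (\<lambda>y. frechet_derivative f (at y) v \<bullet> b) (at x) w"
      using comp[OF assms(2)] by (subst frechet_derivative_cong_open[OF assms(1,3)]) auto
    also have "\<dots> = frechet_derivative (\<lambda>y. frechet_derivative f (at y) v) (at x) w \<bullet> b"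
      using comp[OF smooth_on_frechet[OF assms(2)] assms(3)] by simp
    finally show ?thesis by simp
  qed
  show "frechet_derivative (\<lambda>y. frechet_derivative f (at y) v) (at x) w \<bullet> b =
        frechet_derivative (\<lambda>y. frechet_derivative f (at y) w) (at x) v \<bullet> b"
    unfolding two
    by (rule second_derivative_symmetric_real[OF assms(1) smooth_on_linear[OF assms(1) bounded_linear_inner_left assms(2)] assms(3)])
qed

section \<open>Charts, transition maps and smooth fields\<close>

locale smooth_manifold =
  fixes A :: "('m::{t2_space, second_countable_topology}, 'n::finite) chart set"
  assumes atlas: "smooth_atlas A"
begin

lemma open_chart_domain: "c \<in> A \<Longrightarrow> open (fst c)"
  using atlas unfolding smooth_atlas_def by blast

lemma chart_homeomorphism:
  "c \<in> A \<Longrightarrow> homeomorphism (fst c) (snd c ` fst c) (snd c) (chart_inv c)"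
  using atlas unfolding smooth_atlas_def by blast

lemma open_chart_image:
  assumes "c \<in> A" "open U" "U \<subseteq> fst c"
  shows "open (snd c ` U)"
proof -
  have "openin (top_of_set (fst c)) U"
    using assms by (simp add: open_subset)
  then have "openin (top_of_set (snd c ` fst c)) (snd c ` U)"
    using homeomorphism_imp_open_map[OF chart_homeomorphism[OF assms(1)]] by blast
  moreover have "open (snd c ` fst c)" using atlas assms(1) unfolding smooth_atlas_def by blast
  ultimately show ?thesis using openin_open_trans by blast
qed

lemma chart_inv_chart [simp]: "c \<in> A \<Longrightarrow> q \<in> fst c \<Longrightarrow> chart_inv c (snd c q) = q"
  using chart_homeomorphism[of c] unfolding homeomorphism_def by blast

lemma chart_at_in [simp]: "chart_at A p \<in> A" "p \<in> fst (chart_at A p)"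
proof -
  have "\<exists>c. c \<in> A \<and> p \<in> fst c" using atlas unfolding smooth_atlas_def by blast
  from someI_ex[OF this] show "chart_at A p \<in> A" "p \<in> fst (chart_at A p)"
    unfolding chart_at_def by blast+
qed

text \<open>\<open>chart_components\<close> and \<open>chart_vector\<close> are both Jacobians of
  transition maps; a uniform name reduces every change of chart to the cocycle rule
  \<open>jac_comp\<close> and to \<open>jac_self\<close>.\<close>

definition jac :: "('m, 'n) chart \<Rightarrow> ('m, 'n) chart \<Rightarrow> 'm \<Rightarrow> real ^ 'n \<Rightarrow> real ^ 'n" where
  "jac c d q = frechet_derivative (snd d \<circ> chart_inv c) (at (snd c q))"

lemma transition_smooth:
  "c \<in> A \<Longrightarrow> d \<in> A \<Longrightarrow> smooth_on (snd c ` (fst c \<inter> fst d)) (snd d \<circ> chart_inv c)"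
  using atlas unfolding smooth_atlas_def by blast

lemma jac_has_derivative:
  assumes "c \<in> A" "d \<in> A" "q \<in> fst c" "q \<in> fst d"
  shows "((snd d \<circ> chart_inv c) has_derivative jac c d q) (at (snd c q))"
  using smooth_on_differentiable[OF transition_smooth[OF assms(1,2)], of "snd c q"] assms(3,4)
  unfolding jac_def by (simp add: frechet_derivative_works[symmetric])

lemma jac_linear:
  assumes "c \<in> A" "d \<in> A" "q \<in> fst c" "q \<in> fst d"
  shows "linear (jac c d q)"
  using jac_has_derivative[OF assms] has_derivative_linear by blast

text \<open>The composite of two transition maps equals the direct one only over the overlap with
  the middle chart, so the chain rule is used on the open image of that overlap.\<close>

lemma jac_comp:
  assumes "c \<in> A" "d \<in> A" "e \<in> A" "q \<in> fst c" "q \<in> fst d" "q \<in> fst e"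
  shows "jac d e q (jac c d q v) = jac c e q v"
proof -
  let ?U = "fst c \<inter> fst d"
  have "((snd e \<circ> chart_inv d) has_derivative jac d e q) (at ((snd d \<circ> chart_inv c) (snd c q)))"
    using jac_has_derivative[OF assms(2,3,5,6)] assms by simp
  from diff_chain_at[OF jac_has_derivative[OF assms(1,2,4,5)] this]
  have 1: "((snd e \<circ> chart_inv d) \<circ> (snd d \<circ> chart_inv c) has_derivative jac d e q \<circ> jac c d q) (at (snd c q))" .
  have op: "open (snd c ` ?U)"
    using assms by (intro open_chart_image open_Int open_chart_domain) auto
  have "(snd e \<circ> chart_inv c has_derivative jac d e q \<circ> jac c d q) (at (snd c q))"
    by (rule has_derivative_transform_within_open[OF 1 op]) (use assms in auto)
  then have "jac d e q \<circ> jac c d q = jac c e q"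
    using frechet_derivative_at jac_def by metis
  then show ?thesis by (metis comp_apply)
qed

lemma jac_self:
  assumes "c \<in> A" "q \<in> fst c"
  shows "jac c c q v = v"
proof -
  have "(snd c \<circ> chart_inv c has_derivative id) (at (snd c q))"
    by (rule has_derivative_transform_within_open[OF has_derivative_id[unfolded id_def[symmetric]]
          open_chart_image[OF assms(1) open_chart_domain[OF assms(1)] subset_refl]]) (use assms in auto)
  then show ?thesis
    using frechet_derivative_at jac_def by (metis id_apply)
qed

lemma chart_components_jac: "chart_components A c q = jac (chart_at A q) c q"
  unfolding chart_components_def jac_def by (rule ext) simp

lemma chart_vector_jac: "chart_vector A c q = jac c (chart_at A q) q"
  unfolding chart_vector_def jac_def by (rule ext) simp

lemma field_components_jac:
  "c \<in> A \<Longrightarrow> q \<in> fst c \<Longrightarrow> field_components A c X (snd c q) = jac (chart_at A q) c q (X q)"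
  unfolding field_components_def chart_components_jac by simp

lemma chart_components_vector [simp]:
  "c \<in> A \<Longrightarrow> q \<in> fst c \<Longrightarrow> chart_components A c q (chart_vector A c q v) = v"
  unfolding chart_components_jac chart_vector_jac by (simp add: jac_comp jac_self)

lemma chart_vector_components [simp]:
  "c \<in> A \<Longrightarrow> q \<in> fst c \<Longrightarrow> chart_vector A c q (chart_components A c q v) = v"
  unfolding chart_components_jac chart_vector_jac by (simp add: jac_comp jac_self)

lemma linear_chart_vector: "c \<in> A \<Longrightarrow> q \<in> fst c \<Longrightarrow> linear (chart_vector A c q)"
  unfolding chart_vector_jac by (simp add: jac_linear)

lemma linear_chart_components: "c \<in> A \<Longrightarrow> q \<in> fst c \<Longrightarrow> linear (chart_components A c q)"
  unfolding chart_components_jac by (simp add: jac_linear)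

lemma chart_components_chart_at [simp]: "chart_components A (chart_at A q) q v = v"
  unfolding chart_components_jac by (simp add: jac_self)

section \<open>Smoothness tested in a single chart\<close>

lemma smooth_fun_onI_chart:
  assumes "c \<in> A" "open U" "U \<subseteq> fst c" "smooth_on (snd c ` U) (f \<circ> chart_inv c)"
  shows "smooth_fun_on A U f"
  unfolding smooth_fun_on_def
proof
  fix d assume d: "d \<in> A"
  have op: "open (snd d ` (U \<inter> fst d))"
    using d assms by (intro open_chart_image open_Int open_chart_domain) auto
  have "smooth_on (snd d ` (U \<inter> fst d)) ((f \<circ> chart_inv c) \<circ> (snd c \<circ> chart_inv d))"
  proof (rule smooth_on_compose[OF op open_chart_image[OF assms(1-3)] assms(4)])
    show "smooth_on (snd d ` (U \<inter> fst d)) (snd c \<circ> chart_inv d)"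
      using assms by (intro smooth_on_subset[OF transition_smooth[OF d assms(1)]]) auto
    show "(snd c \<circ> chart_inv d) ` snd d ` (U \<inter> fst d) \<subseteq> snd c ` U"
      using d by auto
  qed
  then show "smooth_on (snd d ` (U \<inter> fst d)) (f \<circ> chart_inv d)"
    by (rule smooth_on_cong[OF op, THEN iffD1, rotated]) (use d assms in auto)
qed

text \<open>Components in \<open>d\<close> arise from those in \<open>c\<close> by the Jacobian of
  the transition map at a moving point: \<open>?h\<close> is that product in the coordinates of
  \<open>c\<close>, pulled back to \<open>d\<close> by the reverse transition.\<close>

lemma smooth_field_onI_chart:
  assumes "c \<in> A" "open U" "U \<subseteq> fst c" "smooth_on (snd c ` U) (field_components A c X)"
  shows "smooth_field_on A U X"
  unfolding smooth_field_on_def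
proof
  fix d assume d: "d \<in> A"
  have op: "open (snd d ` (U \<inter> fst d))"
    using d assms by (intro open_chart_image open_Int open_chart_domain) auto
  have op': "open (snd c ` (U \<inter> fst d))"
    using d assms by (intro open_chart_image open_Int open_chart_domain) auto
  let ?h = "\<lambda>u. frechet_derivative (snd d \<circ> chart_inv c) (at u) (field_components A c X u)"
  have "smooth_on (snd d ` (U \<inter> fst d)) (?h \<circ> (snd c \<circ> chart_inv d))"
  proof (rule smooth_on_compose[OF op op'])
    show "smooth_on (snd c ` (U \<inter> fst d)) ?h"
      using assms d by (intro smooth_on_frechet_field[OF op'] smooth_on_subset[OF transition_smooth[OF assms(1) d]]
          smooth_on_subset[OF assms(4)]) auto
    show "smooth_on (snd d ` (U \<inter> fst d)) (snd c \<circ> chart_inv d)"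
      using assms by (intro smooth_on_subset[OF transition_smooth[OF d assms(1)]]) auto
    show "(snd c \<circ> chart_inv d) ` snd d ` (U \<inter> fst d) \<subseteq> snd c ` (U \<inter> fst d)"
      using d by auto
  qed
  then show "smooth_on (snd d ` (U \<inter> fst d)) (field_components A d X)"
  proof (rule smooth_on_cong[OF op, THEN iffD1, rotated])
    fix y assume "y \<in> snd d ` (U \<inter> fst d)"
    then obtain q where q: "q \<in> U" "q \<in> fst d" "y = snd d q" by auto
    have "(?h \<circ> (snd c \<circ> chart_inv d)) y = jac c d q (field_components A c X (snd c q))"
      using q d by (simp add: jac_def)
    also have "\<dots> = field_components A d X y"
      using q d assms by (simp add: field_components_jac jac_comp subset_iff)
    finally show "(?h \<circ> (snd c \<circ> chart_inv d)) y = field_components A d X y" .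
  qed
qed

lemma smooth_fun_near_chart:
  assumes "c \<in> A" "p \<in> fst c"
  shows "smooth_fun_near A p f \<longleftrightarrow>
    (\<exists>U. open U \<and> p \<in> U \<and> U \<subseteq> fst c \<and> smooth_on (snd c ` U) (f \<circ> chart_inv c))"
proof
  assume "smooth_fun_near A p f"
  then obtain U where "open U" "p \<in> U" "smooth_fun_on A U f" unfolding smooth_fun_near_def by blast
  then show "\<exists>U. open U \<and> p \<in> U \<and> U \<subseteq> fst c \<and> smooth_on (snd c ` U) (f \<circ> chart_inv c)"
    using assms open_Int[OF _ open_chart_domain[OF assms(1)], of U] unfolding smooth_fun_on_def
    by (intro exI[of _ "U \<inter> fst c"]) auto
next
  assume "\<exists>U. open U \<and> p \<in> U \<and> U \<subseteq> fst c \<and> smooth_on (snd c ` U) (f \<circ> chart_inv c)"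
  then show "smooth_fun_near A p f"
    unfolding smooth_fun_near_def using smooth_fun_onI_chart[OF assms(1)] by blast
qed

lemma smooth_field_near_chart:
  assumes "c \<in> A" "p \<in> fst c"
  shows "smooth_field_near A p X \<longleftrightarrow>
    (\<exists>U. open U \<and> p \<in> U \<and> U \<subseteq> fst c \<and> smooth_on (snd c ` U) (field_components A c X))"
proof
  assume "smooth_field_near A p X"
  then obtain U where "open U" "p \<in> U" "smooth_field_on A U X" unfolding smooth_field_near_def by blast
  then show "\<exists>U. open U \<and> p \<in> U \<and> U \<subseteq> fst c \<and> smooth_on (snd c ` U) (field_components A c X)"
    using assms open_Int[OF _ open_chart_domain[OF assms(1)], of U] unfolding smooth_field_on_def
    by (intro exI[of _ "U \<inter> fst c"]) auto
next
  assume "\<exists>U. open U \<and> p \<in> U \<and> U \<subseteq> fst c \<and> smooth_on (snd c ` U) (field_components A c X)"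
  then show "smooth_field_near A p X"
    unfolding smooth_field_near_def using smooth_field_onI_chart[OF assms(1)] by blast
qed

lemma smooth_field_near_nbhd:
  "smooth_field_near A p X \<Longrightarrow> \<exists>U. open U \<and> p \<in> U \<and> (\<forall>q\<in>U. smooth_field_near A q X)"
  unfolding smooth_field_near_def by blast

lemma smooth_fun_near_cong:
  assumes "smooth_fun_near A p f" "open U" "p \<in> U" "\<And>q. q \<in> U \<Longrightarrow> f q = h q"
  shows "smooth_fun_near A p h"
proof -
  let ?c = "chart_at A p"
  obtain V where V: "open V" "p \<in> V" "V \<subseteq> fst ?c" "smooth_on (snd ?c ` V) (f \<circ> chart_inv ?c)"
    using assms(1) smooth_fun_near_chart[OF chart_at_in] by blast
  have op: "open (snd ?c ` (V \<inter> U))" using V assms by (intro open_chart_image) auto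
  have "smooth_on (snd ?c ` (V \<inter> U)) (f \<circ> chart_inv ?c)"
    using V by (auto intro: smooth_on_subset)
  then have "smooth_on (snd ?c ` (V \<inter> U)) (h \<circ> chart_inv ?c)"
    by (rule smooth_on_cong[OF op, THEN iffD1, rotated]) (use V assms in \<open>auto simp: subset_iff\<close>)
  then show ?thesis
    using V assms(2,3) by (subst smooth_fun_near_chart[OF chart_at_in]) (auto intro!: exI[of _ "V \<inter> U"])
qed

lemma smooth_field_near_cong:
  assumes "smooth_field_near A p X" "open U" "p \<in> U" "\<And>q. q \<in> U \<Longrightarrow> X q = Y q"
  shows "smooth_field_near A p Y"
proof -
  let ?c = "chart_at A p"
  obtain V where V: "open V" "p \<in> V" "V \<subseteq> fst ?c" "smooth_on (snd ?c ` V) (field_components A ?c X)"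
    using assms(1) smooth_field_near_chart[OF chart_at_in] by blast
  have op: "open (snd ?c ` (V \<inter> U))" using V assms by (intro open_chart_image) auto
  have "smooth_on (snd ?c ` (V \<inter> U)) (field_components A ?c X)"
    using V by (auto intro: smooth_on_subset)
  then have "smooth_on (snd ?c ` (V \<inter> U)) (field_components A ?c Y)"
    by (rule smooth_on_cong[OF op, THEN iffD1, rotated])
      (use V assms in \<open>auto simp: field_components_def subset_iff\<close>)
  then show ?thesis
    using V assms(2,3) by (subst smooth_field_near_chart[OF chart_at_in]) (auto intro!: exI[of _ "V \<inter> U"])
qed

lemma smooth_fun_near2:
  assumes "smooth_fun_near A p f" "smooth_fun_near A p h" "c \<in> A" "p \<in> fst c"
  obtains U where "open U" "p \<in> U" "U \<subseteq> fst c" "open (snd c ` U)"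
    "smooth_on (snd c ` U) (f \<circ> chart_inv c)" "smooth_on (snd c ` U) (h \<circ> chart_inv c)"
proof -
  obtain U where U: "open U" "p \<in> U" "U \<subseteq> fst c" "smooth_on (snd c ` U) (f \<circ> chart_inv c)"
    using assms(1,2) unfolding smooth_fun_near_chart[OF assms(3,4)] by blast
  obtain V where V: "open V" "p \<in> V" "V \<subseteq> fst c" "smooth_on (snd c ` V) (h \<circ> chart_inv c)"
    using assms(1,2) unfolding smooth_fun_near_chart[OF assms(3,4)] by blast
  show ?thesis
  proof (rule that[of "U \<inter> V"])
    show "open (snd c ` (U \<inter> V))" using U V assms(3) by (intro open_chart_image) auto
    show "smooth_on (snd c ` (U \<inter> V)) (f \<circ> chart_inv c)" by (rule smooth_on_subset[OF U(4)]) auto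
    show "smooth_on (snd c ` (U \<inter> V)) (h \<circ> chart_inv c)" by (rule smooth_on_subset[OF V(4)]) auto
  qed (use U V in auto)
qed

lemma smooth_field_near2:
  assumes "smooth_field_near A p X" "smooth_field_near A p Y" "c \<in> A" "p \<in> fst c"
  obtains U where "open U" "p \<in> U" "U \<subseteq> fst c" "open (snd c ` U)"
    "smooth_on (snd c ` U) (field_components A c X)" "smooth_on (snd c ` U) (field_components A c Y)"
proof -
  obtain U where U: "open U" "p \<in> U" "U \<subseteq> fst c" "smooth_on (snd c ` U) (field_components A c X)"
    using assms(1,2) unfolding smooth_field_near_chart[OF assms(3,4)] by blast
  obtain V where V: "open V" "p \<in> V" "V \<subseteq> fst c" "smooth_on (snd c ` V) (field_components A c Y)"
    using assms(1,2) unfolding smooth_field_near_chart[OF assms(3,4)] by blast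
  show ?thesis
  proof (rule that[of "U \<inter> V"])
    show "open (snd c ` (U \<inter> V))" using U V assms(3) by (intro open_chart_image) auto
    show "smooth_on (snd c ` (U \<inter> V)) (field_components A c X)" by (rule smooth_on_subset[OF U(4)]) auto
    show "smooth_on (snd c ` (U \<inter> V)) (field_components A c Y)" by (rule smooth_on_subset[OF V(4)]) auto
  qed (use U V in auto)
qed

section \<open>Algebra of locally smooth functions and fields\<close>

lemma smooth_fun_near_const: "smooth_fun_near A p (\<lambda>_. k)"
  by (subst smooth_fun_near_chart[OF chart_at_in])
    (auto simp: o_def smooth_on_const intro!: exI[of _ "fst (chart_at A p)"] open_chart_domain)

lemma smooth_fun_near_add:
  assumes "smooth_fun_near A p f" "smooth_fun_near A p h"
  shows "smooth_fun_near A p (\<lambda>q. f q + h q)"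
proof -
  obtain U where U: "open U" "p \<in> U" "U \<subseteq> fst (chart_at A p)" "open (snd (chart_at A p) ` U)"
    "smooth_on (snd (chart_at A p) ` U) (f \<circ> chart_inv (chart_at A p))"
    "smooth_on (snd (chart_at A p) ` U) (h \<circ> chart_inv (chart_at A p))"
    using smooth_fun_near2[OF assms chart_at_in] .
  show ?thesis
    using smooth_on_add[OF U(4-6)] U(1-3) by (subst smooth_fun_near_chart[OF chart_at_in]) (auto simp: o_def)
qed

lemma smooth_fun_near_mult:
  assumes "smooth_fun_near A p f" "smooth_fun_near A p h"
  shows "smooth_fun_near A p (\<lambda>q. f q * h q)"
proof -
  obtain U where U: "open U" "p \<in> U" "U \<subseteq> fst (chart_at A p)" "open (snd (chart_at A p) ` U)"
    "smooth_on (snd (chart_at A p) ` U) (f \<circ> chart_inv (chart_at A p))"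
    "smooth_on (snd (chart_at A p) ` U) (h \<circ> chart_inv (chart_at A p))"
    using smooth_fun_near2[OF assms chart_at_in] .
  show ?thesis
    using smooth_on_mult[OF U(4-6)] U(1-3) by (subst smooth_fun_near_chart[OF chart_at_in]) (auto simp: o_def)
qed

lemma smooth_fun_near_sum:
  "(\<And>i. i \<in> I \<Longrightarrow> smooth_fun_near A p (f i)) \<Longrightarrow> smooth_fun_near A p (\<lambda>q. \<Sum>i\<in>I. f i q)"
  by (induction I rule: infinite_finite_induct) (auto intro: smooth_fun_near_const smooth_fun_near_add)

lemma smooth_fun_near_inverse:
  assumes "smooth_fun_near A p f" "open V" "p \<in> V" "\<And>q. q \<in> V \<Longrightarrow> f q \<noteq> 0"
  shows "smooth_fun_near A p (\<lambda>q. inverse (f q))"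
proof -
  let ?c = "chart_at A p"
  obtain U where U: "open U" "p \<in> U" "U \<subseteq> fst ?c" "smooth_on (snd ?c ` U) (f \<circ> chart_inv ?c)"
    using assms(1) smooth_fun_near_chart[OF chart_at_in] by blast
  have op: "open (snd ?c ` (U \<inter> V))" using U assms by (intro open_chart_image) auto
  have "smooth_on (snd ?c ` (U \<inter> V)) (\<lambda>y. inverse ((f \<circ> chart_inv ?c) y))"
  proof (rule smooth_on_inverse[OF op])
    show "(f \<circ> chart_inv ?c) y \<noteq> 0" if "y \<in> snd ?c ` (U \<inter> V)" for y
      using that U(3) assms(4) by auto
    show "smooth_on (snd ?c ` (U \<inter> V)) (f \<circ> chart_inv ?c)" by (rule smooth_on_subset[OF U(4)]) auto
  qed
  then show ?thesis
    using U assms(2,3) by (subst smooth_fun_near_chart[OF chart_at_in]) (auto simp: o_def intro!: exI[of _ "U \<inter> V"])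
qed

lemma smooth_field_near_add:
  assumes "smooth_field_near A p X" "smooth_field_near A p Y"
  shows "smooth_field_near A p (\<lambda>q. X q + Y q)"
proof -
  let ?c = "chart_at A p"
  obtain U where U: "open U" "p \<in> U" "U \<subseteq> fst ?c" "open (snd ?c ` U)"
    "smooth_on (snd ?c ` U) (field_components A ?c X)" "smooth_on (snd ?c ` U) (field_components A ?c Y)"
    using smooth_field_near2[OF assms chart_at_in] .
  have "smooth_on (snd ?c ` U) (field_components A ?c (\<lambda>q. X q + Y q))"
  proof (rule smooth_on_cong[OF U(4), THEN iffD1, OF _ smooth_on_add[OF U(4-6)]])
    show "field_components A ?c X y + field_components A ?c Y y = field_components A ?c (\<lambda>q. X q + Y q) y"
      if "y \<in> snd ?c ` U" for y
      using that U(3) linear_add[OF linear_chart_components[OF chart_at_in(1)]]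
      by (auto simp: field_components_def subset_iff)
  qed
  then show ?thesis
    using U(1-3) by (subst smooth_field_near_chart[OF chart_at_in]) auto
qed

lemma smooth_field_near_scaleR:
  assumes "smooth_fun_near A p f" "smooth_field_near A p X"
  shows "smooth_field_near A p (\<lambda>q. f q *\<^sub>R X q)"
proof -
  let ?c = "chart_at A p"
  obtain U where U: "open U" "p \<in> U" "U \<subseteq> fst ?c" "smooth_on (snd ?c ` U) (f \<circ> chart_inv ?c)"
    using assms(1) smooth_fun_near_chart[OF chart_at_in] by blast
  obtain V where V: "open V" "p \<in> V" "V \<subseteq> fst ?c" "smooth_on (snd ?c ` V) (field_components A ?c X)"
    using assms(2) smooth_field_near_chart[OF chart_at_in] by blast
  have op: "open (snd ?c ` (U \<inter> V))" using U V by (intro open_chart_image) auto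
  have "smooth_on (snd ?c ` (U \<inter> V)) (\<lambda>y. (f \<circ> chart_inv ?c) y *\<^sub>R field_components A ?c X y)"
    by (intro smooth_on_scaleR[OF op] smooth_on_subset[OF U(4)] smooth_on_subset[OF V(4)]) auto
  then have "smooth_on (snd ?c ` (U \<inter> V)) (field_components A ?c (\<lambda>q. f q *\<^sub>R X q))"
  proof (rule smooth_on_cong[OF op, THEN iffD1, rotated])
    show "(f \<circ> chart_inv ?c) y *\<^sub>R field_components A ?c X y = field_components A ?c (\<lambda>q. f q *\<^sub>R X q) y"
      if "y \<in> snd ?c ` (U \<inter> V)" for y
      using that U(3) linear_scale[OF linear_chart_components[OF chart_at_in(1)]]
      by (auto simp: field_components_def subset_iff)
  qed
  then show ?thesis
    using U(1-3) V(1,2) by (subst smooth_field_near_chart[OF chart_at_in]) (auto intro!: exI[of _ "U \<inter> V"])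
qed

lemma smooth_field_near_uminus: "smooth_field_near A p X \<Longrightarrow> smooth_field_near A p (\<lambda>q. - X q)"
  using smooth_field_near_scaleR[OF smooth_fun_near_const[of p "-1"]] by simp

lemma smooth_field_near_diff:
  "smooth_field_near A p X \<Longrightarrow> smooth_field_near A p Y \<Longrightarrow> smooth_field_near A p (\<lambda>q. X q - Y q)"
  using smooth_field_near_add[of p X "\<lambda>q. - Y q"] smooth_field_near_uminus by simp

section \<open>Coordinate fields of the chart preferred at p\<close>

lemma field_components_extend:
  "q \<in> fst (chart_at A p) \<Longrightarrow> field_components A (chart_at A p) (extend A p v) (snd (chart_at A p) q) = v"
  unfolding field_components_def extend_def by simp

lemma smooth_field_near_extend:
  assumes "q \<in> fst (chart_at A p)"
  shows "smooth_field_near A q (extend A p v)"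
proof -
  let ?c = "chart_at A p"
  have op: "open (snd ?c ` fst ?c)" by (intro open_chart_image open_chart_domain) auto
  have "smooth_on (snd ?c ` fst ?c) (field_components A ?c (extend A p v))"
    by (rule smooth_on_cong[OF op, THEN iffD1, OF _ smooth_on_const[of _ v]]) (auto simp: field_components_extend)
  then show ?thesis
    using assms by (subst smooth_field_near_chart[of ?c]) (auto intro!: exI[of _ "fst ?c"] open_chart_domain)
qed

lemma smooth_field_near_extend' [simp]: "smooth_field_near A p (extend A p v)"
  by (simp add: smooth_field_near_extend)

lemma smooth_field_near_zero: "smooth_field_near A p (\<lambda>q. 0)"
  using smooth_field_near_scaleR[OF smooth_fun_near_const[of p 0] smooth_field_near_extend'] by simp

lemma smooth_field_near_sum:
  "(\<And>i. i \<in> I \<Longrightarrow> smooth_field_near A p (X i)) \<Longrightarrow> smooth_field_near A p (\<lambda>q. \<Sum>i\<in>I. X i q)"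
  by (induction I rule: infinite_finite_induct) (auto intro: smooth_field_near_zero smooth_field_near_add)

lemma extend_at [simp]: "extend A p v p = v"
  using chart_vector_components[OF chart_at_in, of p v] by (simp add: extend_def)

lemma linear_extend: "q \<in> fst (chart_at A p) \<Longrightarrow> linear (\<lambda>v. extend A p v q)"
  unfolding extend_def by (simp add: linear_chart_vector)

lemma extend_eq_0_iff: "q \<in> fst (chart_at A p) \<Longrightarrow> extend A p v q = 0 \<longleftrightarrow> v = 0"
  using chart_components_vector[of "chart_at A p" q v] linear_0[OF linear_extend]
    linear_0[OF linear_chart_components[of "chart_at A p" q]]
  unfolding extend_def by (metis chart_at_in(1))

definition frame_coeff :: "'m \<Rightarrow> ('m \<Rightarrow> real ^ 'n) \<Rightarrow> 'n \<Rightarrow> 'm \<Rightarrow> real" where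
  "frame_coeff p X i q = chart_components A (chart_at A p) q (X q) $ i"

text \<open>Near \<open>p\<close> a smooth field is a combination, with smooth coefficients, of the
  coordinate fields of one chart; a field vanishing at \<open>p\<close> thereby becomes a family of
  coefficients vanishing at \<open>p\<close>.\<close>

lemma frame_expansion:
  assumes "q \<in> fst (chart_at A p)"
  shows "X q = (\<Sum>i\<in>UNIV. frame_coeff p X i q *\<^sub>R extend A p (axis i 1) q)"
proof -
  let ?c = "chart_at A p" and ?u = "chart_components A (chart_at A p) q (X q)"
  have "X q = chart_vector A ?c q ?u" using assms by simp
  also have "?u = (\<Sum>i\<in>UNIV. ?u $ i *\<^sub>R axis i 1)"
    using basis_expansion[of ?u] by (simp add: scalar_mult_eq_scaleR)
  also have "chart_vector A ?c q \<dots> = (\<Sum>i\<in>UNIV. ?u $ i *\<^sub>R chart_vector A ?c q (axis i 1))"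
    using linear_chart_vector[OF chart_at_in(1) assms] by (simp add: linear_sum linear_scale)
  finally show ?thesis unfolding frame_coeff_def extend_def .
qed

lemma smooth_frame_coeff:
  assumes "q \<in> fst (chart_at A p)" "smooth_field_near A q X"
  shows "smooth_fun_near A q (frame_coeff p X i)"
proof -
  let ?c = "chart_at A p"
  obtain U where U: "open U" "q \<in> U" "U \<subseteq> fst ?c" "smooth_on (snd ?c ` U) (field_components A ?c X)"
    using assms(2) smooth_field_near_chart[OF chart_at_in(1) assms(1)] by blast
  have "smooth_on (snd ?c ` U) (\<lambda>y. field_components A ?c X y $ i)"
    using U by (intro smooth_on_linear[OF open_chart_image bounded_linear_vec_nth]) auto
  moreover have "(\<lambda>y. field_components A ?c X y $ i) = frame_coeff p X i \<circ> chart_inv ?c"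
    by (auto simp: fun_eq_iff field_components_def frame_coeff_def)
  ultimately show ?thesis
    using U assms by (subst smooth_fun_near_chart[of ?c]) auto
qed

section \<open>Directional derivatives and Lie brackets\<close>

text \<open>Only first derivatives of the Schouten and Weyl tensors are taken, so differentiability
  at one point, in the chart that \<open>dir_deriv\<close> uses, suffices for them.\<close>

definition differentiable_fun_at :: "'m \<Rightarrow> ('m \<Rightarrow> real) \<Rightarrow> bool" where
  "differentiable_fun_at p f \<longleftrightarrow>
     (f \<circ> chart_inv (chart_at A p)) differentiable (at (snd (chart_at A p) p))"

lemma smooth_imp_differentiable: "smooth_fun_near A p f \<Longrightarrow> differentiable_fun_at p f"
  using smooth_fun_near_chart[OF chart_at_in, of p f] smooth_on_differentiable
  unfolding differentiable_fun_at_def by blast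

lemma dir_deriv_has_derivative:
  "differentiable_fun_at p f \<Longrightarrow>
    ((f \<circ> chart_inv (chart_at A p)) has_derivative (\<lambda>v. dir_deriv A p v f)) (at (snd (chart_at A p) p))"
  unfolding differentiable_fun_at_def dir_deriv_def frechet_derivative_works .

lemma dir_derivI:
  assumes "((f \<circ> chart_inv (chart_at A p)) has_derivative F) (at (snd (chart_at A p) p))"
  shows "differentiable_fun_at p f" "dir_deriv A p v f = F v"
  using assms frechet_derivative_at[OF assms] unfolding differentiable_fun_at_def dir_deriv_def differentiable_def
  by auto

lemma dir_deriv_linear: "differentiable_fun_at p f \<Longrightarrow> linear (\<lambda>v. dir_deriv A p v f)"
  using dir_deriv_has_derivative has_derivative_linear by blast

lemma differentiable_fun_at_add:
  assumes "differentiable_fun_at p f" "differentiable_fun_at p h"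
  shows "differentiable_fun_at p (\<lambda>q. f q + h q)"
    and "dir_deriv A p v (\<lambda>q. f q + h q) = dir_deriv A p v f + dir_deriv A p v h"
  by (rule dir_derivI; use has_derivative_add[OF assms[THEN dir_deriv_has_derivative]] in \<open>simp add: o_def\<close>)+

lemma differentiable_fun_at_diff:
  assumes "differentiable_fun_at p f" "differentiable_fun_at p h"
  shows "differentiable_fun_at p (\<lambda>q. f q - h q)"
    and "dir_deriv A p v (\<lambda>q. f q - h q) = dir_deriv A p v f - dir_deriv A p v h"
  by (rule dir_derivI; use has_derivative_diff[OF assms[THEN dir_deriv_has_derivative]] in \<open>simp add: o_def\<close>)+

lemma differentiable_fun_at_mult:
  assumes "differentiable_fun_at p f" "differentiable_fun_at p h"
  shows "differentiable_fun_at p (\<lambda>q. f q * h q)"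
    and "dir_deriv A p v (\<lambda>q. f q * h q) = f p * dir_deriv A p v h + dir_deriv A p v f * h p"
proof -
  have d: "((\<lambda>q. f q * h q) \<circ> chart_inv (chart_at A p) has_derivative
      (\<lambda>v. f p * dir_deriv A p v h + dir_deriv A p v f * h p)) (at (snd (chart_at A p) p))"
    using has_derivative_mult[OF assms[THEN dir_deriv_has_derivative]] by (simp add: o_def)
  show "differentiable_fun_at p (\<lambda>q. f q * h q)"
    and "dir_deriv A p v (\<lambda>q. f q * h q) = f p * dir_deriv A p v h + dir_deriv A p v f * h p"
    by (rule dir_derivI[OF d])+
qed

lemma differentiable_fun_at_const:
  "differentiable_fun_at p (\<lambda>_. k)" "dir_deriv A p v (\<lambda>_. k) = 0"
proof -
  have d: "((\<lambda>_. k) \<circ> chart_inv (chart_at A p) has_derivative (\<lambda>_. 0)) (at (snd (chart_at A p) p))"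
    by (simp add: o_def)
  show "differentiable_fun_at p (\<lambda>_. k)" "dir_deriv A p v (\<lambda>_. k) = 0" by (rule dir_derivI[OF d])+
qed

lemma differentiable_fun_at_cmult:
  assumes "differentiable_fun_at p f"
  shows "differentiable_fun_at p (\<lambda>q. k * f q)" "dir_deriv A p v (\<lambda>q. k * f q) = k * dir_deriv A p v f"
  using differentiable_fun_at_mult[OF differentiable_fun_at_const(1) assms]
  by (simp_all add: differentiable_fun_at_const)

lemma differentiable_fun_at_sum:
  "(\<And>i. i \<in> I \<Longrightarrow> differentiable_fun_at p (f i)) \<Longrightarrow> differentiable_fun_at p (\<lambda>q. \<Sum>i\<in>I. f i q)"
  by (induction I rule: infinite_finite_induct) (auto intro: differentiable_fun_at_const differentiable_fun_at_add)

lemma differentiable_fun_at_prod: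
  "(\<And>i. i \<in> I \<Longrightarrow> differentiable_fun_at p (f i)) \<Longrightarrow> differentiable_fun_at p (\<lambda>q. \<Prod>i\<in>I. f i q)"
  by (induction I rule: infinite_finite_induct) (auto intro: differentiable_fun_at_const differentiable_fun_at_mult)

lemma differentiable_fun_at_divide:
  assumes "differentiable_fun_at p f" "differentiable_fun_at p h" "h p \<noteq> 0"
  shows "differentiable_fun_at p (\<lambda>q. f q / h q)"
  using assms differentiable_divide[of "f \<circ> chart_inv (chart_at A p)" _ _ "h \<circ> chart_inv (chart_at A p)"]
  unfolding differentiable_fun_at_def by (simp add: o_def)

lemma differentiable_fun_at_cong:
  assumes "open U" "p \<in> U" "\<And>q. q \<in> U \<Longrightarrow> f q = h q"
  shows "differentiable_fun_at p f \<longleftrightarrow> differentiable_fun_at p h" "dir_deriv A p v f = dir_deriv A p v h"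
proof -
  let ?c = "chart_at A p"
  have op: "open (snd ?c ` (U \<inter> fst ?c))"
    using assms by (intro open_chart_image open_Int open_chart_domain) auto
  have m: "snd ?c p \<in> snd ?c ` (U \<inter> fst ?c)" using assms by simp
  have e: "(f \<circ> chart_inv ?c) y = (h \<circ> chart_inv ?c) y" if "y \<in> snd ?c ` (U \<inter> fst ?c)" for y
    using that assms(3) by auto
  show "differentiable_fun_at p f \<longleftrightarrow> differentiable_fun_at p h"
    unfolding differentiable_fun_at_def by (rule differentiable_cong_open[OF op m e])
  show "dir_deriv A p v f = dir_deriv A p v h"
    unfolding dir_deriv_def
    by (rule arg_cong[of _ _ "\<lambda>D. D v"], rule frechet_derivative_cong_open[OF op m e])
qed

text \<open>\<open>dir_deriv\<close> at \<open>q\<close> works in the chart preferred at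
  \<open>q\<close>, whereas \<open>extend A p v\<close> is constant in the chart preferred at
  \<open>p\<close>. The Jacobian hidden in \<open>extend\<close> is the one produced by the chain
  rule, so the derivative can be read in a single chart for all \<open>q\<close>.\<close>

lemma dir_deriv_extend:
  assumes "q \<in> fst (chart_at A p)" "smooth_fun_near A q f"
  shows "dir_deriv A q (extend A p v q) f =
    frechet_derivative (f \<circ> chart_inv (chart_at A p)) (at (snd (chart_at A p) q)) v"
proof -
  let ?c = "chart_at A p" and ?d = "chart_at A q"
  have 1: "((snd ?d \<circ> chart_inv ?c) has_derivative jac ?c ?d q) (at (snd ?c q))"
    using assms by (intro jac_has_derivative) auto
  have 2: "((f \<circ> chart_inv ?d) has_derivative (\<lambda>v. dir_deriv A q v f)) (at ((snd ?d \<circ> chart_inv ?c) (snd ?c q)))"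
    using dir_deriv_has_derivative[OF smooth_imp_differentiable[OF assms(2)]] assms(1) by simp
  have op: "open (snd ?c ` (fst ?c \<inter> fst ?d))"
    by (intro open_chart_image open_Int open_chart_domain) auto
  have "(f \<circ> chart_inv ?c has_derivative (\<lambda>v. dir_deriv A q v f) \<circ> jac ?c ?d q) (at (snd ?c q))"
    by (rule has_derivative_transform_within_open[OF diff_chain_at[OF 1 2] op]) (use assms(1) in auto)
  from frechet_derivative_at[OF this] show ?thesis
    by (metis comp_apply extend_def chart_vector_jac)
qed

lemma dir_deriv_extend_near:
  assumes "q \<in> fst (chart_at A p)" "smooth_fun_near A q f"
  obtains U where "open U" "q \<in> U" "U \<subseteq> fst (chart_at A p)"
    "smooth_on (snd (chart_at A p) ` U) (f \<circ> chart_inv (chart_at A p))"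
    "\<forall>r\<in>U. \<forall>v. dir_deriv A r (extend A p v r) f =
      frechet_derivative (f \<circ> chart_inv (chart_at A p)) (at (snd (chart_at A p) r)) v"
proof -
  obtain U where U: "open U" "q \<in> U" "U \<subseteq> fst (chart_at A p)"
    "smooth_on (snd (chart_at A p) ` U) (f \<circ> chart_inv (chart_at A p))"
    using assms(2) smooth_fun_near_chart[OF chart_at_in(1) assms(1)] by blast
  have "smooth_fun_near A r f" if "r \<in> U" for r
    using that U smooth_fun_near_chart[OF chart_at_in(1), of r p f] by blast
  with U(3) have "\<forall>r\<in>U. \<forall>v. dir_deriv A r (extend A p v r) f =
      frechet_derivative (f \<circ> chart_inv (chart_at A p)) (at (snd (chart_at A p) r)) v"
    using dir_deriv_extend by blast
  with U that show thesis by blast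
qed

lemma smooth_dir_deriv_extend:
  assumes "q \<in> fst (chart_at A p)" "smooth_fun_near A q f"
  shows "smooth_fun_near A q (\<lambda>r. dir_deriv A r (extend A p v r) f)"
proof -
  let ?c = "chart_at A p"
  obtain U where U: "open U" "q \<in> U" "U \<subseteq> fst ?c" "smooth_on (snd ?c ` U) (f \<circ> chart_inv ?c)"
    "\<forall>r\<in>U. \<forall>v. dir_deriv A r (extend A p v r) f = frechet_derivative (f \<circ> chart_inv ?c) (at (snd ?c r)) v"
    using dir_deriv_extend_near[OF assms] .
  have op: "open (snd ?c ` U)" using U by (intro open_chart_image) auto
  have "smooth_on (snd ?c ` U) ((\<lambda>r. dir_deriv A r (extend A p v r) f) \<circ> chart_inv ?c)"
  proof (rule smooth_on_cong[OF op, THEN iffD1, OF _ smooth_on_frechet[OF U(4), of v]])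
    show "frechet_derivative (f \<circ> chart_inv ?c) (at y) v = ((\<lambda>r. dir_deriv A r (extend A p v r) f) \<circ> chart_inv ?c) y"
      if "y \<in> snd ?c ` U" for y using that U(3,5) by auto
  qed
  then show ?thesis
    using U assms by (subst smooth_fun_near_chart[of ?c]) auto
qed

text \<open>In the chart preferred at \<open>p\<close> both sides are iterated derivatives in
  constant directions, so this is symmetry of the second derivative.\<close>

lemma dir_deriv_commute:
  assumes "smooth_fun_near A p f"
  shows "dir_deriv A p x (\<lambda>q. dir_deriv A q (extend A p y q) f) =
         dir_deriv A p y (\<lambda>q. dir_deriv A q (extend A p x q) f)"
proof -
  let ?c = "chart_at A p"
  obtain U where U: "open U" "p \<in> U" "U \<subseteq> fst ?c" "smooth_on (snd ?c ` U) (f \<circ> chart_inv ?c)"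
    "\<forall>r\<in>U. \<forall>v. dir_deriv A r (extend A p v r) f = frechet_derivative (f \<circ> chart_inv ?c) (at (snd ?c r)) v"
    using dir_deriv_extend_near[OF chart_at_in(2) assms] .
  have op: "open (snd ?c ` U)" using U by (intro open_chart_image) auto
  have "dir_deriv A p x (\<lambda>q. dir_deriv A q (extend A p y q) f) =
     frechet_derivative (\<lambda>u. frechet_derivative (f \<circ> chart_inv ?c) (at u) y) (at (snd ?c p)) x" for x y
  proof -
    have "frechet_derivative ((\<lambda>q. dir_deriv A q (extend A p y q) f) \<circ> chart_inv ?c) (at (snd ?c p)) =
      frechet_derivative (\<lambda>u. frechet_derivative (f \<circ> chart_inv ?c) (at u) y) (at (snd ?c p))"
    proof (rule frechet_derivative_cong_open[OF op])
      show "((\<lambda>q. dir_deriv A q (extend A p y q) f) \<circ> chart_inv ?c) u = frechet_derivative (f \<circ> chart_inv ?c) (at u) y"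
        if "u \<in> snd ?c ` U" for u using that U(3,5) by auto
    qed (use U in auto)
    then show ?thesis by (simp add: dir_deriv_def)
  qed
  then show ?thesis
    using second_derivative_symmetric_real[OF op U(4)] U(2) by auto
qed

text \<open>The bracket at \<open>q\<close> is computed in the chart preferred at \<open>q\<close>,
  where the components of the coordinate fields are values of the Jacobian of
  \<open>?\<tau>\<close>. Differentiating them gives second derivatives of \<open>?\<tau>\<close>,
  which are symmetric.\<close>

lemma lie_bracket_extend:
  assumes "q \<in> fst (chart_at A p)"
  shows "lie_bracket A (extend A p x) (extend A p y) q = 0"
proof -
  let ?c = "chart_at A p" and ?d = "chart_at A q"
  let ?\<tau> = "snd ?d \<circ> chart_inv ?c" and ?\<sigma> = "snd ?c \<circ> chart_inv ?d"
  let ?S = "snd ?c ` (fst ?c \<inter> fst ?d)" and ?T = "snd ?d ` (fst ?c \<inter> fst ?d)"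
  have op: "open ?S" "open ?T"
    by (intro open_chart_image open_Int open_chart_domain; simp)+
  have sm: "smooth_on ?S ?\<tau>" by (intro transition_smooth) auto
  have mem: "snd ?c q \<in> ?S" "snd ?d q \<in> ?T" using assms by auto
  let ?F = "\<lambda>v u. frechet_derivative ?\<tau> (at u) v"
  \<comment> \<open>The reverse transition \<open>?\<sigma>\<close> only reparametrises; the
    Jacobian it contributes turns \<open>extend A p x q\<close> back into the coordinate vector
    \<open>x\<close>.\<close>
  have fc: "frechet_derivative (field_components A ?d (extend A p y)) (at (snd ?d q)) (extend A p x q) =
      frechet_derivative (?F y) (at (snd ?c q)) x" for x y
  proof -
    have "frechet_derivative (field_components A ?d (extend A p y)) (at (snd ?d q)) =
        frechet_derivative (?F y \<circ> ?\<sigma>) (at (snd ?d q))"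
    proof (rule frechet_derivative_cong_open[OF op(2) mem(2)])
      fix u assume "u \<in> ?T"
      then obtain r where r: "r \<in> fst ?c" "r \<in> fst ?d" "u = snd ?d r" by auto
      then have "field_components A ?d (extend A p y) u = jac ?c ?d r y"
        by (simp add: field_components_jac extend_def chart_vector_jac jac_comp)
      also have "\<dots> = (?F y \<circ> ?\<sigma>) u" using r by (simp add: jac_def)
      finally show "field_components A ?d (extend A p y) u = (?F y \<circ> ?\<sigma>) u" .
    qed
    moreover have "((?F y \<circ> ?\<sigma>) has_derivative frechet_derivative (?F y) (at (snd ?c q)) \<circ> jac ?d ?c q) (at (snd ?d q))"
    proof (rule diff_chain_at)
      show "(?\<sigma> has_derivative jac ?d ?c q) (at (snd ?d q))"
        using assms by (intro jac_has_derivative) auto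
      show "(?F y has_derivative frechet_derivative (?F y) (at (snd ?c q))) (at (?\<sigma> (snd ?d q)))"
        using smooth_on_differentiable[OF smooth_on_frechet[OF sm] mem(1)] assms
        by (simp add: frechet_derivative_works)
    qed
    ultimately have "frechet_derivative (field_components A ?d (extend A p y)) (at (snd ?d q)) =
        frechet_derivative (?F y) (at (snd ?c q)) \<circ> jac ?d ?c q"
      using frechet_derivative_at by metis
    then show ?thesis
      using assms by (simp add: extend_def chart_vector_jac jac_comp jac_self)
  qed
  show ?thesis
    unfolding lie_bracket_def Let_def fc
    using second_derivative_symmetric[OF op(1) sm mem(1), of x y] by simp
qed

end

section \<open>The Levi-Civita connection and its curvature\<close>

context smooth_manifold
begin

lemma smooth_field_on_subset: "smooth_field_on A U X \<Longrightarrow> V \<subseteq> U \<Longrightarrow> smooth_field_on A V X"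
  unfolding smooth_field_on_def by (meson smooth_on_subset image_mono Int_mono subset_refl)

lemma affine_connection_smooth:
  assumes affine: "affine_connection A D" and near: "smooth_field_near A p X" "smooth_field_near A p Y"
  shows "smooth_field_near A p (\<lambda>q. D q (X q) Y)"
proof -
  obtain U V where "open U" "p \<in> U" "smooth_field_on A U X" "open V" "p \<in> V" "smooth_field_on A V Y"
    using near unfolding smooth_field_near_def by blast
  then have "open (U \<inter> V)" "p \<in> U \<inter> V" "smooth_field_on A (U \<inter> V) X" "smooth_field_on A (U \<inter> V) Y"
    using smooth_field_on_subset[of U X "U \<inter> V"] smooth_field_on_subset[of V Y "U \<inter> V"] by auto
  then show ?thesis
    using affine[unfolded affine_connection_def, THEN conjunct2, THEN conjunct2, THEN conjunct2, rule_format, of "U \<inter> V" X Y]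
    unfolding smooth_field_near_def by blast
qed

end

locale levi_civita_manifold = smooth_manifold A
  for A :: "('m::{t2_space, second_countable_topology}, 'n::finite) chart set" +
  fixes g :: "('m, 'n) metric" and D :: "('m, 'n) connection"
  assumes metric: "riemannian_metric A g" and connection: "levi_civita A g D"
begin

lemma g_bilinear: "bilinear (g p)"
  using metric unfolding riemannian_metric_def by blast

lemma g_sym: "g p v w = g p w v"
  using metric unfolding riemannian_metric_def by blast

lemma g_pos: "v \<noteq> 0 \<Longrightarrow> g p v v > 0"
  using metric unfolding riemannian_metric_def by blast

lemmas g_simps = bilinear_ladd[OF g_bilinear] bilinear_radd[OF g_bilinear]
  bilinear_lsub[OF g_bilinear] bilinear_rsub[OF g_bilinear]
  bilinear_lneg[OF g_bilinear] bilinear_rneg[OF g_bilinear]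
  bilinear_lzero[OF g_bilinear] bilinear_rzero[OF g_bilinear]
  bilinear_lmul[OF g_bilinear] bilinear_rmul[OF g_bilinear]

lemma g_nondegenerate:
  assumes "\<And>t. g p v t = g p w t"
  shows "v = w"
  using assms[of "v - w"] g_pos[of "v - w" p] by (auto simp: g_simps)

lemma smooth_metric:
  assumes "smooth_field_near A p X" "smooth_field_near A p Y"
  shows "smooth_fun_near A p (\<lambda>q. g q (X q) (Y q))"
proof -
  obtain U V where "open U" "p \<in> U" "smooth_field_on A U X" "open V" "p \<in> V" "smooth_field_on A V Y"
    using assms unfolding smooth_field_near_def by blast
  then have "open (U \<inter> V)" "p \<in> U \<inter> V" "smooth_field_on A (U \<inter> V) X" "smooth_field_on A (U \<inter> V) Y"
    using smooth_field_on_subset[of U X "U \<inter> V"] smooth_field_on_subset[of V Y "U \<inter> V"] by auto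
  then show ?thesis
    using metric[unfolded riemannian_metric_def, THEN conjunct2, THEN conjunct2, THEN conjunct2, rule_format, of "U \<inter> V" X Y]
    unfolding smooth_fun_near_def by blast
qed

lemma affine: "affine_connection A D"
  using connection unfolding levi_civita_def by blast

lemma D_linear: "smooth_field_near A p Y \<Longrightarrow> linear (\<lambda>v. D p v Y)"
  by (rule affine[unfolded affine_connection_def, THEN conjunct1, rule_format])

lemma D_add:
  "smooth_field_near A p Y \<Longrightarrow> smooth_field_near A p Z \<Longrightarrow> D p v (\<lambda>q. Y q + Z q) = D p v Y + D p v Z"
  by (rule affine[unfolded affine_connection_def, THEN conjunct2, THEN conjunct1, rule_format])

lemma D_scaleR:
  "smooth_fun_near A p f \<Longrightarrow> smooth_field_near A p Y \<Longrightarrow>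
    D p v (\<lambda>q. f q *\<^sub>R Y q) = dir_deriv A p v f *\<^sub>R Y p + f p *\<^sub>R D p v Y"
  by (rule affine[unfolded affine_connection_def, THEN conjunct2, THEN conjunct2, THEN conjunct1, rule_format])

lemma D_smooth:
  "smooth_field_near A p X \<Longrightarrow> smooth_field_near A p Y \<Longrightarrow> smooth_field_near A p (\<lambda>q. D q (X q) Y)"
  by (rule affine_connection_smooth[OF affine])

lemma D_torsion_free:
  "smooth_field_near A p X \<Longrightarrow> smooth_field_near A p Y \<Longrightarrow>
    D p (X p) Y - D p (Y p) X = lie_bracket A X Y p"
  by (rule connection[unfolded levi_civita_def, THEN conjunct2, THEN conjunct1, rule_format])

lemma D_metric:
  "smooth_field_near A p Y \<Longrightarrow> smooth_field_near A p Z \<Longrightarrow>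
    dir_deriv A p v (\<lambda>q. g q (Y q) (Z q)) = g p (D p v Y) (Z p) + g p (Y p) (D p v Z)"
  by (rule connection[unfolded levi_civita_def, THEN conjunct2, THEN conjunct2, rule_format])

lemma D_uminus: "smooth_field_near A p Y \<Longrightarrow> D p v (\<lambda>q. - Y q) = - D p v Y"
  using D_scaleR[OF smooth_fun_near_const[of p "-1"], of Y v] by (simp add: differentiable_fun_at_const)

lemma D_diff:
  "smooth_field_near A p Y \<Longrightarrow> smooth_field_near A p Z \<Longrightarrow> D p v (\<lambda>q. Y q - Z q) = D p v Y - D p v Z"
  using D_add[of p Y "\<lambda>q. - Z q" v] D_uminus[of p Z v] smooth_field_near_uminus[of p Z] by simp

lemma D_zero: "D p v (\<lambda>q. 0) = 0"
  using D_scaleR[OF smooth_fun_near_const[of p 0] smooth_field_near_zero, of v]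
  by (simp add: differentiable_fun_at_const)

lemma D_sum:
  "(\<And>i. i \<in> I \<Longrightarrow> smooth_field_near A p (Y i)) \<Longrightarrow> D p v (\<lambda>q. \<Sum>i\<in>I. Y i q) = (\<Sum>i\<in>I. D p v (Y i))"
  by (induction I rule: infinite_finite_induct) (auto simp: D_zero D_add smooth_field_near_sum)

text \<open>A field vanishing on \<open>U\<close> is unchanged when multiplied by the indicator function of the
  complement of \<open>U\<close>, which is smooth near every point of \<open>U\<close>.\<close>

lemma D_local:
  assumes "smooth_field_near A p X" "smooth_field_near A p Y"
    and "open U" "p \<in> U" "\<And>q. q \<in> U \<Longrightarrow> X q = Y q"
  shows "D p v X = D p v Y"
proof -
  define Z where "Z q = X q - Y q" for q
  define f :: "'m \<Rightarrow> real" where "f q = (if q \<in> U then 0 else 1)" for q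
  have Z: "smooth_field_near A p Z"
    unfolding Z_def using assms(1,2) by (rule smooth_field_near_diff)
  have f: "smooth_fun_near A p f"
    by (rule smooth_fun_near_cong[OF smooth_fun_near_const[of p 0] assms(3,4)]) (simp add: f_def)
  have "(\<lambda>q. f q *\<^sub>R Z q) = Z"
    using assms(5) by (auto simp: f_def Z_def fun_eq_iff)
  then have "D p v Z = dir_deriv A p v f *\<^sub>R Z p + f p *\<^sub>R D p v Z"
    using D_scaleR[OF f Z, of v] by simp
  then have "D p v Z = 0"
    using assms(4,5) by (simp add: f_def Z_def)
  then show ?thesis
    using D_diff[OF assms(1,2), of v] by (simp add: Z_def[abs_def])
qed

section \<open>Tensoriality of the second covariant derivative and of curvature\<close>

lemma D_extend_commute:
  assumes "q \<in> fst (chart_at A p)"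
  shows "D q (extend A p x q) (extend A p y) = D q (extend A p y q) (extend A p x)"
  using D_torsion_free[OF smooth_field_near_extend[OF assms] smooth_field_near_extend[OF assms], of x y]
    lie_bracket_extend[OF assms, of x y] by simp

text \<open>The second covariant derivative of \<open>Z\<close>. The subtracted term cancels the
  derivative of \<open>Y\<close>, so that only \<open>Y p\<close> matters; this lets the curvature
  at \<open>q\<close> be computed from fields extended from another point.\<close>

definition second_cov :: "'m \<Rightarrow> real ^ 'n \<Rightarrow> ('m \<Rightarrow> real ^ 'n) \<Rightarrow> ('m \<Rightarrow> real ^ 'n) \<Rightarrow> real ^ 'n" where
  "second_cov p x Y Z = D p x (\<lambda>q. D q (Y q) Z) - D p (D p x Y) Z"

text \<open>In the coordinate frame \<open>Y\<close> has coefficients vanishing at \<open>p\<close>.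
  The Leibniz rule leaves only their derivatives, and both terms of \<open>second_cov\<close> reduce
  to the same sum.\<close>

lemma second_cov_eq_0:
  assumes Y: "smooth_field_near A p Y" and Z: "smooth_field_near A p Z" and "Y p = 0"
  shows "second_cov p x Y Z = 0"
proof -
  define a where "a = frame_coeff p Y"
  define E where "E i = extend A p (axis i (1::real))" for i
  have a: "smooth_fun_near A p (a i)" for i
    unfolding a_def using Y by (simp add: smooth_frame_coeff)
  have E: "smooth_field_near A p (E i)" for i unfolding E_def by simp
  have a0: "a i p = 0" for i
    using assms(3) by (simp add: a_def frame_coeff_def)
  have exp: "Y q = (\<Sum>i\<in>UNIV. a i q *\<^sub>R E i q)" if "q \<in> fst (chart_at A p)" for q
    unfolding a_def E_def by (rule frame_expansion[OF that])
  obtain U where U: "open U" "p \<in> U" "\<And>q. q \<in> U \<Longrightarrow> smooth_field_near A q Z"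
    using smooth_field_near_nbhd[OF Z] by blast
  have sm: "smooth_field_near A p (\<lambda>q. a i q *\<^sub>R D q (E i q) Z)" for i
    by (intro smooth_field_near_scaleR a D_smooth E Z)
  have "D p x (\<lambda>q. D q (Y q) Z) = D p x (\<lambda>q. \<Sum>i\<in>UNIV. a i q *\<^sub>R D q (E i q) Z)"
  proof (rule D_local[OF D_smooth[OF Y Z]])
    show "open (U \<inter> fst (chart_at A p))" using U(1) by (intro open_Int open_chart_domain) auto
    show "D q (Y q) Z = (\<Sum>i\<in>UNIV. a i q *\<^sub>R D q (E i q) Z)" if "q \<in> U \<inter> fst (chart_at A p)" for q
      using exp[of q] that
      by (simp add: linear_sum[OF D_linear[OF U(3)[of q]]] linear_scale[OF D_linear[OF U(3)[of q]]])
  qed (use U sm in \<open>auto intro: smooth_field_near_sum\<close>)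
  also have "\<dots> = (\<Sum>i\<in>UNIV. D p x (\<lambda>q. a i q *\<^sub>R D q (E i q) Z))"
    by (rule D_sum) (rule sm)
  also have "\<dots> = (\<Sum>i\<in>UNIV. dir_deriv A p x (a i) *\<^sub>R D p (E i p) Z)"
    by (simp add: D_scaleR[OF a D_smooth[OF E Z]] a0)
  finally have 1: "D p x (\<lambda>q. D q (Y q) Z) = (\<Sum>i\<in>UNIV. dir_deriv A p x (a i) *\<^sub>R D p (E i p) Z)" .
  have sm': "smooth_field_near A p (\<lambda>q. a i q *\<^sub>R E i q)" for i
    by (intro smooth_field_near_scaleR a E)
  have "D p x Y = D p x (\<lambda>q. \<Sum>i\<in>UNIV. a i q *\<^sub>R E i q)"
    by (rule D_local[OF Y _ open_chart_domain[of "chart_at A p"]])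
      (use exp sm' in \<open>auto intro: smooth_field_near_sum\<close>)
  also have "\<dots> = (\<Sum>i\<in>UNIV. D p x (\<lambda>q. a i q *\<^sub>R E i q))"
    by (rule D_sum) (rule sm')
  also have "\<dots> = (\<Sum>i\<in>UNIV. dir_deriv A p x (a i) *\<^sub>R E i p)"
    by (simp add: D_scaleR[OF a E] a0)
  finally have "D p (D p x Y) Z = (\<Sum>i\<in>UNIV. dir_deriv A p x (a i) *\<^sub>R D p (E i p) Z)"
    by (simp add: linear_sum[OF D_linear[OF Z]] linear_scale[OF D_linear[OF Z]])
  with 1 show ?thesis by (simp add: second_cov_def)
qed

lemma second_cov_tensorial:
  assumes Y: "smooth_field_near A p Y" and Y': "smooth_field_near A p Y'"
    and Z: "smooth_field_near A p Z" and eq: "Y p = Y' p"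
  shows "second_cov p x Y Z = second_cov p x Y' Z"
proof -
  have YY: "smooth_field_near A p (\<lambda>q. Y q - Y' q)" by (rule smooth_field_near_diff[OF Y Y'])
  obtain U where U: "open U" "p \<in> U" "\<And>q. q \<in> U \<Longrightarrow> smooth_field_near A q Z"
    using smooth_field_near_nbhd[OF Z] by blast
  have "D p x (\<lambda>q. D q (Y q - Y' q) Z) = D p x (\<lambda>q. D q (Y q) Z - D q (Y' q) Z)"
    by (rule D_local[OF D_smooth[OF YY Z] smooth_field_near_diff[OF D_smooth[OF Y Z] D_smooth[OF Y' Z]] U(1,2)])
      (rule linear_diff[OF D_linear[OF U(3)]])
  also have "\<dots> = D p x (\<lambda>q. D q (Y q) Z) - D p x (\<lambda>q. D q (Y' q) Z)"
    by (rule D_diff[OF D_smooth[OF Y Z] D_smooth[OF Y' Z]])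
  finally have "second_cov p x (\<lambda>q. Y q - Y' q) Z = second_cov p x Y Z - second_cov p x Y' Z"
    using D_diff[OF Y Y', of x] linear_diff[OF D_linear[OF Z]] by (simp add: second_cov_def)
  then show ?thesis using second_cov_eq_0[OF YY Z, of x] eq by simp
qed

text \<open>The curvature acting on a field \<open>Z\<close> rather than on a vector. The bracket
  term is absent because the coordinate fields extending \<open>x\<close> and \<open>y\<close>
  commute.\<close>

definition curv_field :: "'m \<Rightarrow> real ^ 'n \<Rightarrow> real ^ 'n \<Rightarrow> ('m \<Rightarrow> real ^ 'n) \<Rightarrow> real ^ 'n" where
  "curv_field p x y Z = D p x (\<lambda>q. D q (extend A p y q) Z) - D p y (\<lambda>q. D q (extend A p x q) Z)"

lemma curvature_op_eq: "curvature_op A D p x y z = curv_field p x y (extend A p z)"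
  unfolding curvature_op_def curv_field_def Let_def
  using linear_0[OF D_linear[OF smooth_field_near_extend']] by (simp add: lie_bracket_extend)

text \<open>Antisymmetrising the second derivative of \<open>g(Z, T)\<close>.\<close>

lemma curv_field_skew:
  assumes Z: "smooth_field_near A p Z" and T: "smooth_field_near A p T"
  shows "g p (curv_field p x y Z) (T p) = - g p (Z p) (curv_field p x y T)"
proof -
  let ?h = "\<lambda>q. g q (Z q) (T q)"
  have h: "smooth_fun_near A p ?h" by (rule smooth_metric[OF Z T])
  obtain U where U: "open U" "p \<in> U" "\<And>q. q \<in> U \<Longrightarrow> smooth_field_near A q Z"
    using smooth_field_near_nbhd[OF Z] by blast
  obtain V where V: "open V" "p \<in> V" "\<And>q. q \<in> V \<Longrightarrow> smooth_field_near A q T"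
    using smooth_field_near_nbhd[OF T] by blast
  have "dir_deriv A p x (\<lambda>q. dir_deriv A q (extend A p y q) ?h) =
     g p (D p x (\<lambda>q. D q (extend A p y q) Z)) (T p) + g p (D p y Z) (D p x T)
     + g p (D p x Z) (D p y T) + g p (Z p) (D p x (\<lambda>q. D q (extend A p y q) T))" for x y
  proof -
    let ?Z = "\<lambda>q. D q (extend A p y q) Z" and ?T = "\<lambda>q. D q (extend A p y q) T"
    have Z': "smooth_field_near A p ?Z" and T': "smooth_field_near A p ?T"
      by (simp_all add: D_smooth Z T)
    have "dir_deriv A p x (\<lambda>q. dir_deriv A q (extend A p y q) ?h) =
        dir_deriv A p x (\<lambda>q. g q (?Z q) (T q) + g q (Z q) (?T q))"
      by (rule differentiable_fun_at_cong(2)[of "U \<inter> V"]) (use U V in \<open>auto simp: D_metric\<close>)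
    also have "\<dots> = dir_deriv A p x (\<lambda>q. g q (?Z q) (T q)) + dir_deriv A p x (\<lambda>q. g q (Z q) (?T q))"
      by (intro differentiable_fun_at_add smooth_imp_differentiable smooth_metric Z T Z' T')
    finally show ?thesis by (simp add: D_metric Z T Z' T')
  qed
  then show ?thesis
    using dir_deriv_commute[OF h, of x y] by (simp add: curv_field_def g_simps)
qed

text \<open>\<open>curv_field_skew\<close> moves the operator from \<open>Z\<close> to an extension
  of the test vector \<open>t\<close>; what remains involves \<open>Z\<close> only through
  \<open>Z p\<close>.\<close>

lemma curv_field_tensorial:
  assumes "smooth_field_near A p Z"
  shows "curv_field p x y Z = curvature_op A D p x y (Z p)"
proof (rule g_nondegenerate[of p])
  fix t
  show "g p (curv_field p x y Z) t = g p (curvature_op A D p x y (Z p)) t"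
    using curv_field_skew[OF assms smooth_field_near_extend'[of p t], of x y]
      curv_field_skew[OF smooth_field_near_extend'[of p "Z p"] smooth_field_near_extend'[of p t], of x y]
    by (simp add: curvature_op_eq)
qed

text \<open>By definition the curvature at \<open>q\<close> uses extensions from \<open>q\<close>;
  here the extensions from \<open>p\<close> serve all \<open>q\<close> at once, which is what
  smoothness in \<open>q\<close> calls for. The corrections in the two copies of
  \<open>second_cov\<close> cancel since the fields commute.\<close>

lemma curvature_op_extend:
  assumes q: "q \<in> fst (chart_at A p)" and Z: "smooth_field_near A q Z"
  shows "curvature_op A D q (extend A p x q) (extend A p y q) (Z q) =
    D q (extend A p x q) (\<lambda>r. D r (extend A p y r) Z) - D q (extend A p y q) (\<lambda>r. D r (extend A p x r) Z)"
proof -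
  let ?X = "extend A p x" and ?Y = "extend A p y"
  have X: "smooth_field_near A q ?X" and Y: "smooth_field_near A q ?Y"
    using q by (simp_all add: smooth_field_near_extend)
  have "D q (?X q) (\<lambda>r. D r (?Y r) Z) - D q (?Y q) (\<lambda>r. D r (?X r) Z) =
    second_cov q (?X q) ?Y Z - second_cov q (?Y q) ?X Z"
    using D_extend_commute[OF q, of x y] by (simp add: second_cov_def)
  also have "\<dots> = second_cov q (?X q) (extend A q (?Y q)) Z - second_cov q (?Y q) (extend A q (?X q)) Z"
    using second_cov_tensorial[OF Y smooth_field_near_extend' Z] second_cov_tensorial[OF X smooth_field_near_extend' Z]
    by simp
  also have "\<dots> = curv_field q (?X q) (?Y q) Z"
    using D_extend_commute[of q q "?X q" "?Y q"] by (simp add: second_cov_def curv_field_def)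
  finally show ?thesis using curv_field_tensorial[OF Z] by simp
qed

lemma smooth_curvature_op:
  "smooth_field_near A p (\<lambda>q. curvature_op A D q (extend A p x q) (extend A p y q) (extend A p z q))"
proof (rule smooth_field_near_cong[OF _ open_chart_domain[of "chart_at A p"]])
  show "smooth_field_near A p (\<lambda>q. D q (extend A p x q) (\<lambda>r. D r (extend A p y r) (extend A p z))
     - D q (extend A p y q) (\<lambda>r. D r (extend A p x r) (extend A p z)))"
    by (intro smooth_field_near_diff D_smooth smooth_field_near_extend')
qed (simp_all add: curvature_op_extend smooth_field_near_extend)

end

section \<open>Algebraic curvature tensors\<close>

text \<open>The algebraic symmetries of a Riemann tensor on one vector space. Linearity is asked for
  in the last slot alone; pair symmetry and antisymmetry carry it to the others.\<close>

definition curvature_like :: "('v::real_vector \<Rightarrow> 'v \<Rightarrow> 'v \<Rightarrow> 'v \<Rightarrow> real) \<Rightarrow> bool" where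
  "curvature_like F \<longleftrightarrow> (\<forall>x y z t. F x y z t = - F y x z t \<and> F x y z t = - F x y t z \<and>
     F x y z t + F y z x t + F z x y t = 0) \<and> (\<forall>x y z. linear (F x y z))"

lemma curvature_likeD:
  assumes "curvature_like F"
  shows "F x y z t = - F y x z t" "F x y z t = - F x y t z" "F x y z t + F y z x t + F z x y t = 0"
    "linear (F x y z)"
  using assms unfolding curvature_like_def by blast+

text \<open>The classical argument: four instances of the first Bianchi identity, one for each
  vector in last place, combine so that antisymmetry leaves twice the difference of the two
  sides.\<close>

lemma curvature_like_pair:
  assumes "curvature_like F"
  shows "F x y z t = F z t x y"
proof -
  note s1 = curvature_likeD(1)[OF assms] and s2 = curvature_likeD(2)[OF assms]
    and b = curvature_likeD(3)[OF assms]
  have "F x y z t + F y z x t + F z x y t = 0" "F y z t x + F z t y x + F t y z x = 0"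
    "F z t x y + F t x z y + F x z t y = 0" "F t x y z + F x y t z + F y t x z = 0"
    by (rule b)+
  moreover have "F y z t x = - F y z x t" "F z t y x = - F z t x y" "F x y t z = - F x y z t"
    "F t x z y = - F t x y z"
    by (rule s2)+
  moreover have "F t y z x = F y t x z" "F x z t y = F z x y t"
    using s1[of t y z x] s2[of y t z x] s1[of x z t y] s2[of z x t y] by simp_all
  ultimately show ?thesis by linarith
qed

lemma curvature_like_linear:
  assumes "curvature_like F"
  shows "linear (\<lambda>x. F x y z t)" "linear (\<lambda>y. F x y z t)" "linear (\<lambda>z. F x y z t)" "linear (\<lambda>t. F x y z t)"
proof -
  note l = curvature_likeD(4)[OF assms]
  show 4: "linear (\<lambda>t. F x y z t)" for x y z using l by simp
  show 3: "linear (\<lambda>z. F x y z t)" for x y t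
    using linear_compose_neg[OF 4[of x y t]] by (subst curvature_likeD(2)[OF assms])
  show 1: "linear (\<lambda>x. F x y z t)" for y z t
    using 3[of z t y] by (subst curvature_like_pair[OF assms])
  show "linear (\<lambda>y. F x y z t)"
    using linear_compose_neg[OF 1[of x z t]] by (subst curvature_likeD(1)[OF assms])
qed

lemma curvature_like_diff:
  assumes "curvature_like F" "curvature_like H"
  shows "curvature_like (\<lambda>x y z t. F x y z t - H x y z t)"
  unfolding curvature_like_def
proof (intro conjI allI)
  fix x y z t
  note f = curvature_likeD(1-3)[OF assms(1)] and h = curvature_likeD(1-3)[OF assms(2)]
  show "F x y z t - H x y z t = - (F y x z t - H y x z t)" using f(1)[of x y] h(1)[of x y] by simp
  show "F x y z t - H x y z t = - (F x y t z - H x y t z)" using f(2)[of x y z t] h(2)[of x y z t] by simp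
  show "F x y z t - H x y z t + (F y z x t - H y z x t) + (F z x y t - H z x y t) = 0"
    using f(3)[of x y z t] h(3)[of x y z t] by simp
  show "linear (\<lambda>t. F x y z t - H x y z t)"
    using assms[THEN curvature_likeD(4)] by (intro linear_compose_sub)
qed

lemma curvature_like_kulkarni_nomizu:
  assumes "bilinear (g p)" "\<And>v w. g p v w = g p w v" "bilinear (h p)" "\<And>v w. h p v w = h p w v"
  shows "curvature_like (kulkarni_nomizu g h p)"
  unfolding curvature_like_def
proof (intro conjI allI)
  fix x y z t
  note s = assms(2,4)
  show "kulkarni_nomizu g h p x y z t = - kulkarni_nomizu g h p y x z t"
    by (simp add: kulkarni_nomizu_def)
  show "kulkarni_nomizu g h p x y z t = - kulkarni_nomizu g h p x y t z"
    by (simp add: kulkarni_nomizu_def)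
  show "kulkarni_nomizu g h p x y z t + kulkarni_nomizu g h p y z x t + kulkarni_nomizu g h p z x y t = 0"
    using s[of x y] s[of y z] s[of z x] by (simp add: kulkarni_nomizu_def)
  have "linear (\<lambda>t. g p x t * h p y z + g p y z * h p x t - g p x z * h p y t - g p y t * h p x z)"
    using bilinear_radd[OF assms(1)] bilinear_radd[OF assms(3)] bilinear_rmul[OF assms(1)] bilinear_rmul[OF assms(3)]
    by (intro linearI) (simp_all add: algebra_simps)
  then show "linear (kulkarni_nomizu g h p x y z)"
    by (simp add: kulkarni_nomizu_def[abs_def])
qed

context levi_civita_manifold
begin

lemma curvature_like_riemann: "curvature_like (riemann A g D p)"
  unfolding curvature_like_def
proof (intro conjI allI)
  fix x y z t
  show "riemann A g D p x y z t = - riemann A g D p y x z t"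
    by (simp add: riemann_def curvature_op_eq curv_field_def g_simps)
  show "riemann A g D p x y z t = - riemann A g D p x y t z"
    using curv_field_skew[OF smooth_field_near_extend'[of p z] smooth_field_near_extend'[of p t], of x y]
    by (simp add: riemann_def curvature_op_eq g_sym[of p z])
  have "D p x (\<lambda>q. D q (extend A p y q) (extend A p z)) = D p x (\<lambda>q. D q (extend A p z q) (extend A p y))" for x y z
    by (rule D_local[OF _ _ open_chart_domain[of "chart_at A p"]])
      (auto intro!: D_smooth smooth_field_near_extend D_extend_commute)
  note c = this
  show "riemann A g D p x y z t + riemann A g D p y z x t + riemann A g D p z x y t = 0"
    using c[of x y z] c[of y z x] c[of z x y] by (simp add: riemann_def curvature_op_eq curv_field_def g_simps)
  have "linear (g p (curvature_op A D p x y z))"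
    using g_bilinear unfolding bilinear_def by blast
  then show "linear (riemann A g D p x y z)"
    unfolding riemann_def .
qed

lemma smooth_riemann:
  "smooth_fun_near A p (\<lambda>q. riemann A g D q (extend A p x q) (extend A p y q) (extend A p z q) (extend A p t q))"
  unfolding riemann_def by (intro smooth_metric smooth_curvature_op smooth_field_near_extend')

end

section \<open>Frames of an inner product\<close>

definition inner_like :: "('v::real_vector \<Rightarrow> 'v \<Rightarrow> real) \<Rightarrow> bool" where
  "inner_like b \<longleftrightarrow> bilinear b \<and> (\<forall>v w. b v w = b w v) \<and> (\<forall>v. v \<noteq> 0 \<longrightarrow> b v v > 0)"

text \<open>Allowing a common squared length \<open>c\<close> lets frames that are orthonormal for a
  rescaled metric be handled with the original inner product.\<close>

definition scaled_frame ::
  "(real ^ 'n \<Rightarrow> real ^ 'n \<Rightarrow> real) \<Rightarrow> real \<Rightarrow> ('n::finite \<Rightarrow> real ^ 'n) \<Rightarrow> bool" where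
  "scaled_frame b c e \<longleftrightarrow> c > 0 \<and> (\<forall>i j. b (e i) (e j) = (if i = j then c else 0))"

lemma inner_likeD:
  assumes "inner_like b"
  shows "bilinear b" "b v w = b w v" "v \<noteq> 0 \<Longrightarrow> b v v > 0"
  using assms unfolding inner_like_def by blast+

lemma inner_like_eqI:
  assumes "inner_like b" "\<And>t. b v t = b w t"
  shows "v = w"
  using assms(2)[of "v - w"] inner_likeD(3)[OF assms(1), of "v - w"]
  by (auto simp: bilinear_lsub[OF inner_likeD(1)[OF assms(1)]])

lemma bilinear_linear:
  assumes "bilinear B"
  shows "linear (\<lambda>x. B x y)" "linear (B x)"
  using assms unfolding bilinear_def by blast+

lemma bilinear_lsum: "bilinear B \<Longrightarrow> B (\<Sum>i\<in>I. c i *\<^sub>R f i) y = (\<Sum>i\<in>I. c i * B (f i) y)"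
  by (simp add: linear_sum[OF bilinear_linear(1)] bilinear_lmul)

lemma bilinear_rsum: "bilinear B \<Longrightarrow> B x (\<Sum>i\<in>I. c i *\<^sub>R f i) = (\<Sum>i\<in>I. c i * B x (f i))"
  by (simp add: linear_sum[OF bilinear_linear(2)] bilinear_rmul)

section \<open>Expansions and traces in scaled frames\<close>

lemma frame_expand:
  fixes e :: "'n::finite \<Rightarrow> real ^ 'n"
  assumes b: "inner_like b" and e: "scaled_frame b c e"
  shows "(\<Sum>i\<in>UNIV. b x (e i) *\<^sub>R e i) = c *\<^sub>R x"
proof -
  note bil = inner_likeD(1)[OF b]
  have c: "c > 0" and ee: "\<And>i j. b (e i) (e j) = (if i = j then c else 0)"
    using e unfolding scaled_frame_def by auto
  define L where "L v = (\<Sum>i\<in>UNIV. v $ i *\<^sub>R e i)" for v :: "real ^ 'n"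
  have L: "linear L"
    unfolding L_def by (intro linearI) (simp_all add: algebra_simps sum.distrib scaleR_sum_right)
  have bL: "b (L v) (e j) = c * v $ j" for v j
  proof -
    have "b (L v) (e j) = (\<Sum>i\<in>UNIV. v $ i * b (e i) (e j))"
      unfolding L_def by (rule bilinear_lsum[OF bil])
    also have "\<dots> = (\<Sum>i\<in>UNIV. if i = j then v $ i * c else 0)" by (intro sum.cong) (auto simp: ee)
    finally show ?thesis by simp
  qed
  have "inj L"
  proof (subst linear_injective_0[OF L], intro allI impI)
    fix v assume "L v = 0"
    then have "c * v $ j = 0" for j using bL[of v j] by (simp add: bilinear_lzero[OF bil])
    then show "v = 0" using c by (simp add: vec_eq_iff)
  qed
  then obtain v where v: "x = L v"
    using linear_injective_imp_surjective[OF L] by (metis surjD)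
  have "(\<Sum>i\<in>UNIV. b x (e i) *\<^sub>R e i) = (\<Sum>i\<in>UNIV. c *\<^sub>R (v $ i *\<^sub>R e i))"
    unfolding v bL by simp
  also have "\<dots> = c *\<^sub>R x" unfolding v L_def by (simp add: scaleR_sum_right)
  finally show ?thesis .
qed

text \<open>Expand each \<open>e' i\<close> in \<open>e\<close>, exchange the sums and collect the
  expansion of \<open>e j\<close> in \<open>e'\<close>, which carries the factor \<open>c\<close>.
  Every power of the conformal factor that comes from a contraction originates here.\<close>

lemma frame_trace:
  fixes e e' :: "'n::finite \<Rightarrow> real ^ 'n"
  assumes b: "inner_like b" and e: "scaled_frame b 1 e" and e': "scaled_frame b c e'" and B: "bilinear B"
  shows "(\<Sum>i\<in>UNIV. B (e' i) (e' i)) = c * (\<Sum>i\<in>UNIV. B (e i) (e i))"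
proof -
  have "(\<Sum>i\<in>UNIV. B (e' i) (e' i)) = (\<Sum>i\<in>UNIV. B (\<Sum>j\<in>UNIV. b (e' i) (e j) *\<^sub>R e j) (e' i))"
    using frame_expand[OF b e] by simp
  also have "\<dots> = (\<Sum>i\<in>UNIV. \<Sum>j\<in>UNIV. b (e' i) (e j) * B (e j) (e' i))"
    by (simp add: bilinear_lsum[OF B])
  also have "\<dots> = (\<Sum>j\<in>UNIV. \<Sum>i\<in>UNIV. b (e j) (e' i) * B (e j) (e' i))"
    by (subst sum.swap) (simp add: inner_likeD(2)[OF b])
  also have "\<dots> = (\<Sum>j\<in>UNIV. B (e j) (\<Sum>i\<in>UNIV. b (e j) (e' i) *\<^sub>R e' i))"
    by (simp add: bilinear_rsum[OF B])
  also have "\<dots> = c * (\<Sum>j\<in>UNIV. B (e j) (e j))"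
    using frame_expand[OF b e'] by (simp add: bilinear_rmul[OF B] sum_distrib_left)
  finally show ?thesis .
qed

lemma frame_contract:
  fixes e :: "'n::finite \<Rightarrow> real ^ 'n"
  assumes b: "inner_like b" and e: "scaled_frame b 1 e" and l: "linear l"
  shows "(\<Sum>i\<in>UNIV. b x (e i) * l (e i)) = (l x :: real)" "(\<Sum>i\<in>UNIV. b (e i) x * l (e i)) = l x"
proof -
  have "l x = l (\<Sum>i\<in>UNIV. b x (e i) *\<^sub>R e i)" using frame_expand[OF b e, of x] by simp
  also have "\<dots> = (\<Sum>i\<in>UNIV. b x (e i) * l (e i))"
    by (simp add: linear_sum[OF l] linear_scale[OF l])
  finally show 1: "(\<Sum>i\<in>UNIV. b x (e i) * l (e i)) = l x" by simp
  then show "(\<Sum>i\<in>UNIV. b (e i) x * l (e i)) = l x"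
    by (simp add: inner_likeD(2)[OF b, of _ x])
qed

text \<open>Gram-Schmidt along the index set. As \<open>k\<close> lies outside \<open>I\<close>, the
  span built so far has dimension below \<open>CARD('n)\<close>, and a vector outside it supplies
  the next direction.\<close>

lemma orthonormal_on_exists:
  fixes b :: "real ^ 'n::finite \<Rightarrow> real ^ 'n \<Rightarrow> real"
  assumes b: "inner_like b" and "finite I"
  shows "\<exists>e :: 'n \<Rightarrow> real ^ 'n. \<forall>i\<in>I. \<forall>j\<in>I. b (e i) (e j) = (if i = j then 1 else 0)"
  using assms(2)
proof (induction I)
  case (insert k I)
  note bil = inner_likeD(1)[OF b]
  obtain e :: "'n \<Rightarrow> real ^ 'n" where e: "\<forall>i\<in>I. \<forall>j\<in>I. b (e i) (e j) = (if i = j then 1 else 0)"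
    using insert by blast
  have "dim (span (e ` I)) \<le> card (e ` I)" using insert by (simp add: dim_le_card')
  also have "\<dots> \<le> card I" using insert by (simp add: card_image_le)
  also have "\<dots> < card (insert k I)" using insert by simp
  also have "\<dots> \<le> CARD('n)" by (intro card_mono) auto
  finally have "dim (span (e ` I)) < CARD('n)" .
  moreover have "dim (UNIV :: (real ^ 'n) set) = CARD('n)" by simp
  ultimately have "span (e ` I) \<noteq> UNIV" by (metis less_irrefl)
  then obtain v where v: "v \<notin> span (e ` I)" by blast
  define u where "u = v - (\<Sum>i\<in>I. b v (e i) *\<^sub>R e i)"
  have "u \<noteq> 0"
  proof
    assume "u = 0"
    then have "v = (\<Sum>i\<in>I. b v (e i) *\<^sub>R e i)" by (simp add: u_def)
    moreover have "\<dots> \<in> span (e ` I)" by (intro span_sum span_scale span_base) auto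
    ultimately show False using v by simp
  qed
  then have uu: "b u u > 0" using inner_likeD(3)[OF b] by blast
  have ue: "b u (e j) = 0" if "j \<in> I" for j
  proof -
    have "b (\<Sum>i\<in>I. b v (e i) *\<^sub>R e i) (e j) = (\<Sum>i\<in>I. b v (e i) * b (e i) (e j))"
      by (rule bilinear_lsum[OF bil])
    also have "\<dots> = (\<Sum>i\<in>I. if i = j then b v (e i) else 0)"
      using e that by (intro sum.cong) auto
    also have "\<dots> = b v (e j)" using insert that by simp
    finally show ?thesis by (simp add: u_def bilinear_lsub[OF bil])
  qed
  then have eu: "b (e j) u = 0" if "j \<in> I" for j using that inner_likeD(2)[OF b] by metis
  define e' where "e' = e(k := (1 / sqrt (b u u)) *\<^sub>R u)"
  have "b (e' i) (e' j) = (if i = j then 1 else 0)" if "i \<in> insert k I" "j \<in> insert k I" for i j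
    using that e insert(2) uu ue eu
    by (auto simp: e'_def bilinear_lmul[OF bil] bilinear_rmul[OF bil] real_sqrt_mult[symmetric])
  then show ?case by blast
qed simp

lemma orthonormal_frame_scaled:
  fixes g :: "('m, 'b::finite) metric"
  assumes "inner_like (g p)"
  shows "scaled_frame (g p) 1 (orthonormal_frame g p)"
proof -
  have "\<exists>e :: 'b \<Rightarrow> real ^ 'b. \<forall>i j. g p (e i) (e j) = (if i = j then 1 else 0)"
    using orthonormal_on_exists[OF assms finite[of UNIV]] by (simp split del: if_split)
  from someI_ex[OF this] show ?thesis
    unfolding scaled_frame_def orthonormal_frame_def by simp
qed

text \<open>\<open>ricci\<close> is a trace in the standard basis, while contractions use
  orthonormal frames; expanding the standard basis in \<open>e\<close> and exchanging sums joins the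
  two.\<close>

lemma trace_frame:
  fixes L :: "real ^ 'n::finite \<Rightarrow> real ^ 'n"
  assumes b: "inner_like b" and e: "scaled_frame b 1 e" and L: "linear L"
  shows "trace (matrix L) = (\<Sum>j\<in>UNIV. b (L (e j)) (e j))"
proof -
  have be: "(\<Sum>i\<in>UNIV. x $ i *\<^sub>R axis i 1) = x" for x :: "real ^ 'n"
    using basis_expansion[of x] by (simp add: scalar_mult_eq_scaleR)
  have "trace (matrix L) = (\<Sum>i\<in>UNIV. L (axis i 1) $ i)"
    by (simp add: trace_def matrix_def)
  also have "\<dots> = (\<Sum>i\<in>UNIV. \<Sum>j\<in>UNIV. b (axis i 1) (e j) * L (e j) $ i)"
  proof (rule sum.cong[OF refl])
    fix i
    have "linear (\<lambda>x. L x $ i)" by (intro linearI) (simp_all add: linear_add[OF L] linear_scale[OF L])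
    from frame_contract(1)[OF b e this, of "axis i 1"]
    show "L (axis i 1) $ i = (\<Sum>j\<in>UNIV. b (axis i 1) (e j) * L (e j) $ i)" by simp
  qed
  also have "\<dots> = (\<Sum>j\<in>UNIV. \<Sum>i\<in>UNIV. L (e j) $ i * b (axis i 1) (e j))"
    by (subst sum.swap) (simp add: mult.commute)
  also have "\<dots> = (\<Sum>j\<in>UNIV. b (\<Sum>i\<in>UNIV. L (e j) $ i *\<^sub>R axis i 1) (e j))"
    by (simp add: bilinear_lsum[OF inner_likeD(1)[OF b]])
  also have "\<dots> = (\<Sum>j\<in>UNIV. b (L (e j)) (e j))"
    by (simp only: be)
  finally show ?thesis .
qed

text \<open>With \<open>F\<close> the vector belonging to given components in a chart and
  \<open>F'\<close> the components of a vector, a trace is expressed in the coordinate frame; this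
  makes \<open>ricci\<close> visibly smooth.\<close>

lemma trace_conjugate:
  fixes L F F' :: "real ^ 'n::finite \<Rightarrow> real ^ 'n"
  assumes "linear L" "linear F" "linear F'" "\<And>v. F (F' v) = v"
  shows "trace (matrix L) = (\<Sum>i\<in>UNIV. F' (L (F (axis i 1))) $ i)"
proof -
  have "(\<Sum>i\<in>UNIV. F' (L (F (axis i 1))) $ i) = trace (matrix (F' \<circ> (L \<circ> F)))"
    by (simp add: trace_def matrix_def)
  also have "\<dots> = trace (matrix F' ** (matrix L ** matrix F))"
    using assms by (simp add: matrix_compose linear_compose)
  also have "\<dots> = trace ((matrix L ** matrix F) ** matrix F')" by (rule trace_mul_sym)
  also have "\<dots> = trace (matrix L ** matrix (F \<circ> F'))"
    using assms by (simp add: matrix_compose matrix_mul_assoc)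
  also have "F \<circ> F' = id" using assms(4) by auto
  finally show ?thesis by (simp only: matrix_id_mat_1 matrix_mul_rid)
qed

text \<open>The Gram matrix of the basis \<open>F (axis i 1)\<close> is inverted by Cramer's rule, which expresses the
  inverse differentiably in terms of the entries.\<close>

definition gram_inverse :: "real ^ 'n ^ 'n \<Rightarrow> 'n::finite \<Rightarrow> 'n \<Rightarrow> real" where
  "gram_inverse M j k = det (\<chi> i l. if l = j then axis k 1 $ i else M $ i $ l) / det M"

text \<open>A kernel vector \<open>x\<close> of the Gram matrix yields an \<open>F x\<close> of
  length zero, which positivity and injectivity exclude.\<close>

lemma gram_det_nonzero:
  fixes F :: "real ^ 'n::finite \<Rightarrow> real ^ 'n"
  assumes b: "inner_like b" and F: "linear F" "inj F"
  shows "det (\<chi> i j. b (F (axis i 1)) (F (axis j 1))) \<noteq> 0"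
    and "((\<chi> i j. b (F (axis i 1)) (F (axis j 1))) *v x) $ i = b (F (axis i 1)) (F x)"
proof -
  let ?M = "\<chi> i j. b (F (axis i 1)) (F (axis j 1))"
  note bil = inner_likeD(1)[OF b]
  have Fx: "F x = (\<Sum>j\<in>UNIV. x $ j *\<^sub>R F (axis j 1))" for x
    using basis_expansion[of x]
    by (subst linear_scale[OF F(1), symmetric], subst linear_sum[OF F(1), symmetric])
      (simp add: scalar_mult_eq_scaleR)
  show M: "(?M *v x) $ i = b (F (axis i 1)) (F x)" for x i
    by (subst Fx) (simp add: matrix_vector_mult_def bilinear_rsum[OF bil] mult.commute)
  have "x = 0" if "?M *v x = 0" for x
  proof -
    have "b (F x) (F x) = (\<Sum>i\<in>UNIV. x $ i * b (F (axis i 1)) (F x))"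
      by (subst (1) Fx) (rule bilinear_lsum[OF bil])
    also have "\<dots> = 0" using M[of x] that by (metis (no_types, lifting) mult_zero_right sum.neutral zero_index)
    finally have "F x = 0" using inner_likeD(3)[OF b, of "F x"] by auto
    then show ?thesis using F linear_injective_0 by blast
  qed
  then have "invertible ?M"
    using matrix_left_invertible_ker invertible_left_inverse by blast
  then show "det ?M \<noteq> 0" by (simp add: invertible_det_nz)
qed

lemma frame_trace_basis:
  fixes F :: "real ^ 'n::finite \<Rightarrow> real ^ 'n"
  assumes b: "inner_like b" and e: "scaled_frame b 1 e" and F: "linear F" "inj F" and B: "bilinear B"
  shows "(\<Sum>i\<in>UNIV. B (e i) (e i)) = (\<Sum>k\<in>UNIV. \<Sum>j\<in>UNIV.
    gram_inverse (\<chi> i j. b (F (axis i 1)) (F (axis j 1))) j k * B (F (axis k 1)) (F (axis j 1)))"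
proof -
  let ?M = "\<chi> i j. b (F (axis i 1)) (F (axis j 1))" and ?E = "\<lambda>i. F (axis i 1)"
  \<comment> \<open>The basis dual to \<open>?E\<close> under \<open>b\<close>; by Cramer's rule its
    coordinates are the columns of the inverse Gram matrix.\<close>
  define u where "u k = F (\<chi> j. gram_inverse ?M j k)" for k
  have Fx: "F x = (\<Sum>j\<in>UNIV. x $ j *\<^sub>R ?E j)" for x
    using basis_expansion[of x]
    by (subst linear_scale[OF F(1), symmetric], subst linear_sum[OF F(1), symmetric])
      (simp add: scalar_mult_eq_scaleR)
  have Eu: "b (?E i) (u k) = (if i = k then 1 else 0)" for i k
  proof -
    have "?M *v (\<chi> j. gram_inverse ?M j k) = axis k 1"
      unfolding gram_inverse_def by (subst cramer[OF gram_det_nonzero(1)[OF b F]]) (rule refl)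
    moreover have "b (?E i) (u k) = (?M *v (\<chi> j. gram_inverse ?M j k)) $ i"
      by (simp only: u_def gram_det_nonzero(2)[OF b F])
    ultimately show ?thesis by (simp add: axis_def)
  qed
  have bu: "x = (\<Sum>k\<in>UNIV. b x (u k) *\<^sub>R ?E k)" for x
  proof -
    obtain y where y: "x = F y" using linear_injective_imp_surjective[OF F] by (metis surjD)
    have "b x (u k) = y $ k" for k
    proof -
      have "b x (u k) = (\<Sum>j\<in>UNIV. y $ j * b (?E j) (u k))"
        unfolding y by (subst Fx) (rule bilinear_lsum[OF inner_likeD(1)[OF b]])
      also have "\<dots> = (\<Sum>j\<in>UNIV. if j = k then y $ j else 0)" by (intro sum.cong) (auto simp: Eu)
      finally show ?thesis by simp
    qed
    then show ?thesis using Fx[of y] y by simp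
  qed
  have "(\<Sum>i\<in>UNIV. B (e i) (e i)) = (\<Sum>i\<in>UNIV. B (\<Sum>k\<in>UNIV. b (e i) (u k) *\<^sub>R ?E k) (e i))"
    using bu by simp
  also have "\<dots> = (\<Sum>k\<in>UNIV. \<Sum>i\<in>UNIV. b (u k) (e i) * B (?E k) (e i))"
    by (subst sum.swap) (simp add: bilinear_lsum[OF B] inner_likeD(2)[OF b])
  also have "\<dots> = (\<Sum>k\<in>UNIV. B (?E k) (u k))"
    by (simp add: frame_contract(1)[OF b e bilinear_linear(2)[OF B]])
  also have "\<dots> = (\<Sum>k\<in>UNIV. \<Sum>j\<in>UNIV. gram_inverse ?M j k * B (?E k) (?E j))"
    unfolding u_def by (subst Fx) (simp add: bilinear_rsum[OF B])
  finally show ?thesis .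
qed

text \<open>Tracing the outer slots, the trace n of the metric yields n h, the two mixed terms yield
  - h each, and the remaining term is g times the trace of h.\<close>

lemma kulkarni_nomizu_trace:
  fixes e :: "'n::finite \<Rightarrow> real ^ 'n"
  assumes b: "inner_like (g p)" and e: "scaled_frame (g p) 1 e"
    and h: "bilinear (h p)" "\<And>v w. h p v w = h p w v"
  shows "(\<Sum>i\<in>UNIV. kulkarni_nomizu g h p (e i) x y (e i)) =
    (real CARD('n) - 2) * h p x y + g p x y * (\<Sum>i\<in>UNIV. h p (e i) (e i))"
proof -
  have "(\<Sum>i\<in>UNIV. g p (e i) (e i)) = real CARD('n)"
    using e by (simp add: scaled_frame_def)
  then show ?thesis
    unfolding kulkarni_nomizu_def
    using frame_contract[OF b e bilinear_linear(2)[OF h(1)], of y x]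
      frame_contract[OF b e bilinear_linear(1)[OF h(1)], of x y]
    by (simp add: sum.distrib sum_subtractf sum_distrib_right[symmetric] sum_distrib_left[symmetric]
        algebra_simps)
qed

section \<open>Ricci, Schouten and Weyl tensors\<close>

context levi_civita_manifold
begin

lemma inner_like_g: "inner_like (g p)"
  unfolding inner_like_def using g_bilinear g_sym g_pos by blast

abbreviation frame :: "'m \<Rightarrow> 'n \<Rightarrow> real ^ 'n" where "frame \<equiv> orthonormal_frame g"

lemma frame_scaled: "scaled_frame (g p) 1 (frame p)"
  by (rule orthonormal_frame_scaled[of g p, OF inner_like_g])

lemma linear_curvature_op: "linear (\<lambda>v. curvature_op A D p v x y)"
proof -
  have l: "linear (\<lambda>v. riemann A g D p v x y t)" for t
    by (rule curvature_like_linear(1)[OF curvature_like_riemann])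
  show ?thesis
  proof (intro linearI g_nondegenerate[of p])
    show "g p (curvature_op A D p (v + w) x y) t = g p (curvature_op A D p v x y + curvature_op A D p w x y) t" for v w t
      using linear_add[OF l[of t], of v w] by (simp add: riemann_def g_simps)
    show "g p (curvature_op A D p (r *\<^sub>R v) x y) t = g p (r *\<^sub>R curvature_op A D p v x y) t" for r v t
      using linear_scale[OF l[of t], of r v] by (simp add: riemann_def g_simps)
  qed
qed

lemma ricci_frame: "ricci A D p x y = (\<Sum>i\<in>UNIV. riemann A g D p (frame p i) x y (frame p i))"
  unfolding ricci_def riemann_def
  by (rule trace_frame[OF inner_like_g frame_scaled linear_curvature_op])

lemma ricci_sym: "ricci A D p x y = ricci A D p y x"
proof -
  note c = curvature_like_riemann[of p]
  have "riemann A g D p e x y e = riemann A g D p e y x e" for e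
    using curvature_like_pair[OF c, of e x y e] curvature_likeD(1)[OF c, of y e e x] curvature_likeD(2)[OF c, of e y e x]
    by simp
  then show ?thesis by (simp add: ricci_frame)
qed

lemma ricci_bilinear: "bilinear (ricci A D p)"
proof -
  have "linear (ricci A D p x)" for x
    unfolding ricci_frame[abs_def]
    by (intro linear_compose_sum ballI curvature_like_linear(3)[OF curvature_like_riemann])
  then show ?thesis
    unfolding bilinear_def using ricci_sym[of p] by (simp add: ricci_sym[of p _ y for y])
qed

lemma schouten_sym: "schouten A g D p x y = schouten A g D p y x"
  by (simp add: schouten_def Let_def ricci_sym[of p x] g_sym[of p x])

lemma schouten_bilinear: "bilinear (schouten A g D p)"
proof -
  have "bilinear (\<lambda>x y. a * (ricci A D p x y - c * g p x y))" for a c :: real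
    unfolding bilinear_def
    by (intro conjI allI linearI)
      (simp_all add: bilinear_ladd[OF ricci_bilinear] bilinear_radd[OF ricci_bilinear]
        bilinear_lmul[OF ricci_bilinear] bilinear_rmul[OF ricci_bilinear] g_simps algebra_simps)
  then show ?thesis unfolding schouten_def[abs_def] Let_def .
qed

lemma curvature_like_weyl: "curvature_like (weyl A g D p)"
  unfolding weyl_def[abs_def]
  by (intro curvature_like_diff curvature_like_riemann curvature_like_kulkarni_nomizu
      g_bilinear g_sym schouten_bilinear schouten_sym)

lemma schouten_trace:
  assumes n: "CARD('n) \<ge> 4"
  shows "(\<Sum>i\<in>UNIV. schouten A g D p (frame p i) (frame p i)) =
    scalar_curvature A g D p / (2 * (real CARD('n) - 1))"
proof -
  let ?n = "real CARD('n)" and ?S = "scalar_curvature A g D p"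
  have n': "?n \<ge> 4" using n by simp
  have "(\<Sum>i\<in>UNIV. g p (frame p i) (frame p i)) = ?n"
    using frame_scaled[of p] by (simp add: scaled_frame_def)
  then have "(\<Sum>i\<in>UNIV. schouten A g D p (frame p i) (frame p i)) =
      1 / (?n - 2) * (?S - 1 / (2 * (?n - 1)) * ?S * ?n)"
    unfolding schouten_def Let_def scalar_curvature_def
    by (simp only: sum_distrib_left[symmetric] sum_subtractf)
  also have "?S - 1 / (2 * (?n - 1)) * ?S * ?n = (?n - 2) * (?S / (2 * (?n - 1)))"
    using n' by (simp add: divide_simps) (simp add: algebra_simps)
  also have "1 / (?n - 2) * \<dots> = ?S / (2 * (?n - 1))" using n' by simp
  finally show ?thesis .
qed

text \<open>The Schouten tensor is normalised so that the trace of its Kulkarni-Nomizu product with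
  the metric is the Ricci tensor.\<close>

lemma weyl_trace_free:
  assumes n: "CARD('n) \<ge> 4"
  shows "(\<Sum>i\<in>UNIV. weyl A g D p (frame p i) x y (frame p i)) = 0"
proof -
  have n': "real CARD('n) \<ge> 4" using n by simp
  have "(\<Sum>i\<in>UNIV. weyl A g D p (frame p i) x y (frame p i)) = ricci A D p x y -
     ((real CARD('n) - 2) * schouten A g D p x y
       + g p x y * (\<Sum>i\<in>UNIV. schouten A g D p (frame p i) (frame p i)))"
    unfolding weyl_def sum_subtractf ricci_frame
    by (subst kulkarni_nomizu_trace[of g p, OF inner_like_g frame_scaled]) (auto intro: schouten_bilinear schouten_sym)
  also have "\<dots> = 0"
    unfolding schouten_trace[OF n] using n' by (simp add: schouten_def Let_def)
  finally show ?thesis .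
qed

section \<open>Regularity of the curvature tensors\<close>

lemma smooth_ricci: "smooth_fun_near A p (\<lambda>q. ricci A D q (extend A p x q) (extend A p y q))"
proof (rule smooth_fun_near_cong[OF _ open_chart_domain[of "chart_at A p"]])
  let ?Q = "\<lambda>i q. curvature_op A D q (extend A p (axis i 1) q) (extend A p x q) (extend A p y q)"
  show "smooth_fun_near A p (\<lambda>q. \<Sum>i\<in>UNIV. frame_coeff p (?Q i) i q)"
    by (rule smooth_fun_near_sum) (rule smooth_frame_coeff[OF chart_at_in(2) smooth_curvature_op])
  show "(\<Sum>i\<in>UNIV. frame_coeff p (?Q i) i q) = ricci A D q (extend A p x q) (extend A p y q)"
    if "q \<in> fst (chart_at A p)" for q
    unfolding ricci_def frame_coeff_def extend_def
    by (rule trace_conjugate[symmetric])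
      (use that in \<open>auto intro: linear_curvature_op linear_chart_vector linear_chart_components\<close>)
qed auto

lemma differentiable_det:
  assumes "\<And>i j. differentiable_fun_at p (\<lambda>q. M q $ i $ j)"
  shows "differentiable_fun_at p (\<lambda>q. det (M q :: real ^ 'n ^ 'n))"
  unfolding det_def
  by (intro differentiable_fun_at_sum differentiable_fun_at_mult differentiable_fun_at_const differentiable_fun_at_prod assms)

text \<open>The orthonormal frame in the definition may jump from point to point.
  \<open>frame_trace_basis\<close> rewrites the trace through the Gram matrix of the coordinate
  fields, whose entries are smooth, and the quotient of determinants keeps
  differentiability.\<close>

lemma differentiable_scalar: "differentiable_fun_at p (scalar_curvature A g D)"
proof -
  let ?E = "\<lambda>i q. extend A p (axis i 1) q"
  let ?M = "\<lambda>q. \<chi> i j. g q (?E i q) (?E j q)"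
  let ?f = "\<lambda>q. \<Sum>k\<in>UNIV. \<Sum>j\<in>UNIV. gram_inverse (?M q) j k * ricci A D q (?E k q) (?E j q)"
  have inj: "inj (\<lambda>v. extend A p v q)" if "q \<in> fst (chart_at A p)" for q
    using linear_extend[OF that] extend_eq_0_iff[OF that] by (subst linear_injective_0) auto
  have M: "differentiable_fun_at p (\<lambda>q. ?M q $ i $ j)" for i j
    by (simp add: smooth_imp_differentiable smooth_metric)
  have "differentiable_fun_at p (\<lambda>q. gram_inverse (?M q) j k)" for j k
    unfolding gram_inverse_def
  proof (intro differentiable_fun_at_divide differentiable_det)
    show "differentiable_fun_at p (\<lambda>q. (\<chi> i l. if l = j then axis k 1 $ i else ?M q $ i $ l) $ i $ l)" for i l
      using M[of i l] by (cases "l = j") (simp_all add: differentiable_fun_at_const)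
    show "det (?M p) \<noteq> 0"
      using gram_det_nonzero(1)[OF inner_like_g[of p] linear_extend[of p p] inj[of p]] by simp
  qed (rule M)
  then have "differentiable_fun_at p ?f"
    by (intro differentiable_fun_at_sum differentiable_fun_at_mult(1)[OF _ smooth_imp_differentiable[OF smooth_ricci]]) auto
  moreover have "?f q = scalar_curvature A g D q" if "q \<in> fst (chart_at A p)" for q
    unfolding scalar_curvature_def
    by (rule frame_trace_basis[OF inner_like_g frame_scaled linear_extend[OF that] inj[OF that] ricci_bilinear, symmetric])
  ultimately show ?thesis
    using differentiable_fun_at_cong(1)[OF open_chart_domain[of "chart_at A p"], of p ?f "scalar_curvature A g D"] by auto
qed

lemma differentiable_schouten:
  "differentiable_fun_at p (\<lambda>q. schouten A g D q (extend A p x q) (extend A p y q))"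
  unfolding schouten_def Let_def
  by (intro differentiable_fun_at_mult differentiable_fun_at_diff differentiable_fun_at_const differentiable_scalar
      smooth_imp_differentiable smooth_ricci smooth_metric smooth_field_near_extend')

lemma differentiable_weyl:
  "differentiable_fun_at p (\<lambda>q. weyl A g D q (extend A p x q) (extend A p y q) (extend A p z q) (extend A p t q))"
  unfolding weyl_def kulkarni_nomizu_def
  by (intro differentiable_fun_at_mult(1) differentiable_fun_at_diff(1) differentiable_fun_at_add(1)
      smooth_imp_differentiable[OF smooth_riemann] differentiable_schouten
      smooth_imp_differentiable[OF smooth_metric[OF smooth_field_near_extend' smooth_field_near_extend']])

section \<open>The covariant derivative of the Weyl tensor\<close>

text \<open>\<open>extend A p\<close> is known to be linear in the vector only on the chart domain,
  so \<open>D_local\<close> is what carries linearity through \<open>D\<close>.\<close>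

lemma D_extend_linear: "linear (\<lambda>x. D p v (extend A p x))"
proof (rule linearI)
  have o: "open (fst (chart_at A p))" "p \<in> fst (chart_at A p)" by (simp_all add: open_chart_domain)
  show "D p v (extend A p (x + y)) = D p v (extend A p x) + D p v (extend A p y)" for x y
    by (subst D_add[symmetric], simp, simp, rule D_local[OF _ _ o])
      (simp_all add: smooth_field_near_add linear_add[OF linear_extend])
  show "D p v (extend A p (r *\<^sub>R x)) = r *\<^sub>R D p v (extend A p x)" for r x
  proof -
    have "D p v (extend A p (r *\<^sub>R x)) = D p v (\<lambda>q. r *\<^sub>R extend A p x q)"
      by (rule D_local[OF _ _ o])
        (simp_all add: smooth_field_near_scaleR smooth_fun_near_const linear_scale[OF linear_extend])
    also have "\<dots> = r *\<^sub>R D p v (extend A p x)"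
      using D_scaleR[OF smooth_fun_near_const[of p r] smooth_field_near_extend'[of p x], of v]
      by (simp add: differentiable_fun_at_const)
    finally show ?thesis .
  qed
qed

abbreviation cov_weyl :: "'m \<Rightarrow> real ^ 'n \<Rightarrow> real ^ 'n \<Rightarrow> real ^ 'n \<Rightarrow> real ^ 'n \<Rightarrow> real ^ 'n \<Rightarrow> real" where
  "cov_weyl \<equiv> cov_deriv4 A D (weyl A g D)"

lemma linear_cov_weyl: "linear (\<lambda>v. cov_weyl p v x y z t)"
proof -
  note W = curvature_like_linear[OF curvature_like_weyl[of p]]
  have l: "linear (\<lambda>v. D p v (extend A p x))" for x by (rule D_linear) simp
  show ?thesis
    unfolding cov_deriv4_def Let_def
    by (intro linear_compose_sub dir_deriv_linear differentiable_weyl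
        linear_compose[OF l W(1), unfolded o_def] linear_compose[OF l W(2), unfolded o_def]
        linear_compose[OF l W(3), unfolded o_def] linear_compose[OF l W(4), unfolded o_def])
qed

text \<open>The derivative term has the symmetries of \<open>weyl\<close>, and the four correction
  terms permute among themselves. The linearity obtained is what a change of frame in the divergence
  requires.\<close>

lemma curvature_like_cov_weyl: "curvature_like (cov_weyl p v)"
  unfolding curvature_like_def
proof (intro conjI allI)
  fix x y z t
  note W = curvature_like_weyl and d = differentiable_weyl[of p]
  let ?w = "\<lambda>x y z t q. weyl A g D q (extend A p x q) (extend A p y q) (extend A p z q) (extend A p t q)"
  note s1 = curvature_likeD(1)[OF W] and s2 = curvature_likeD(2)[OF W] and b = curvature_likeD(3)[OF W]
  have "?w x y z t = (\<lambda>q. - 1 * ?w y x z t q)" by (rule ext, subst s1) simp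
  then have "dir_deriv A p v (?w x y z t) = - dir_deriv A p v (?w y x z t)"
    using differentiable_fun_at_cmult(2)[OF d, of v "-1" y x z t] by simp
  then show "cov_weyl p v x y z t = - cov_weyl p v y x z t"
    unfolding cov_deriv4_def Let_def
    using s1[of p "D p v (extend A p x)" y z t] s1[of p x "D p v (extend A p y)" z t]
      s1[of p x y "D p v (extend A p z)" t] s1[of p x y z "D p v (extend A p t)"] by simp
  have "?w x y z t = (\<lambda>q. - 1 * ?w x y t z q)" by (rule ext, subst s2) simp
  then have "dir_deriv A p v (?w x y z t) = - dir_deriv A p v (?w x y t z)"
    using differentiable_fun_at_cmult(2)[OF d, of v "-1" x y t z] by simp
  then show "cov_weyl p v x y z t = - cov_weyl p v x y t z"
    unfolding cov_deriv4_def Let_def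
    using s2[of p "D p v (extend A p x)" y z t] s2[of p x "D p v (extend A p y)" z t]
      s2[of p x y "D p v (extend A p z)" t] s2[of p x y z "D p v (extend A p t)"] by simp
  have "dir_deriv A p v (?w x y z t) + dir_deriv A p v (?w y z x t) + dir_deriv A p v (?w z x y t) =
      dir_deriv A p v (\<lambda>q. ?w x y z t q + ?w y z x t q + ?w z x y t q)"
    by (simp add: differentiable_fun_at_add d)
  also have "\<dots> = 0" by (simp add: b differentiable_fun_at_const)
  finally show "cov_weyl p v x y z t + cov_weyl p v y z x t + cov_weyl p v z x y t = 0"
    unfolding cov_deriv4_def Let_def
    using b[of p "D p v (extend A p x)" y z t] b[of p x "D p v (extend A p y)" z t]
      b[of p x y "D p v (extend A p z)" t] b[of p x y z "D p v (extend A p t)"] by simp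
  have o: "open (fst (chart_at A p))" "p \<in> fst (chart_at A p)" by (simp_all add: open_chart_domain)
  have a: "dir_deriv A p v (?w x y z (s + t)) = dir_deriv A p v (?w x y z s) + dir_deriv A p v (?w x y z t)" for s t
    by (subst differentiable_fun_at_add(2)[symmetric, OF d d], rule differentiable_fun_at_cong(2)[OF o])
      (simp add: linear_add[OF linear_extend] linear_add[OF curvature_likeD(4)[OF W]])
  have m: "dir_deriv A p v (?w x y z (r *\<^sub>R t)) = r * dir_deriv A p v (?w x y z t)" for r t
    by (subst differentiable_fun_at_cmult(2)[symmetric, OF d], rule differentiable_fun_at_cong(2)[OF o])
      (simp add: linear_scale[OF linear_extend] linear_scale[OF curvature_likeD(4)[OF W]])
  have "linear (\<lambda>t. dir_deriv A p v (?w x y z t))" by (rule linearI[OF a]) (simp add: m)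
  moreover have "linear (\<lambda>t. weyl A g D p x y z t)" for x y z by (rule curvature_likeD(4)[OF W])
  moreover have "linear (\<lambda>t. weyl A g D p x y z (D p v (extend A p t)))"
    using linear_compose[OF D_extend_linear curvature_likeD(4)[OF W]] by (simp only: o_def)
  ultimately show "linear (cov_weyl p v x y z)"
    unfolding cov_deriv4_def[abs_def] Let_def by (intro linear_compose_sub)
qed

end

section \<open>The pseudo-inverse\<close>

text \<open>The hypotheses say that the space is the direct sum of the image and the kernel.\<close>

definition splits :: "('v::real_vector \<Rightarrow> 'v) \<Rightarrow> bool" where
  "splits w \<longleftrightarrow> linear w \<and> (\<forall>x. w (w x) = 0 \<longrightarrow> w x = 0) \<and> (\<forall>z. \<exists>\<eta>\<in>range w. w (z - w \<eta>) = 0)"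

text \<open>On its range \<open>w\<close> is injective, so the two conditions determine
  \<open>\<eta>\<close>; choosing it for each \<open>z\<close> gives the only map \<open>s\<close>
  that meets the definite description. From here on values of the pseudo-inverse are found by
  checking these two conditions.\<close>

lemma pseudo_inverse_eqI:
  assumes w: "splits w" and "\<eta> \<in> range w" "w (z - w \<eta>) = 0"
  shows "pseudo_inverse w z = \<eta>"
proof -
  have lin: "linear w" and inj: "\<And>x. w (w x) = 0 \<Longrightarrow> w x = 0"
    and ex: "\<And>z. \<exists>\<eta>\<in>range w. w (z - w \<eta>) = 0"
    using w unfolding splits_def by blast+
  note l = linear_add[OF lin] linear_diff[OF lin] linear_scale[OF lin] linear_0[OF lin]
  have uniq: "\<eta> = \<eta>'" if h: "\<eta> \<in> range w" "w (z - w \<eta>) = 0" "\<eta>' \<in> range w" "w (z - w \<eta>') = 0" for z \<eta> \<eta>'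
  proof -
    obtain x x' where x: "\<eta> = w x" "\<eta>' = w x'" using h by blast
    have "w (w (\<eta> - \<eta>')) = 0" using h by (simp add: l)
    then have "w (\<eta> - \<eta>') = 0" by (rule inj)
    then have "w (w (x - x')) = 0" by (simp add: x l)
    then have "w (x - x') = 0" by (rule inj)
    then show ?thesis by (simp add: x l)
  qed
  obtain s where s: "\<And>z. s z \<in> range w" "\<And>z. w (z - w (s z)) = 0" using ex by metis
  have sI: "s z = \<eta>" if "\<eta> \<in> range w" "w (z - w \<eta>) = 0" for z \<eta>
    by (rule uniq[OF s(1,2) that])
  have add: "s (a + b) = s a + s b" for a b
  proof (rule sI)
    obtain x x' where x: "s a = w x" "s b = w x'" using s(1) by blast
    show "s a + s b \<in> range w" unfolding x by (simp add: l(1)[symmetric])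
    show "w (a + b - w (s a + s b)) = 0" using s(2)[of a] s(2)[of b] by (simp add: l)
  qed
  have scale: "s (r *\<^sub>R a) = r *\<^sub>R s a" for r a
  proof (rule sI)
    obtain x where x: "s a = w x" using s(1) by blast
    show "r *\<^sub>R s a \<in> range w" unfolding x by (simp add: l(3)[symmetric])
    show "w (r *\<^sub>R a - w (r *\<^sub>R s a)) = 0" using s(2)[of a] by (simp add: l)
  qed
  have "pseudo_inverse w = s"
    unfolding pseudo_inverse_def
  proof (rule the_equality)
    show "linear s \<and> (\<forall>\<eta>\<in>range w. s (w \<eta>) = \<eta>) \<and> (\<forall>\<kappa>. w \<kappa> = 0 \<longrightarrow> s \<kappa> = 0)"
    proof (intro conjI ballI allI impI)
      show "linear s" by (rule linearI) (simp_all add: add scale)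
      show "s (w \<eta>) = \<eta>" if "\<eta> \<in> range w" for \<eta> using that by (intro sI) (auto simp: l)
      show "s \<kappa> = 0" if "w \<kappa> = 0" for \<kappa>
        using that by (intro sI) (auto simp: l intro: range_eqI[of _ _ 0])
    qed
    fix s' assume s': "linear s' \<and> (\<forall>\<eta>\<in>range w. s' (w \<eta>) = \<eta>) \<and> (\<forall>\<kappa>. w \<kappa> = 0 \<longrightarrow> s' \<kappa> = 0)"
    show "s' = s"
    proof
      fix z
      have "s' z = s' (w (s z)) + s' (z - w (s z))"
        using s' linear_add[of s' "w (s z)" "z - w (s z)"] by simp
      then show "s' z = s z" using s' s by simp
    qed
  qed
  then show ?thesis using sI[OF assms(2,3)] by simp
qed

lemma splitsE:
  assumes "splits w"
  obtains x where "pseudo_inverse w z = w x" "w (z - w (w x)) = 0"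
  using assms pseudo_inverse_eqI[OF assms] unfolding splits_def by (metis imageE)

section \<open>Projection, linearity, scaling and conjugation of the pseudo-inverse\<close>

lemma pseudo_inverse_kernel:
  assumes w: "splits w"
  shows "w (pseudo_inverse w (w z)) = w z"
proof -
  have lin: "linear w" using w unfolding splits_def by blast
  obtain x where x: "w (z - w (w x)) = 0" using splitsE[OF w] by metis
  have "pseudo_inverse w (w z) = w (w x)"
    using x by (intro pseudo_inverse_eqI[OF w]) (auto simp: linear_diff[OF lin] linear_0[OF lin])
  then show ?thesis using x by (simp add: linear_diff[OF lin])
qed

lemma pseudo_inverse_diff:
  assumes w: "splits w"
  shows "pseudo_inverse w (a - b) = pseudo_inverse w a - pseudo_inverse w b"
proof -
  have lin: "linear w" using w unfolding splits_def by blast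
  note l = linear_diff[OF lin]
  obtain x where x: "pseudo_inverse w a = w x" "w (a - w (w x)) = 0" using splitsE[OF w] .
  obtain y where y: "pseudo_inverse w b = w y" "w (b - w (w y)) = 0" using splitsE[OF w] .
  have "w x - w y \<in> range w" by (simp add: l[symmetric])
  then show ?thesis
    unfolding x(1) y(1) using x(2) y(2) by (intro pseudo_inverse_eqI[OF w]) (simp_all add: l)
qed

lemma pseudo_inverse_scale:
  assumes w: "splits w"
  shows "pseudo_inverse w (r *\<^sub>R a) = r *\<^sub>R pseudo_inverse w a"
proof -
  have lin: "linear w" using w unfolding splits_def by blast
  note l = linear_diff[OF lin] linear_scale[OF lin]
  obtain x where x: "pseudo_inverse w a = w x" "w (a - w (w x)) = 0" using splitsE[OF w] .
  have "r *\<^sub>R w x \<in> range w" by (simp add: l(2)[symmetric])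
  then show ?thesis
    unfolding x(1) using x(2) by (intro pseudo_inverse_eqI[OF w]) (simp_all add: l)
qed

lemma pseudo_inverse_scaled_map:
  assumes w: "splits w" and c: "c \<noteq> 0"
  shows "pseudo_inverse (\<lambda>x. c *\<^sub>R w x) z = (1 / c) *\<^sub>R pseudo_inverse w z"
proof (rule pseudo_inverse_eqI)
  have lin: "linear w" using w unfolding splits_def by blast
  note l = linear_diff[OF lin] linear_scale[OF lin]
  \<comment> \<open>Rescaling a map by a nonzero \<open>c\<close> preserves its image; this names
    the preimage.\<close>
  have sc: "(1 / c) *\<^sub>R w x = c *\<^sub>R w ((1 / (c * c)) *\<^sub>R x)" for x using c by (simp add: l)
  have r: "(1 / c) *\<^sub>R w x \<in> range (\<lambda>x. c *\<^sub>R w x)" for x unfolding sc by blast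
  show "splits (\<lambda>x. c *\<^sub>R w x)"
    unfolding splits_def
  proof (intro conjI allI impI)
    show "linear (\<lambda>x. c *\<^sub>R w x)" using lin by (rule linear_compose_scale_right)
    show "c *\<^sub>R w x = 0" if "c *\<^sub>R w (c *\<^sub>R w x) = 0" for x
      using that w c unfolding splits_def by (simp add: l)
    fix z
    obtain x where x: "w (z - w (w x)) = 0" using splitsE[OF w] by metis
    show "\<exists>\<eta>\<in>range (\<lambda>x. c *\<^sub>R w x). c *\<^sub>R w (z - c *\<^sub>R w \<eta>) = 0"
      by (rule bexI[OF _ r[of x]]) (use x c in \<open>simp add: l\<close>)
  qed
  obtain x where x: "pseudo_inverse w z = w x" "w (z - w (w x)) = 0" using splitsE[OF w] .
  show "(1 / c) *\<^sub>R pseudo_inverse w z \<in> range (\<lambda>x. c *\<^sub>R w x)" unfolding x(1) by (rule r)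
  show "c *\<^sub>R w (z - c *\<^sub>R w ((1 / c) *\<^sub>R pseudo_inverse w z)) = 0"
    unfolding x(1) using x(2) c by (simp add: l)
qed

text \<open>With \<open>F\<close> the musical isomorphism \<open>flat\<close>, this replaces the
  endomorphism of covectors by one of tangent vectors.\<close>

lemma pseudo_inverse_conjugate:
  assumes w: "splits w" and F: "linear F" "bij F" and eq: "\<And>x. w' (F x) = F (w x)"
  shows "pseudo_inverse w' (F z) = F (pseudo_inverse w z)"
proof (rule pseudo_inverse_eqI)
  have lin: "linear w" using w unfolding splits_def by blast
  have F0: "F x = 0 \<longleftrightarrow> x = 0" for x
    using F linear_0[OF F(1)] by (metis bij_is_inj injD)
  have surj: "\<exists>x. y = F x" for y using F(2) by (metis bij_pointE)
  have r: "F (w x) \<in> range w'" for x by (simp add: eq[symmetric])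
  show "splits w'"
    unfolding splits_def
  proof (intro conjI allI impI)
    show "linear w'"
    proof (rule linearI)
      show "w' (a + b) = w' a + w' b" for a b
        using surj[of a] surj[of b] by (auto simp: eq linear_add[OF F(1), symmetric] linear_add[OF lin])
      show "w' (r *\<^sub>R a) = r *\<^sub>R w' a" for r a
        using surj[of a] by (auto simp: eq linear_scale[OF F(1), symmetric] linear_scale[OF lin])
    qed
    show "w' a = 0" if "w' (w' a) = 0" for a
      using surj[of a] that w unfolding splits_def by (auto simp: eq F0)
    fix a
    obtain z where z: "a = F z" using surj by blast
    obtain x where x: "w (z - w (w x)) = 0" using splitsE[OF w] by metis
    show "\<exists>\<eta>\<in>range w'. w' (a - w' \<eta>) = 0"
      by (rule bexI[OF _ r[of x]]) (use x in \<open>simp add: z eq F0 linear_diff[OF F(1), symmetric]\<close>)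
  qed
  obtain x where x: "pseudo_inverse w z = w x" "w (z - w (w x)) = 0" using splitsE[OF w] .
  show "F (pseudo_inverse w z) \<in> range w'" unfolding x(1) by (rule r)
  show "w' (F z - w' (F (pseudo_inverse w z))) = 0"
    unfolding x(1) using x(2) by (simp add: eq F0 linear_diff[OF F(1), symmetric])
qed

text \<open>Symmetry gives b(w x, w x) = b(x, w(w x)), so \<open>w\<close> is injective on its
  range; by dimension it maps the range onto itself, and each \<open>w z\<close> equals w(w \<eta>)
  with \<eta> in the range.\<close>

lemma splits_symmetric:
  fixes w :: "real ^ 'n::finite \<Rightarrow> real ^ 'n"
  assumes b: "inner_like b" and lin: "linear w" and sym: "\<And>x y. b (w x) y = b x (w y)"
  shows "splits w"
proof -
  note bil = inner_likeD(1)[OF b]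
  have inj: "w x = 0" if "w (w x) = 0" for x
  proof (rule ccontr)
    assume "w x \<noteq> 0"
    then have "b (w x) (w x) > 0" using inner_likeD(3)[OF b] by blast
    moreover have "b (w x) (w x) = 0" using sym[of x "w x"] that by (simp add: bilinear_rzero[OF bil])
    ultimately show False by simp
  qed
  have sub: "subspace (range w)" using lin by (simp add: linear_subspace_image)
  have inj_on: "inj_on w (range w)"
  proof (rule inj_onI)
    fix x y assume "x \<in> range w" "y \<in> range w" "w x = w y"
    then obtain a where a: "x - y = w a" "w (x - y) = 0"
      using linear_diff[OF lin] by (metis imageE rangeI right_minus_eq)
    then show "x = y" using inj[of a] by simp
  qed
  have "w ` range w = range w"
  proof (rule subspace_dim_equal)
    show "subspace (w ` range w)" using lin sub by (rule linear_subspace_image)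
    show "dim (range w) \<le> dim (w ` range w)"
      using dim_image_eq[OF lin, of "range w"] inj_on span_eq_iff[of "range w"] sub by (metis order_refl)
  qed (use sub in auto)
  then have img: "\<exists>y\<in>range w. z = w y" if "z \<in> range w" for z using that by blast
  have "\<exists>\<eta>\<in>range w. w (z - w \<eta>) = 0" for z
  proof -
    obtain y where y: "y \<in> range w" "w z = w y" using img[of "w z"] by blast
    obtain \<eta> where \<eta>: "\<eta> \<in> range w" "y = w \<eta>" using img[OF y(1)] by blast
    show ?thesis using y \<eta> by (intro bexI[of _ \<eta>]) (auto simp: linear_diff[OF lin])
  qed
  then show ?thesis unfolding splits_def using lin inj by blast
qed

section \<open>The action of a Weyl tensor on two-forms\<close>

text \<open>\<open>weyl_action\<close> with the tensor and the frame as parameters, so that the new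
  Weyl tensor and the new frame can be traded for the old ones one at a time.\<close>

definition curv_action ::
  "(real ^ 'n \<Rightarrow> real ^ 'n \<Rightarrow> real ^ 'n \<Rightarrow> real ^ 'n \<Rightarrow> real) \<Rightarrow> ('n::finite \<Rightarrow> real ^ 'n) \<Rightarrow>
    (real ^ 'n \<Rightarrow> real ^ 'n \<Rightarrow> real) \<Rightarrow> real ^ 'n \<Rightarrow> real ^ 'n \<Rightarrow> real" where
  "curv_action W e b z t = (\<Sum>i\<in>UNIV. \<Sum>j\<in>UNIV. b (e i) (e j) * W (e j) z t (e i))"

text \<open>In the notation of the theorem, \<open>curv_form W e X Y = g(\<ww>(X\<^sup>*), Y\<^sup>*)\<close>, and \<open>curv_op\<close> is \<open>\<ww>\<close>
  transported to tangent vectors.\<close>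

definition curv_form ::
  "(real ^ 'n \<Rightarrow> real ^ 'n \<Rightarrow> real ^ 'n \<Rightarrow> real ^ 'n \<Rightarrow> real) \<Rightarrow> ('n::finite \<Rightarrow> real ^ 'n) \<Rightarrow>
    real ^ 'n \<Rightarrow> real ^ 'n \<Rightarrow> real" where
  "curv_form W e X Y = (\<Sum>i\<in>UNIV. curv_action W e (W (e i) X) (e i) Y)"

text \<open>The vector dual to the functional \<open>l\<close>, as an explicit sum instead of the
  definite description in \<open>sharp\<close>.\<close>

definition frame_sharp :: "('n::finite \<Rightarrow> real ^ 'n) \<Rightarrow> (real ^ 'n \<Rightarrow> real) \<Rightarrow> real ^ 'n" where
  "frame_sharp e l = (\<Sum>j\<in>UNIV. l (e j) *\<^sub>R e j)"

definition curv_op ::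
  "(real ^ 'n \<Rightarrow> real ^ 'n \<Rightarrow> real ^ 'n \<Rightarrow> real ^ 'n \<Rightarrow> real) \<Rightarrow> ('n::finite \<Rightarrow> real ^ 'n) \<Rightarrow>
    real ^ 'n \<Rightarrow> real ^ 'n" where
  "curv_op W e X = frame_sharp e (curv_form W e X)"

lemma curv_action_linear:
  assumes W: "curvature_like W"
  shows "linear (\<lambda>z. curv_action W e b z t)" "linear (\<lambda>t. curv_action W e b z t)"
  unfolding curv_action_def
  by (intro linear_compose_sum ballI linear_compose_scale_right[where 'b = real, simplified]
      curvature_like_linear[OF W])+

lemma curv_action_add:
  "curv_action W e (\<lambda>x y. b x y + b' x y) z t = curv_action W e b z t + curv_action W e b' z t"
  unfolding curv_action_def by (simp add: algebra_simps sum.distrib)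

lemma curv_action_cmult:
  "curv_action W e (\<lambda>x y. c * b x y) z t = c * curv_action W e b z t"
  unfolding curv_action_def by (simp add: sum_distrib_left mult.assoc)

lemma curv_action_scale:
  "curv_action (\<lambda>x y z t. c * W x y z t) e b z t = c * curv_action W e b z t"
  unfolding curv_action_def by (simp add: sum_distrib_left mult.left_commute)

text \<open>Two slots are contracted, each at the cost of a factor \<open>c\<close>.\<close>

lemma curv_action_frame:
  assumes b: "inner_like g" and e: "scaled_frame g 1 e" and e': "scaled_frame g c e'"
    and B: "bilinear B" and W: "curvature_like W"
  shows "curv_action W e' B z t = c * c * curv_action W e B z t"
proof -
  note W' = curvature_like_linear[OF W]
  have mult: "bilinear (\<lambda>u v. l u * m v)" if "linear l" "linear m" for l m :: "real ^ 'n \<Rightarrow> real"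
    using that unfolding bilinear_def by (auto intro!: linearI simp: linear_add linear_scale algebra_simps)
  have "(\<Sum>j\<in>UNIV. B (e' i) (e' j) * W (e' j) z t (e' i)) =
      c * (\<Sum>j\<in>UNIV. B (e' i) (e j) * W (e j) z t (e' i))" for i
    by (rule frame_trace[OF b e e' mult[OF bilinear_linear(2)[OF B] W'(1)]])
  moreover have "(\<Sum>i\<in>UNIV. B (e' i) (e j) * W (e j) z t (e' i)) =
      c * (\<Sum>i\<in>UNIV. B (e i) (e j) * W (e j) z t (e i))" for j
    by (rule frame_trace[OF b e e' mult[OF bilinear_linear(1)[OF B] W'(4)]])
  ultimately show ?thesis
    unfolding curv_action_def
    by (simp add: sum_distrib_left[symmetric]) (subst (1 2) sum.swap, simp add: sum_distrib_left[symmetric])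
qed

text \<open>For antisymmetric \<open>B\<close>, averaging with the exchanged sum replaces the tensor
  by half of W(e_j,z,t,e_i) - W(e_i,z,t,e_j), which the first Bianchi identity turns into
  W(z,t,e_i,e_j).\<close>

lemma curv_action_skew:
  assumes W: "curvature_like W" and B: "\<And>u v. B u v = - B v u"
  shows "curv_action W e B z t = (1/2) * (\<Sum>i\<in>UNIV. \<Sum>j\<in>UNIV. B (e i) (e j) * W z t (e i) (e j))"
proof -
  have W': "W j z t i - W i z t j = W z t i j" for i j
    using curvature_likeD(3)[OF W, of z t j i] curvature_likeD(2)[OF W, of z t j i]
      curvature_like_pair[OF W, of i z t j] curvature_likeD(1)[OF W, of t j i z]
      curvature_likeD(2)[OF W, of j t i z] curvature_likeD(1)[OF W, of t j z i] by simp
  have "curv_action W e B z t = (\<Sum>i\<in>UNIV. \<Sum>j\<in>UNIV. B (e j) (e i) * W (e i) z t (e j))"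
    unfolding curv_action_def by (rule sum.swap)
  also have "\<dots> = - (\<Sum>i\<in>UNIV. \<Sum>j\<in>UNIV. B (e i) (e j) * W (e i) z t (e j))"
    by (subst B) (simp add: sum_negf)
  finally have "2 * curv_action W e B z t =
      (\<Sum>i\<in>UNIV. \<Sum>j\<in>UNIV. B (e i) (e j) * W (e j) z t (e i)) - (\<Sum>i\<in>UNIV. \<Sum>j\<in>UNIV. B (e i) (e j) * W (e i) z t (e j))"
    unfolding curv_action_def by simp
  also have "\<dots> = (\<Sum>i\<in>UNIV. \<Sum>j\<in>UNIV. B (e i) (e j) * W z t (e i) (e j))"
    by (simp add: sum_subtractf[symmetric] W'[symmetric] right_diff_distrib)
  finally show ?thesis by simp
qed

text \<open>The factor 1/2 of \<open>curv_action_skew\<close> is absorbed by the two equal halves of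
  a wedge product defined without normalisation.\<close>

lemma curv_action_wedge:
  assumes b: "inner_like g" and e: "scaled_frame g 1 e" and W: "curvature_like W"
  shows "curv_action W e (\<lambda>u v. g x u * g y v - g y u * g x v) z t = W x y z t"
proof -
  have W4: "(\<Sum>j\<in>UNIV. g y (e j) * W z t u (e j)) = W z t u y" for u y
    by (rule frame_contract(1)[OF b e curvature_like_linear(4)[OF W]])
  have W3: "(\<Sum>i\<in>UNIV. g x (e i) * W z t (e i) y) = W z t x y" for x y
    by (rule frame_contract(1)[OF b e curvature_like_linear(3)[OF W]])
  have "(\<Sum>i\<in>UNIV. \<Sum>j\<in>UNIV. g x (e i) * g y (e j) * W z t (e i) (e j)) = W z t x y" for x y
    by (simp add: mult.assoc sum_distrib_left[symmetric] W4 W3)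
  then show ?thesis
    using curvature_likeD(2)[OF W, of z t y x] curvature_like_pair[OF W, of x y z t]
    by (subst curv_action_skew[OF W]) (simp_all add: left_diff_distrib sum_subtractf)
qed

context
  fixes g :: "real ^ 'n::finite \<Rightarrow> real ^ 'n \<Rightarrow> real" and e :: "'n \<Rightarrow> real ^ 'n"
    and W :: "real ^ 'n \<Rightarrow> real ^ 'n \<Rightarrow> real ^ 'n \<Rightarrow> real ^ 'n \<Rightarrow> real"
  assumes b: "inner_like g" and e: "scaled_frame g 1 e" and W: "curvature_like W"
begin

lemma g_frame_sharp:
  assumes l: "linear l"
  shows "g (frame_sharp e l) v = l v"
  unfolding frame_sharp_def
  using frame_contract(2)[OF b e l, of v]
  by (simp add: bilinear_lsum[OF inner_likeD(1)[OF b]] mult.commute)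

lemma curv_form_formula:
  "curv_form W e X Y = (1/2) * (\<Sum>i\<in>UNIV. \<Sum>j\<in>UNIV. \<Sum>k\<in>UNIV. W (e i) X (e j) (e k) * W (e i) Y (e j) (e k))"
proof -
  have "curv_action W e (W u X) u Y = (1/2) * (\<Sum>j\<in>UNIV. \<Sum>k\<in>UNIV. W u X (e j) (e k) * W u Y (e j) (e k))" for u
    by (rule curv_action_skew[OF W]) (rule curvature_likeD(2)[OF W])
  then show ?thesis unfolding curv_form_def by (simp add: sum_distrib_left)
qed

lemma curv_form_sym: "curv_form W e X Y = curv_form W e Y X"
  unfolding curv_form_formula by (simp add: mult.commute)

lemma curv_form_linear: "linear (curv_form W e X)"
  unfolding curv_form_def[abs_def]
  by (intro linear_compose_sum ballI curv_action_linear(2)[OF W])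

lemma g_curv_op: "g (curv_op W e X) Y = curv_form W e X Y"
  unfolding curv_op_def by (rule g_frame_sharp[OF curv_form_linear])

lemma curv_op_linear: "linear (curv_op W e)"
proof (rule linearI; rule inner_like_eqI[OF b])
  note l = curv_form_linear[THEN linear_add] curv_form_linear[THEN linear_scale]
  note bil = inner_likeD(1)[OF b]
  show "g (curv_op W e (x + y)) t = g (curv_op W e x + curv_op W e y) t" for x y t
    by (simp add: bilinear_ladd[OF bil] g_curv_op curv_form_sym[of _ t] l)
  show "g (curv_op W e (r *\<^sub>R x)) t = g (r *\<^sub>R curv_op W e x) t" for r x t
    by (simp add: bilinear_lmul[OF bil] g_curv_op curv_form_sym[of _ t] l)
qed

lemma curv_op_splits: "splits (curv_op W e)"
proof (rule splits_symmetric[OF b curv_op_linear])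
  fix x y
  have "g (curv_op W e x) y = g (curv_op W e y) x" unfolding g_curv_op by (rule curv_form_sym)
  then show "g (curv_op W e x) y = g x (curv_op W e y)" by (simp add: inner_likeD(2)[OF b, of x])
qed

text \<open>\<open>X\<close> stands in the last slot because that is where \<open>T_field\<close>
  and \<open>grad\<close> occur in the change of \<open>C_T\<close>.\<close>

lemma curv_op_kernel:
  assumes "curv_op W e X = 0"
  shows "W x y z X = 0"
proof -
  have "curv_form W e X X = 0"
    using g_curv_op[of X X] assms by (simp add: bilinear_lzero[OF inner_likeD(1)[OF b]])
  then have "(\<Sum>i\<in>UNIV. \<Sum>j\<in>UNIV. \<Sum>k\<in>UNIV. (W (e i) X (e j) (e k))\<^sup>2) = 0"
    unfolding curv_form_formula by (simp add: power2_eq_square)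
  then have 0: "W (e i) X (e j) (e k) = 0" for i j k
    by (simp add: sum_nonneg_eq_0_iff sum_nonneg)
  have "W x y z X = W z X x y" by (rule curvature_like_pair[OF W])
  also have "\<dots> = (\<Sum>i\<in>UNIV. g z (e i) * W (e i) X x y)"
    by (rule frame_contract(1)[OF b e curvature_like_linear(1)[OF W], symmetric])
  also have "\<dots> = (\<Sum>i\<in>UNIV. g z (e i) * (\<Sum>j\<in>UNIV. g x (e j) * W (e i) X (e j) y))"
    by (simp add: frame_contract(1)[OF b e curvature_like_linear(3)[OF W]])
  also have "\<dots> = (\<Sum>i\<in>UNIV. g z (e i) * (\<Sum>j\<in>UNIV. g x (e j) * (\<Sum>k\<in>UNIV. g y (e k) * W (e i) X (e j) (e k))))"
    by (simp add: frame_contract(1)[OF b e curvature_like_linear(4)[OF W]])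
  finally show ?thesis by (simp add: 0)
qed

end

section \<open>The field \<open>\<T>\<close> in terms of tangent vectors\<close>

text \<open>\<open>flat\<close> is a bijection intertwining \<open>w_endo\<close> with
  \<open>curv_op\<close>, so covectors, \<open>sharp\<close> and \<open>Blinfun\<close> disappear
  and the pseudo-inverse is taken on tangent vectors.\<close>

lemma T_field_eq:
  fixes A :: "('m::{t2_space, second_countable_topology}, 'n::finite) chart set" and g p
  defines "e \<equiv> orthonormal_frame g p"
  assumes b: "inner_like (g p)" and W: "curvature_like (weyl A g D p)"
  shows "T_field A g D p = (1 / (real CARD('n) - 3)) *\<^sub>R pseudo_inverse (curv_op (weyl A g D p) e)
    (frame_sharp e (\<lambda>v. \<Sum>i\<in>UNIV. curv_action (weyl A g D p) e (\<lambda>x y. div_weyl A g D p x y (e i)) (e i) v))"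
proof -
  let ?W = "weyl A g D p" and ?n = "real CARD('n)"
  let ?l = "\<lambda>v. \<Sum>i\<in>UNIV. curv_action ?W e (\<lambda>x y. div_weyl A g D p x y (e i)) (e i) v"
  note bil = inner_likeD(1)[OF b]
  have e: "scaled_frame (g p) 1 e" unfolding e_def by (rule orthonormal_frame_scaled[of g p, OF b])
  have act: "weyl_action A g D p = curv_action ?W e"
    by (intro ext) (simp add: weyl_action_def curv_action_def Let_def e_def)
  have fl: "blinfun_apply (flat g p v) = g p v" for v
    unfolding flat_def by (intro bounded_linear_Blinfun_apply linear_conv_bounded_linear[THEN iffD1] bilinear_linear(2)[OF bil])
  have fl_sharp: "Blinfun l = flat g p (frame_sharp e l)" if "linear l" for l
    using g_frame_sharp[OF b e W that] unfolding flat_def by (metis ext)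
  have lin: "linear (flat g p)"
    by (intro linearI blinfun_eqI) (simp_all add: fl plus_blinfun.rep_eq scaleR_blinfun.rep_eq
        bilinear_ladd[OF bil] bilinear_lmul[OF bil])
  have inj: "inj (flat g p)"
    by (intro injI inner_like_eqI[OF b]) (metis fl)
  have "\<exists>v. \<theta> = flat g p v" for \<theta>
    using fl_sharp[of "blinfun_apply \<theta>"] blinfun.bounded_linear_right[of \<theta>]
    by (metis blinfun_apply_inverse bounded_linear.linear)
  then have bij: "bij (flat g p)" using inj unfolding bij_def surj_def by blast
  have sharp: "sharp g p (flat g p v) = v" for v
    unfolding sharp_def using inj by (simp add: inj_eq)
  have "w_endo A g D p (flat g p X) = flat g p (curv_op ?W e X)" for X
  proof -
    have "wedge (flat g p u) (flat g p X) = (\<lambda>x y. g p u x * g p X y - g p X x * g p u y)" for u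
      by (intro ext) (simp add: wedge_def fl)
    moreover have "curv_action ?W e (\<lambda>x y. g p u x * g p X y - g p X x * g p u y) = ?W u X" for u
      by (intro ext) (rule curv_action_wedge[OF b e W])
    ultimately have "w_endo A g D p (flat g p X) = Blinfun (curv_form ?W e X)"
      unfolding w_endo_def Let_def act e_def[symmetric] by (simp add: curv_form_def[abs_def])
    also have "\<dots> = flat g p (curv_op ?W e X)"
      unfolding curv_op_def by (rule fl_sharp[OF curv_form_linear[OF b e W]])
    finally show ?thesis .
  qed
  then have "pseudo_inverse (w_endo A g D p) (flat g p z) = flat g p (pseudo_inverse (curv_op ?W e) z)" for z
    by (rule pseudo_inverse_conjugate[where F = "flat g p" and w = "curv_op ?W e", OF curv_op_splits[OF b e W] lin bij])
  moreover have "linear ?l" by (intro linear_compose_sum ballI curv_action_linear(2)[OF W])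
  ultimately show ?thesis
    unfolding T_field_def Let_def act e_def[symmetric]
    by (simp add: fl_sharp linear_scale[OF lin, symmetric] sharp)
qed

section \<open>Conformal change of the metric\<close>

locale conformal_change = levi_civita_manifold A g D
  for A :: "('m::{t2_space, second_countable_topology}, 'n::finite) chart set"
  and g :: "('m, 'n) metric" and D :: "('m, 'n) connection" +
  fixes gbar :: "('m, 'n) metric" and Dbar :: "('m, 'n) connection" and phi psi :: "'m \<Rightarrow> real"
  assumes dim4: "CARD('n) \<ge> 4"
    and smooth_phi: "smooth_fun_on A UNIV phi"
    and psi: "psi = (\<lambda>p. exp (phi p))"
    and gbar: "gbar = (\<lambda>p v w. psi p powi (-2) * g p v w)"
    and connection_bar: "levi_civita A gbar Dbar"
begin

section \<open>The Levi-Civita connection of the new metric\<close>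

definition conf_factor :: "'m \<Rightarrow> real" where "conf_factor p = exp (- 2 * phi p)"

lemma conf_factor_pos: "conf_factor p > 0"
  by (simp add: conf_factor_def)

lemma gbar_eq: "gbar p v w = conf_factor p * g p v w"
proof -
  have "exp (phi p) powi (-2) = exp (- 2 * phi p)"
    by (simp add: power_int_minus exp_minus exp_double)
  then show ?thesis by (simp add: gbar psi conf_factor_def)
qed

lemma phi_near: "smooth_fun_near A p phi"
  unfolding smooth_fun_near_def using smooth_phi by blast

lemma conf_factor_differentiable: "differentiable_fun_at p conf_factor" "dir_deriv A p v conf_factor = - 2 * conf_factor p * dir_deriv A p v phi"
proof -
  have "(conf_factor \<circ> chart_inv (chart_at A p) has_derivative (\<lambda>v. - 2 * conf_factor p * dir_deriv A p v phi))
      (at (snd (chart_at A p) p))"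
    using has_derivative_exp[OF has_derivative_mult_right[OF
          dir_deriv_has_derivative[OF smooth_imp_differentiable[OF phi_near[of p]]], of "-2"]]
    by (simp add: conf_factor_def[abs_def] o_def mult_ac)
  then show "differentiable_fun_at p conf_factor" "dir_deriv A p v conf_factor = - 2 * conf_factor p * dir_deriv A p v phi"
    by (rule dir_derivI)+
qed

definition grad :: "'m \<Rightarrow> real ^ 'n" where
  "grad p = frame_sharp (frame p) (\<lambda>v. dir_deriv A p v phi)"

lemma dphi: "dir_deriv A p v phi = g p (grad p) v"
  unfolding grad_def
  by (rule g_frame_sharp[OF inner_like_g frame_scaled curvature_like_weyl
        dir_deriv_linear[OF smooth_imp_differentiable[OF phi_near]], symmetric])

lemma Dbar_torsion_free:
  "smooth_field_near A p X \<Longrightarrow> smooth_field_near A p Y \<Longrightarrow>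
    Dbar p (X p) Y - Dbar p (Y p) X = lie_bracket A X Y p"
  by (rule connection_bar[unfolded levi_civita_def, THEN conjunct2, THEN conjunct1, rule_format])

lemma Dbar_metric:
  assumes Y: "smooth_field_near A p Y" and Z: "smooth_field_near A p Z"
  shows "g p (D p v Y) (Z p) + g p (Y p) (D p v Z) - 2 * g p (grad p) v * g p (Y p) (Z p) =
    g p (Dbar p v Y) (Z p) + g p (Y p) (Dbar p v Z)"
proof -
  have "dir_deriv A p v (\<lambda>q. gbar q (Y q) (Z q)) = gbar p (Dbar p v Y) (Z p) + gbar p (Y p) (Dbar p v Z)"
    by (rule connection_bar[unfolded levi_civita_def, THEN conjunct2, THEN conjunct2, rule_format, OF Y Z])
  moreover have "dir_deriv A p v (\<lambda>q. gbar q (Y q) (Z q)) =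
      conf_factor p * (g p (D p v Y) (Z p) + g p (Y p) (D p v Z)) - 2 * conf_factor p * g p (grad p) v * g p (Y p) (Z p)"
    unfolding gbar_eq
    by (simp add: differentiable_fun_at_mult conf_factor_differentiable smooth_imp_differentiable[OF smooth_metric[OF Y Z]]
        D_metric[OF Y Z] dphi)
  ultimately have "conf_factor p * (g p (D p v Y) (Z p) + g p (Y p) (D p v Z) - 2 * g p (grad p) v * g p (Y p) (Z p)) =
      conf_factor p * (g p (Dbar p v Y) (Z p) + g p (Y p) (Dbar p v Z))"
    by (simp add: gbar_eq algebra_simps)
  then show ?thesis using conf_factor_pos[of p] by simp
qed

text \<open>The difference of the two sides, as a function of three fields, is symmetric in the first two
  and antisymmetric in the last two arguments, hence zero.\<close>

lemma Dbar_eq: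
  assumes Y: "smooth_field_near A p Y"
  shows "Dbar p v Y = D p v Y - g p (grad p) v *\<^sub>R Y p - g p (grad p) (Y p) *\<^sub>R v + g p v (Y p) *\<^sub>R grad p"
proof (rule g_nondegenerate[of p])
  fix t
  define X where "X = extend A p v"
  define Z where "Z = extend A p t"
  have X: "smooth_field_near A p X" "X p = v" and Z: "smooth_field_near A p Z" "Z p = t"
    by (simp_all add: X_def Z_def)
  let ?G = "grad p"
  define B where "B U V = Dbar p (U p) V -
    (D p (U p) V - g p ?G (U p) *\<^sub>R V p - g p ?G (V p) *\<^sub>R U p + g p (U p) (V p) *\<^sub>R ?G)"
    for U V :: "'m \<Rightarrow> real ^ 'n"
  have sym: "B U V = B V U" if "smooth_field_near A p U" "smooth_field_near A p V" for U V
    using D_torsion_free[OF that] Dbar_torsion_free[OF that] by (simp add: B_def g_sym[of p "V p" "U p"] algebra_simps)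
  have skew: "g p (B U V) (Y p) = - g p (B U Y) (V p)"
    if "smooth_field_near A p U" "smooth_field_near A p V" "smooth_field_near A p Y" for U V Y
    using Dbar_metric[OF that(2,3), of "U p"]
      g_sym[of p "V p" "D p (U p) Y"] g_sym[of p "V p" "Dbar p (U p) Y"] g_sym[of p "Y p" "V p"]
    by (simp add: B_def g_simps) (simp add: algebra_simps)
  have "g p (B X Y) (Z p) = - g p (B X Z) (Y p)" "g p (B Z X) (Y p) = - g p (B Z Y) (X p)"
    "g p (B Y Z) (X p) = - g p (B Y X) (Z p)"
    using skew X Y Z by blast+
  moreover have "B X Z = B Z X" "B Z Y = B Y Z" "B Y X = B X Y" using sym X Y Z by blast+
  ultimately have "g p (B X Y) (Z p) = 0" by simp
  then show "g p (Dbar p v Y) t =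
      g p (D p v Y - g p ?G v *\<^sub>R Y p - g p ?G (Y p) *\<^sub>R v + g p v (Y p) *\<^sub>R ?G) t"
    by (simp add: B_def X Z g_simps)
qed

text \<open>\<open>grad\<close> is built from a frame chosen point by point, so its smoothness comes
  from the connections: \<open>Dbar_eq\<close> along Y gives Dbar_Y Y - D_Y Y + 2 df(Y) Y = g(Y,Y)
  G, whose left side is smooth because both connections preserve smooth fields. A coordinate field
  with nonzero components has no zeros in its chart, which permits the division.\<close>

lemma smooth_grad: "smooth_field_near A p grad"
proof -
  obtain y :: "real ^ 'n" where y: "y \<noteq> 0" using axis_eq_0_iff[of _ "1::real"] by blast
  let ?Y = "extend A p y"
  let ?K = "\<lambda>q. Dbar q (?Y q) ?Y - D q (?Y q) ?Y + (2 * dir_deriv A q (?Y q) phi) *\<^sub>R ?Y q"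
  have aff: "affine_connection A Dbar" using connection_bar unfolding levi_civita_def by blast
  have K: "smooth_field_near A p ?K"
    by (intro smooth_field_near_add smooth_field_near_diff affine_connection_smooth[OF aff] D_smooth
        smooth_field_near_scaleR smooth_fun_near_mult smooth_fun_near_const smooth_dir_deriv_extend phi_near
        smooth_field_near_extend' chart_at_in)
  have gY: "g q (?Y q) (?Y q) \<noteq> 0" if "q \<in> fst (chart_at A p)" for q
    using g_pos[of "?Y q" q] extend_eq_0_iff[OF that] y by auto
  have "smooth_field_near A p (\<lambda>q. inverse (g q (?Y q) (?Y q)) *\<^sub>R ?K q)"
    by (intro smooth_field_near_scaleR K smooth_fun_near_inverse[OF smooth_metric open_chart_domain[of "chart_at A p"]])
      (simp_all add: gY)
  then show ?thesis
  proof (rule smooth_field_near_cong[OF _ open_chart_domain[of "chart_at A p"]])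
    fix q assume q: "q \<in> fst (chart_at A p)"
    have "?K q = g q (?Y q) (?Y q) *\<^sub>R grad q"
      unfolding Dbar_eq[OF smooth_field_near_extend[OF q]] dphi by (simp add: vec_eq_iff)
    then show "inverse (g q (?Y q) (?Y q)) *\<^sub>R ?K q = grad q"
      using gY[OF q] by simp
  qed simp_all
qed

section \<open>The Hessian and the change of curvature\<close>

definition hess :: "'m \<Rightarrow> real ^ 'n \<Rightarrow> real ^ 'n \<Rightarrow> real" where
  "hess p x y = g p (D p x grad) y"

text \<open>Differentiating df(Y) along x gives the Hessian plus df(D_x Y). For coordinate fields
  the left side is symmetric, and so is the correction since they commute.\<close>

lemma hess_sym: "hess p x y = hess p y x"
proof -
  have "dir_deriv A p x (\<lambda>q. dir_deriv A q (extend A p y q) phi) = hess p x y + g p (grad p) (D p x (extend A p y))" for x y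
    unfolding dphi by (simp add: D_metric smooth_grad hess_def)
  then show ?thesis
    using dir_deriv_commute[OF phi_near, of p x y] D_extend_commute[OF chart_at_in(2), of p x y] by simp
qed

lemma hess_bilinear: "bilinear (hess p)"
proof -
  have "linear (hess p x)" for x
    using bilinear_linear(2)[OF g_bilinear] unfolding hess_def[abs_def] .
  then show ?thesis
    unfolding bilinear_def by (simp add: hess_sym[of p _ y for y])
qed

definition schouten_change :: "'m \<Rightarrow> real ^ 'n \<Rightarrow> real ^ 'n \<Rightarrow> real" where
  "schouten_change p x y = hess p x y + g p (grad p) x * g p (grad p) y - 1/2 * g p (grad p) (grad p) * g p x y"

lemma schouten_change_sym: "schouten_change p x y = schouten_change p y x"
  by (simp add: schouten_change_def hess_sym[of p x] g_sym[of p x y] mult.commute)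

lemma schouten_change_bilinear: "bilinear (schouten_change p)"
  unfolding bilinear_def schouten_change_def
  by (intro conjI allI linearI)
    (simp_all add: g_simps bilinear_ladd[OF hess_bilinear] bilinear_radd[OF hess_bilinear]
      bilinear_lmul[OF hess_bilinear] bilinear_rmul[OF hess_bilinear] algebra_simps)

text \<open>\<open>Dbar_eq\<close> is inserted for the inner derivative as an identity of fields
  near \<open>p\<close>, and for the outer one at \<open>p\<close>. Keeping first derivatives
  explicit lets the antisymmetrisation in \<open>curvature_op_bar\<close> cancel them.\<close>

lemma Dbar_Dbar:
  fixes p x y z
  defines "Y \<equiv> extend A p y" and "Z \<equiv> extend A p z" and "G \<equiv> grad p"
  shows "g p (Dbar p x (\<lambda>q. Dbar q (Y q) Z)) t =
    g p (D p x (\<lambda>q. D q (Y q) Z)) t - (hess p x y + g p G (D p x Y)) * g p z t - g p G y * g p (D p x Z) t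
    - (hess p x z + g p G (D p x Z)) * g p y t - g p G z * g p (D p x Y) t
    + (g p (D p x Y) z + g p y (D p x Z)) * g p G t + g p y z * hess p x t
    - g p G x * (g p (D p y Z) t - g p G y * g p z t - g p G z * g p y t + g p y z * g p G t)
    - (g p G (D p y Z) - 2 * g p G y * g p G z + g p y z * g p G G) * g p x t
    + (g p x (D p y Z) - g p G y * g p x z - g p G z * g p x y + g p y z * g p G x) * g p G t"
proof -
  have Y: "smooth_field_near A p Y" "Y p = y" and Z: "smooth_field_near A p Z" "Z p = z"
    by (simp_all add: Y_def Z_def)
  let ?K = "\<lambda>q. Dbar q (Y q) Z"
  let ?K' = "\<lambda>q. D q (Y q) Z - g q (grad q) (Y q) *\<^sub>R Z q - g q (grad q) (Z q) *\<^sub>R Y q + g q (Y q) (Z q) *\<^sub>R grad q"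
  note sm = smooth_grad Y(1) Z(1) smooth_metric smooth_field_near_scaleR smooth_field_near_diff
    smooth_field_near_add D_smooth
  have K': "smooth_field_near A p ?K'"
    by (intro smooth_field_near_add smooth_field_near_diff smooth_field_near_scaleR D_smooth smooth_metric
        smooth_grad Y(1) Z(1))
  have o: "open (fst (chart_at A p))" "p \<in> fst (chart_at A p)" by (simp_all add: open_chart_domain)
  have eq: "?K' q = ?K q" if "q \<in> fst (chart_at A p)" for q
    unfolding Z_def by (rule Dbar_eq[OF smooth_field_near_extend[OF that], symmetric])
  have K: "smooth_field_near A p ?K" by (rule smooth_field_near_cong[OF K' o eq])
  have Kp: "?K p = D p y Z - g p G y *\<^sub>R z - g p G z *\<^sub>R y + g p y z *\<^sub>R G"
    using eq[OF o(2)] by (simp add: Y Z G_def)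
  have "D p x ?K = D p x ?K'" by (rule D_local[OF K K' o eq[symmetric]])
  also have "\<dots> = D p x (\<lambda>q. D q (Y q) Z)
     - ((hess p x y + g p G (D p x Y)) *\<^sub>R z + g p G y *\<^sub>R D p x Z)
     - ((hess p x z + g p G (D p x Z)) *\<^sub>R y + g p G z *\<^sub>R D p x Y)
     + ((g p (D p x Y) z + g p y (D p x Z)) *\<^sub>R G + g p y z *\<^sub>R D p x grad)"
    by (simp add: D_add D_diff D_scaleR sm D_metric Y(2) Z(2) hess_def G_def)
  finally have DK: "D p x ?K = \<dots>" .
  show ?thesis
    unfolding Dbar_eq[OF K] DK Kp hess_def G_def[symmetric]
    by (simp add: g_simps g_sym[of p x G] algebra_simps)
qed

lemma curvature_op_bar:
  "g p (curvature_op A Dbar p x y z) t = riemann A g D p x y z t + kulkarni_nomizu g schouten_change p x y z t"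
proof -
  let ?X = "extend A p x" and ?Y = "extend A p y" and ?Z = "extend A p z" and ?G = "grad p"
  have 0: "Dbar p 0 ?Z = 0"
    using linear_0[OF D_linear[of p ?Z]] by (simp add: Dbar_eq g_simps)
  have c: "D p y ?X = D p x ?Y"
    using D_extend_commute[OF chart_at_in(2), of p x y] by simp
  have "g p (curvature_op A Dbar p x y z) t = g p (Dbar p x (\<lambda>q. Dbar q (?Y q) ?Z)) t - g p (Dbar p y (\<lambda>q. Dbar q (?X q) ?Z)) t"
    by (simp add: curvature_op_def Let_def lie_bracket_extend 0 g_simps)
  also have "\<dots> = g p (D p x (\<lambda>q. D q (?Y q) ?Z)) t - g p (D p y (\<lambda>q. D q (?X q) ?Z)) t + kulkarni_nomizu g schouten_change p x y z t"
    unfolding Dbar_Dbar c kulkarni_nomizu_def schouten_change_def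
    using hess_sym[of p x y] hess_sym[of p x z] hess_sym[of p y z] g_sym[of p y x] g_sym[of p z x] g_sym[of p z y]
    by (simp add: algebra_simps)
  finally show ?thesis
    by (simp add: riemann_def curvature_op_eq curv_field_def g_simps)
qed

lemma ricci_bar:
  "ricci A Dbar p x y = ricci A D p x y + (real CARD('n) - 2) * schouten_change p x y
    + g p x y * (\<Sum>i\<in>UNIV. schouten_change p (frame p i) (frame p i))"
proof -
  have kn: "curvature_like (kulkarni_nomizu g schouten_change p)"
    by (intro curvature_like_kulkarni_nomizu g_bilinear g_sym schouten_change_bilinear schouten_change_sym)
  have "linear (\<lambda>v. curvature_op A Dbar p v x y)"
  proof (rule linearI; rule g_nondegenerate[of p])
    note l = curvature_like_linear(1)[OF curvature_like_riemann] curvature_like_linear(1)[OF kn]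
    show "g p (curvature_op A Dbar p (a + b) x y) t =
        g p (curvature_op A Dbar p a x y + curvature_op A Dbar p b x y) t" for a b t
      by (simp add: g_simps curvature_op_bar l[THEN linear_add])
    show "g p (curvature_op A Dbar p (r *\<^sub>R a) x y) t = g p (r *\<^sub>R curvature_op A Dbar p a x y) t" for r a t
      by (simp add: g_simps curvature_op_bar l[THEN linear_scale] algebra_simps)
  qed
  from trace_frame[OF inner_like_g[of p] frame_scaled[of p] this] show ?thesis
    unfolding ricci_def[of A Dbar] curvature_op_bar
    by (simp add: sum.distrib ricci_frame
        kulkarni_nomizu_trace[of g p, OF inner_like_g frame_scaled schouten_change_bilinear schouten_change_sym])
qed

section \<open>Frames, Schouten and Weyl tensors of the new metric\<close>

lemma inner_like_gbar: "inner_like (gbar p)"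
  unfolding inner_like_def bilinear_def gbar_eq
  using conf_factor_pos[of p] g_pos[of _ p]
  by (auto intro!: linearI simp: g_simps g_sym algebra_simps)

abbreviation frame_bar :: "'m \<Rightarrow> 'n \<Rightarrow> real ^ 'n" where "frame_bar \<equiv> orthonormal_frame gbar"

lemma frame_bar_scaled: "scaled_frame (g p) (1 / conf_factor p) (frame_bar p)"
  using orthonormal_frame_scaled[of gbar p, OF inner_like_gbar] conf_factor_pos[of p]
  unfolding scaled_frame_def gbar_eq by (auto simp: field_simps split: if_splits)

text \<open>The trace of \<open>schouten_change\<close> enters both the Ricci tensor and the scalar
  curvature, and the constant 1/(2(n-1)) is exactly what cancels the two. The factor of the new
  frame cancels that of \<open>gbar\<close>.\<close>

lemma schouten_bar: "schouten A gbar Dbar p x y = schouten A g D p x y + schouten_change p x y"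
proof -
  let ?n = "real CARD('n)" and ?t = "\<Sum>i\<in>UNIV. schouten_change p (frame p i) (frame p i)" and ?S = "scalar_curvature A g D p"
  have n: "?n \<ge> 4" using dim4 by simp
  let ?B = "\<lambda>x y. ricci A D p x y + (?n - 2) * schouten_change p x y + g p x y * ?t"
  have "bilinear ?B"
    unfolding bilinear_def
    by (intro conjI allI linearI)
      (simp_all add: g_simps bilinear_ladd[OF schouten_change_bilinear] bilinear_radd[OF schouten_change_bilinear]
        bilinear_lmul[OF schouten_change_bilinear] bilinear_rmul[OF schouten_change_bilinear] bilinear_ladd[OF ricci_bilinear]
        bilinear_radd[OF ricci_bilinear] bilinear_lmul[OF ricci_bilinear] bilinear_rmul[OF ricci_bilinear] algebra_simps)
  from frame_trace[OF inner_like_g frame_scaled frame_bar_scaled this]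
  have "scalar_curvature A gbar Dbar p = 1 / conf_factor p * (\<Sum>i\<in>UNIV. ?B (frame p i) (frame p i))"
    unfolding scalar_curvature_def ricci_bar .
  also have "(\<Sum>i\<in>UNIV. ?B (frame p i) (frame p i)) = ?S + (?n - 2) * ?t + ?n * ?t"
    using frame_scaled[of p] unfolding scaled_frame_def
    by (simp add: sum.distrib sum_distrib_left[symmetric] scalar_curvature_def)
  also have "\<dots> = ?S + 2 * (?n - 1) * ?t" by (simp add: algebra_simps)
  finally have "scalar_curvature A gbar Dbar p * gbar p x y = (?S + 2 * (?n - 1) * ?t) * g p x y"
    unfolding gbar_eq[of p x y] using conf_factor_pos[of p] by simp
  then have "schouten A gbar Dbar p x y = 1 / (?n - 2) * (?B x y - 1 / (2 * (?n - 1)) * ((?S + 2 * (?n - 1) * ?t) * g p x y))"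
    by (simp only: schouten_def Let_def ricci_bar mult.assoc)
  also have "1 / (2 * (?n - 1)) * ((?S + 2 * (?n - 1) * ?t) * g p x y) = 1 / (2 * (?n - 1)) * ?S * g p x y + g p x y * ?t"
    using n by (simp add: divide_simps) (simp add: algebra_simps)
  also have "1 / (?n - 2) * (?B x y - (1 / (2 * (?n - 1)) * ?S * g p x y + g p x y * ?t)) =
      1 / (?n - 2) * (ricci A D p x y - 1 / (2 * (?n - 1)) * ?S * g p x y) + 1 / (?n - 2) * ((?n - 2) * schouten_change p x y)"
    by (simp only: right_diff_distrib[symmetric] distrib_left[symmetric]) simp
  also have "\<dots> = schouten A g D p x y + schouten_change p x y"
    using n by (simp add: schouten_def Let_def)
  finally show ?thesis .
qed

text \<open>The curvature gains the Kulkarni-Nomizu product of \<open>g\<close> with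
  \<open>schouten_change\<close>, the very term by which the subtracted product grows.\<close>

lemma weyl_bar: "weyl A gbar Dbar p x y z t = conf_factor p * weyl A g D p x y z t"
  unfolding weyl_def riemann_def[of A gbar] kulkarni_nomizu_def[of gbar] schouten_bar gbar_eq curvature_op_bar
  by (simp add: kulkarni_nomizu_def algebra_simps)

section \<open>Changes of the divergence, of the vector field and of the Schouten derivative\<close>

lemma curvature_like_weyl_bar: "curvature_like (weyl A gbar Dbar p)"
proof -
  note W = curvature_likeD[OF curvature_like_weyl[of p]]
  show ?thesis
    unfolding curvature_like_def
  proof (intro conjI allI)
    fix x y z t
    let ?w = "weyl A gbar Dbar p"
    show "?w x y z t = - ?w y x z t" unfolding weyl_bar using W(1)[of x y z t] by simp
    show "?w x y z t = - ?w x y t z" unfolding weyl_bar using W(2)[of x y z t] by simp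
    show "?w x y z t + ?w y z x t + ?w z x y t = 0"
      unfolding weyl_bar by (simp only: distrib_left[symmetric] W(3) mult_zero_right)
    show "linear (?w x y z)"
      using W(4)[of x y z] by (intro linearI) (simp_all add: weyl_bar linear_add linear_scale algebra_simps)
  qed
qed

lemma div_weyl_bar:
  "div_weyl A gbar Dbar p x y z = div_weyl A g D p x y z - (real CARD('n) - 3) * weyl A g D p x y z (grad p)"
proof -
  let ?n = "real CARD('n)" and ?G = "grad p" and ?e = "frame p"
  let ?W = "weyl A g D p"
  note c = curvature_like_weyl[of p]
  note W = curvature_like_linear[OF c]
  note l = W[THEN linear_add] W[THEN linear_scale] W[THEN linear_diff]
  \<comment> \<open>The coefficient 2 is 4 - 2: each of the four slots contributes df(v) W through
    \<open>Dbar_eq\<close>, and differentiating the conformal factor removes twice that. The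
    remaining terms are the other two corrections of \<open>Dbar_eq\<close>, slot by slot.\<close>
  define Q where "Q v t = cov_weyl p v x y z t + 2 * (g p ?G v * ?W x y z t)
     + g p ?G x * ?W v y z t + g p ?G y * ?W x v z t + g p ?G z * ?W x y v t + g p ?G t * ?W x y z v
     - g p v x * ?W ?G y z t - g p v y * ?W x ?G z t - g p v z * ?W x y ?G t - g p v t * ?W x y z ?G" for v t
  have cov: "cov_deriv4 A Dbar (weyl A gbar Dbar) p v x y z t = conf_factor p * Q v t" for v t
  proof -
    let ?w = "\<lambda>q. weyl A g D q (extend A p x q) (extend A p y q) (extend A p z q) (extend A p t q)"
    have "dir_deriv A p v (\<lambda>q. conf_factor q * ?w q) = conf_factor p * dir_deriv A p v ?w - 2 * conf_factor p * g p ?G v * ?W x y z t"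
      by (simp add: differentiable_fun_at_mult conf_factor_differentiable differentiable_weyl dphi)
    then show ?thesis
      unfolding cov_deriv4_def Let_def weyl_bar Q_def
      by (simp add: Dbar_eq l) (simp add: algebra_simps)
  qed
  have "bilinear Q"
    unfolding bilinear_def
  proof (intro conjI allI linearI)
    note C = linear_cov_weyl[of p] curvature_like_linear(4)[OF curvature_like_cov_weyl[of p]]
    note Cl = C[THEN linear_add] C[THEN linear_scale]
    show "Q v (t + t') = Q v t + Q v t'" "Q (v + v') t = Q v t + Q v' t"
      "Q v (r *\<^sub>R t) = r *\<^sub>R Q v t" "Q (r *\<^sub>R v) t = r *\<^sub>R Q v t" for v v' t t' r
      unfolding Q_def by (simp_all add: Cl l(1-8) g_simps distrib_left distrib_right, simp_all add: algebra_simps)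
  qed
  from frame_trace[OF inner_like_g frame_scaled frame_bar_scaled this]
  have "div_weyl A gbar Dbar p x y z = (\<Sum>i\<in>UNIV. Q (?e i) (?e i))"
    unfolding div_weyl_def Let_def cov using conf_factor_pos[of p] by (simp add: sum_distrib_left[symmetric])
  \<comment> \<open>Contracting leaves 2 + 1 - n = -(n - 3) copies of W(x,y,z,G): the 1 comes from
    the slot of \<open>t\<close>, the n from the trace of the metric. Three contractions vanish
    since W is trace-free and antisymmetric; the three terms with G in another slot cancel by the
    first Bianchi identity.\<close>
  also have "\<dots> = div_weyl A g D p x y z + 2 * ?W x y z ?G + g p ?G x * 0 + g p ?G y * 0 + g p ?G z * 0 + ?W x y z ?G
     - ?W ?G y z x - ?W x ?G z y - ?W x y ?G z - ?n * ?W x y z ?G"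
  proof -
    note f = frame_contract[OF inner_like_g[of p] frame_scaled[of p]]
    have 1: "(\<Sum>i\<in>UNIV. ?W (?e i) y z (?e i)) = 0" by (rule weyl_trace_free[OF dim4])
    have 2: "(\<Sum>i\<in>UNIV. ?W x (?e i) z (?e i)) = 0"
      using weyl_trace_free[OF dim4, of p x z] curvature_likeD(1)[OF c, of x] by (simp add: sum_negf)
    have "?W x y u u = 0" for u using curvature_likeD(2)[OF c, of x y u u] by simp
    then have 3: "(\<Sum>i\<in>UNIV. ?W x y (?e i) (?e i)) = 0" by simp
    have 4: "(\<Sum>i\<in>UNIV. g p (?e i) (?e i)) = ?n"
      using frame_scaled[of p] by (simp add: scaled_frame_def)
    show ?thesis
      unfolding Q_def sum.distrib sum_subtractf sum_distrib_left[symmetric] sum_distrib_right[symmetric]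
        f(1)[OF W(4)] f(2)[OF W(4)] 1 2 3 4 div_weyl_def Let_def by simp
  qed
  also have "\<dots> = div_weyl A g D p x y z - (?n - 3) * ?W x y z ?G"
  proof -
    have "?W ?G y z x = - ?W z x y ?G"
      using curvature_like_pair[OF c, of ?G y z x] curvature_likeD(2)[OF c, of z x ?G y] by simp
    moreover have "?W x ?G z y = - ?W y z x ?G"
      using curvature_like_pair[OF c, of x ?G z y] curvature_likeD(1)[OF c, of z y x ?G] by simp
    moreover have "?W x y ?G z = - ?W x y z ?G" by (rule curvature_likeD(2)[OF c])
    ultimately have "?W ?G y z x + ?W x ?G z y + ?W x y ?G z = 0"
      using curvature_likeD(3)[OF c, of x y z ?G] by linarith
    then show ?thesis by (simp add: algebra_simps)
  qed
  finally show ?thesis .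
qed

text \<open>With c the inverse of \<open>conf_factor p\<close>, \<open>curv_form\<close> scales by c
  and \<open>curv_op\<close> by c^2, since the new metric raises the index; the source vector scales
  by c^3 up to the gradient term. The pseudo-inverse scales by c^-2, and the field by c.\<close>

lemma T_field_bar:
  "weyl A g D p x y z (T_field A gbar Dbar p) = 1 / conf_factor p * (weyl A g D p x y z (T_field A g D p) - weyl A g D p x y z (grad p))"
proof -
  let ?n = "real CARD('n)" and ?G = "grad p" and ?e = "frame p" and ?e' = "frame_bar p"
  let ?W = "weyl A g D p" and ?c = "1 / conf_factor p"
  have n: "?n \<ge> 4" using dim4 by simp
  have sc: "conf_factor p \<noteq> 0" using conf_factor_pos[of p] by simp
  note c = curvature_like_weyl[of p] and c' = curvature_like_weyl_bar[of p]
  note b = inner_like_g[of p] and b' = inner_like_gbar[of p]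
  note e = frame_scaled[of p] and e' = frame_bar_scaled[of p]
  have e'1: "scaled_frame (gbar p) 1 ?e'" by (rule orthonormal_frame_scaled[of gbar p, OF b'])
  have Wbar: "weyl A gbar Dbar p = (\<lambda>x y z t. conf_factor p * ?W x y z t)" by (intro ext) (rule weyl_bar)
  let ?w = "curv_op ?W ?e"
  define L where "L v = (\<Sum>i\<in>UNIV. curv_action ?W ?e (\<lambda>x y. div_weyl A g D p x y (?e i)) (?e i) v)" for v
  define L' where "L' v = (\<Sum>i\<in>UNIV. curv_action (weyl A gbar Dbar p) ?e' (\<lambda>x y. div_weyl A gbar Dbar p x y (?e' i)) (?e' i) v)" for v
  have L: "linear L" "linear L'"
    unfolding L_def L'_def by (intro linear_compose_sum ballI curv_action_linear(2) c c')+
  have Wbil: "bilinear (?W u X)" for u X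
    unfolding bilinear_def using curvature_like_linear[OF c] by blast
  \<comment> \<open>Two Weyl tensors against three contractions leave one factor
    \<open>?c\<close>.\<close>
  have form: "curv_form (weyl A gbar Dbar p) ?e' X Y = ?c * curv_form ?W ?e X Y" for X Y
  proof -
    let ?B = "\<lambda>u v. curv_action ?W ?e (?W u X) v Y"
    have "bilinear ?B"
      unfolding bilinear_def
    proof (intro conjI allI)
      show "linear (?B u)" for u by (rule curv_action_linear(1)[OF c])
      note l = curvature_like_linear(1)[OF c]
      show "linear (\<lambda>u. ?B u v)" for v
      proof (rule linearI)
        have "?W (u + u') X = (\<lambda>a b. ?W u X a b + ?W u' X a b)" for u u'
          by (intro ext) (rule linear_add[OF l])
        then show "?B (u + u') v = ?B u v + ?B u' v" for u u' by (simp add: curv_action_add)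
        have "?W (r *\<^sub>R u) X = (\<lambda>a b. r * ?W u X a b)" for u r
          by (intro ext) (use linear_scale[OF l] in simp)
        then show "?B (r *\<^sub>R u) v = r *\<^sub>R ?B u v" for u r by (simp add: curv_action_cmult)
      qed
    qed
    from frame_trace[OF b e e' this]
    have "(\<Sum>i\<in>UNIV. ?B (?e' i) (?e' i)) = ?c * curv_form ?W ?e X Y" by (simp add: curv_form_def)
    then show ?thesis
      unfolding curv_form_def[of _ ?e'] Wbar curv_action_scale curv_action_cmult
        curv_action_frame[OF b e e' Wbil c] using sc by (simp add: sum_distrib_left[symmetric])
  qed
  have op: "curv_op (weyl A gbar Dbar p) ?e' = (\<lambda>X. (?c * ?c) *\<^sub>R ?w X)"
  proof
    fix X show "curv_op (weyl A gbar Dbar p) ?e' X = (?c * ?c) *\<^sub>R ?w X"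
    proof (rule g_nondegenerate[of p])
      fix t
      have "conf_factor p * g p (curv_op (weyl A gbar Dbar p) ?e' X) t = ?c * g p (?w X) t"
        using g_curv_op[OF b' e'1 c', of X t] by (simp add: gbar_eq form g_curv_op[OF b e c])
      then show "g p (curv_op (weyl A gbar Dbar p) ?e' X) t = g p ((?c * ?c) *\<^sub>R ?w X) t"
        using sc by (simp add: g_simps field_simps)
    qed
  qed
  \<comment> \<open>One Weyl tensor against three contractions leaves \<open>?c * ?c\<close>;
    \<open>div_weyl_bar\<close> adds no factor of its own.\<close>
  have L'_eq: "L' v = ?c * ?c * (L v - (?n - 3) * curv_form ?W ?e ?G v)" for v
  proof -
    let ?d = "\<lambda>z x y. div_weyl A gbar Dbar p x y z"
    let ?B = "\<lambda>z u. curv_action ?W ?e (?d z) u v"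
    note C = curvature_like_linear[OF curvature_like_cov_weyl]
    have dl: "linear (\<lambda>x. ?d z x y)" "linear (\<lambda>y. ?d z x y)" "linear (\<lambda>z. ?d z x y)" for x y z
      unfolding div_weyl_bar unfolding div_weyl_def Let_def
      by (intro linear_compose_sub linear_compose_sum ballI C
          linear_compose_scale_right[where 'b = real, simplified] curvature_like_linear[OF c])+
    have dbil: "bilinear (?d z)" for z unfolding bilinear_def using dl by blast
    have "bilinear ?B"
      unfolding bilinear_def
    proof (intro conjI allI)
      show "linear (?B z)" for z by (rule curv_action_linear(1)[OF c])
      show "linear (\<lambda>z. ?B z u)" for u
      proof (rule linearI)
        have "?d (z + z') = (\<lambda>x y. ?d z x y + ?d z' x y)" for z z'
          by (intro ext) (rule linear_add[OF dl(3)])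
        then show "?B (z + z') u = ?B z u + ?B z' u" for z z' by (simp add: curv_action_add)
        have "?d (r *\<^sub>R z) = (\<lambda>x y. r * ?d z x y)" for z r
          by (intro ext) (use linear_scale[OF dl(3)] in simp)
        then show "?B (r *\<^sub>R z) u = r *\<^sub>R ?B z u" for z r by (simp add: curv_action_cmult)
      qed
    qed
    from frame_trace[OF b e e' this]
    have "L' v = conf_factor p * (?c * ?c * (?c * (\<Sum>i\<in>UNIV. ?B (?e i) (?e i))))"
      unfolding L'_def Wbar curv_action_scale curv_action_frame[OF b e e' dbil c]
      by (simp only: sum_distrib_left[symmetric])
    moreover define r where "r = - (?n - 3)"
    \<comment> \<open>Pair symmetry turns the two-form W(.,.,z,G) into W(z,G,.,.), whose contraction
      is \<open>curv_form\<close> by definition.\<close>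
    have "?d z = (\<lambda>x y. div_weyl A g D p x y z + r * ?W z ?G x y)" for z
      using curvature_like_pair[OF c, of _ _ z ?G]
      by (intro ext) (simp add: div_weyl_bar r_def left_diff_distrib)
    then have "(\<Sum>i\<in>UNIV. ?B (?e i) (?e i)) = L v + r * curv_form ?W ?e ?G v"
      unfolding L_def curv_form_def
      by (simp add: curv_action_add curv_action_cmult sum.distrib sum_distrib_left[symmetric])
    ultimately show ?thesis using sc by (simp add: r_def left_diff_distrib)
  qed
  have Lsharp: "frame_sharp ?e' L' = (?c * ?c * ?c) *\<^sub>R (frame_sharp ?e L - (?n - 3) *\<^sub>R ?w ?G)"
  proof (rule g_nondegenerate[of p])
    fix t
    have "g p (frame_sharp ?e' L') t = ?c * L' t"
      using g_frame_sharp[OF b' e'1 c' L(2), of t] sc by (simp add: gbar_eq divide_simps mult.commute)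
    then show "g p (frame_sharp ?e' L') t = g p ((?c * ?c * ?c) *\<^sub>R (frame_sharp ?e L - (?n - 3) *\<^sub>R ?w ?G)) t"
      by (simp only: L'_eq g_simps g_frame_sharp[OF b e c L(1)] g_curv_op[OF b e c] real_scaleR_def mult.assoc)
  qed
  note sp = curv_op_splits[OF b e c]
  have T: "T_field A g D p = (1 / (?n - 3)) *\<^sub>R pseudo_inverse ?w (frame_sharp ?e L)"
    unfolding L_def by (rule T_field_eq[OF b c])
  have cc: "?c * ?c \<noteq> 0" using sc by simp
  have "T_field A gbar Dbar p = (1 / (?n - 3)) *\<^sub>R pseudo_inverse (\<lambda>X. (?c * ?c) *\<^sub>R ?w X) (frame_sharp ?e' L')"
    unfolding op[symmetric] L'_def by (rule T_field_eq[OF b' c'])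
  also have "\<dots> = ?c *\<^sub>R (T_field A g D p - pseudo_inverse ?w (?w ?G))"
    unfolding T Lsharp pseudo_inverse_scaled_map[OF sp cc] pseudo_inverse_scale[OF sp] pseudo_inverse_diff[OF sp]
    using n sc by (simp add: scaleR_diff_right)
  finally have Tbar: "T_field A gbar Dbar p = ?c *\<^sub>R (T_field A g D p - pseudo_inverse ?w (?w ?G))" .
  have "?w (pseudo_inverse ?w (?w ?G) - ?G) = 0"
    using pseudo_inverse_kernel[OF sp, of ?G] by (simp add: linear_diff[OF curv_op_linear[OF b e c]])
  from curv_op_kernel[OF b e c this]
  have "?W x y z (pseudo_inverse ?w (?w ?G)) = ?W x y z ?G"
    by (simp add: linear_diff[OF curvature_like_linear(4)[OF c]])
  then show ?thesis
    unfolding Tbar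
    by (simp add: linear_diff[OF curvature_like_linear(4)[OF c]] linear_scale[OF curvature_like_linear(4)[OF c]])
qed

text \<open>Third derivatives of \<open>phi\<close> antisymmetrise to the curvature acting on
  \<open>grad\<close>. Its Kulkarni-Nomizu part cancels the terms that \<open>Dbar_eq\<close>
  produces from \<open>schouten\<close>; those produced from \<open>schouten_change\<close> cancel
  against the products of gradient and Hessian.\<close>

lemma d_nabla_schouten_bar:
  "d_nabla A Dbar (schouten A gbar Dbar) p x y z =
    d_nabla A D (schouten A g D) p x y z - weyl A g D p x y z (grad p)"
proof -
  let ?G = "grad p" and ?k = "schouten A g D"
  note kb = schouten_bilinear[of p]
  note kl = bilinear_ladd[OF kb] bilinear_radd[OF kb] bilinear_lsub[OF kb] bilinear_rsub[OF kb]
    bilinear_lmul[OF kb] bilinear_rmul[OF kb]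
  note cb = schouten_change_bilinear[of p]
  note cl = bilinear_ladd[OF cb] bilinear_radd[OF cb] bilinear_lsub[OF cb] bilinear_rsub[OF cb]
    bilinear_lmul[OF cb] bilinear_rmul[OF cb]
  \<comment> \<open>The second derivative of \<open>grad\<close> and its correction stay
    unevaluated: what is needed of them is the antisymmetric part, which is curvature.\<close>
  have cov: "cov_deriv2 A Dbar (schouten A gbar Dbar) p x y z =
      cov_deriv2 A D ?k p x y z + g p (D p x (\<lambda>q. D q (extend A p y q) grad)) z
      - g p (D p (D p x (extend A p y)) grad) z
      + hess p x y * g p ?G z + g p ?G y * hess p x z - hess p x ?G * g p y z
      + 2 * g p ?G x * (?k p y z + schouten_change p y z) + g p ?G y * (?k p x z + schouten_change p x z)
      + g p ?G z * (?k p y x + schouten_change p y x) - g p x y * (?k p ?G z + schouten_change p ?G z)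
      - g p x z * (?k p y ?G + schouten_change p y ?G)" for x y z
  proof -
    let ?Y = "extend A p y" and ?Z = "extend A p z"
    let ?H = "\<lambda>q. g q (D q (?Y q) grad) (?Z q)"
    have Y: "smooth_field_near A p ?Y" and Z: "smooth_field_near A p ?Z" by simp_all
    have H: "differentiable_fun_at p ?H" and gY: "differentiable_fun_at p (\<lambda>q. g q (grad q) (?Y q))"
      and gZ: "differentiable_fun_at p (\<lambda>q. g q (grad q) (?Z q))"
      and gG: "differentiable_fun_at p (\<lambda>q. g q (grad q) (grad q))"
      and gYZ: "differentiable_fun_at p (\<lambda>q. g q (?Y q) (?Z q))"
      by (intro smooth_imp_differentiable smooth_metric D_smooth Y Z smooth_grad)+
    have "dir_deriv A p x (\<lambda>q. schouten A gbar Dbar q (?Y q) (?Z q)) =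
        dir_deriv A p x (\<lambda>q. ?k q (?Y q) (?Z q) + (?H q + g q (grad q) (?Y q) * g q (grad q) (?Z q)
           - 1/2 * (g q (grad q) (grad q) * g q (?Y q) (?Z q))))"
      unfolding schouten_bar schouten_change_def hess_def by (simp only: mult.assoc)
    also have "\<dots> = dir_deriv A p x (\<lambda>q. ?k q (?Y q) (?Z q)) + (dir_deriv A p x ?H
       + dir_deriv A p x (\<lambda>q. g q (grad q) (?Y q) * g q (grad q) (?Z q))
       - 1/2 * dir_deriv A p x (\<lambda>q. g q (grad q) (grad q) * g q (?Y q) (?Z q)))"
      by (simp only: differentiable_fun_at_add differentiable_fun_at_diff differentiable_fun_at_cmult
          differentiable_fun_at_mult(1) differentiable_schouten H gY gZ gG gYZ)
    also have "dir_deriv A p x ?H = g p (D p x (\<lambda>q. D q (?Y q) grad)) z + hess p y (D p x ?Z)"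
      using D_metric[OF D_smooth[OF Y smooth_grad] Z, of x] by (simp add: hess_def)
    also have "dir_deriv A p x (\<lambda>q. g q (grad q) (?Y q) * g q (grad q) (?Z q)) =
        g p ?G y * (hess p x z + g p ?G (D p x ?Z)) + (hess p x y + g p ?G (D p x ?Y)) * g p ?G z"
      by (simp add: differentiable_fun_at_mult(2)[OF gY gZ] D_metric smooth_grad hess_def)
    also have "dir_deriv A p x (\<lambda>q. g q (grad q) (grad q) * g q (?Y q) (?Z q)) =
        g p ?G ?G * (g p (D p x ?Y) z + g p y (D p x ?Z)) + 2 * hess p x ?G * g p y z"
      by (simp add: differentiable_fun_at_mult(2)[OF gG gYZ] D_metric smooth_grad hess_def g_sym[of p ?G "D p x grad"])
    finally have d: "dir_deriv A p x (\<lambda>q. schouten A gbar Dbar q (?Y q) (?Z q)) =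
        dir_deriv A p x (\<lambda>q. ?k q (?Y q) (?Z q))
        + (g p (D p x (\<lambda>q. D q (?Y q) grad)) z + hess p y (D p x ?Z)
        + (g p ?G y * (hess p x z + g p ?G (D p x ?Z)) + (hess p x y + g p ?G (D p x ?Y)) * g p ?G z)
        - 1/2 * (g p ?G ?G * (g p (D p x ?Y) z + g p y (D p x ?Z)) + 2 * hess p x ?G * g p y z))" .
    have conf1: "schouten_change p (D p x ?Y) z = g p (D p (D p x ?Y) grad) z + g p ?G (D p x ?Y) * g p ?G z
        - 1/2 * g p ?G ?G * g p (D p x ?Y) z"
      and conf2: "schouten_change p y (D p x ?Z) = hess p y (D p x ?Z) + g p ?G y * g p ?G (D p x ?Z)
        - 1/2 * g p ?G ?G * g p y (D p x ?Z)"
      by (simp_all add: schouten_change_def hess_def)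
    show ?thesis
      unfolding cov_deriv2_def Let_def d
      unfolding schouten_bar Dbar_eq[OF Y] Dbar_eq[OF Z] extend_at kl cl conf1 conf2
      by (simp add: algebra_simps)
  qed
  have "g p (curv_field p x y grad) z = - riemann A g D p x y z ?G"
    using curv_field_skew[OF smooth_grad smooth_field_near_extend'[of p z], of x y]
    by (simp add: riemann_def curvature_op_eq g_sym[of p ?G])
  then have R: "g p (D p x (\<lambda>q. D q (extend A p y q) grad)) z - g p (D p y (\<lambda>q. D q (extend A p x q) grad)) z
      = - (weyl A g D p x y z ?G + kulkarni_nomizu g ?k p x y z ?G)"
    by (simp add: weyl_def curv_field_def g_simps)
  have sym: "g p y x = g p x y" "hess p y x = hess p x y" "?k p y x = ?k p x y"
    "hess p x ?G = hess p ?G x" "hess p y ?G = hess p ?G y" "?k p x ?G = ?k p ?G x" "?k p y ?G = ?k p ?G y"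
    "g p x ?G = g p ?G x" "g p y ?G = g p ?G y"
    by (rule g_sym hess_sym schouten_sym)+
  have c: "D p y (extend A p x) = D p x (extend A p y)"
    using D_extend_commute[OF chart_at_in(2), of p x y] by simp
  show ?thesis
    unfolding d_nabla_def cov using R unfolding kulkarni_nomizu_def schouten_change_def c sym
    by (simp add: algebra_simps)
qed

lemma C_T_bar: "C_T A gbar Dbar p x y z = C_T A g D p x y z"
  unfolding C_T_def d_nabla_schouten_bar weyl_bar T_field_bar using conf_factor_pos[of p] by simp

end

theorem proposition1:
  fixes A :: "('m::{t2_space, second_countable_topology}, 'n::finite) chart set"
    and g gbar :: "('m, 'n) metric"
    and D Dbar :: "('m, 'n) connection"
    and phi psi :: "'m \<Rightarrow> real"
  assumes "CARD('n) \<ge> 4"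
    and "smooth_atlas A"
    and "riemannian_metric A g"
    and "levi_civita A g D"
    and "smooth_fun_on A UNIV phi"
    and "psi = (\<lambda>p. exp (phi p))"
    and "gbar = (\<lambda>p v w. psi p powi (-2) * g p v w)"
    and "levi_civita A gbar Dbar"
  shows "\<forall>p \<in> M_E A g D. \<forall>x y z. C_T A gbar Dbar p x y z = C_T A g D p x y z"
proof -
  interpret conformal_change A g D gbar Dbar phi psi
    by unfold_locales (use assms in auto)
  show ?thesis by (simp add: C_T_bar)
qed

end
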